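(* Let $g$ be a semisimple isometry of a CAT(0) space $X$. The following are equivalent. (i) $g$ is contracting (or, equivalently, rank-one if $X$ is proper). (ii) $g$ skewers a pair of separated curtains. (iii) $g$ acts loxodromically on the curtain model $X_D$.
   Context: **Curtains.** Let $(X,d)$ be a CAT(0) space. A geodesic is an isometric embedding $\alpha:I\to X$ of an interval $I\subset\mathbb R$, and $\pi_\alpha:X\to\alpha$ is closest-point projection. For $r$ with $[r-\frac12,r+\frac12]$ in the interior of $I$, the curtain dual to $\alpha$ at $r$ is $h=h_{\alpha,r}=\pi_\alpha^{-1}(\alpha[r-\frac12,r+\frac12])$. Its halfspaces are $h^-=\pi_\alpha^{-1}\alpha(I\cap(-\infty,r-\frac12))$ and $h^+=\pi_\alpha^{-1}\alpha(I\cap(r+\frac12,\infty))$. The curtain $h$ separates $A,B\subset X$ if one of them is contained in $h^-$ and the other in $h^+$. A chain is a set of pairwise disjoint curtains $\{h_i\}$, indexed by consecutive integers, such that $h_i$ separates $h_{i-1}$ from $h_{i+1}$ for all $i$; it separates $A$ from $B$ if every $h_i$ does. **$L$-separation and $d_L$.** For $L\in\mathbb N=\{0,1,2,\dots\}$, disjoint curtains $h,h'$ are $L$-separated if every chain all of whose elements meet both $h$ and $h'$ has cardinality at most $L$; they are separated if they are $L$-separated for some $L\in\mathbb N$. An $L$-chain is a chain whose elements are pairwise $L$-separated. Set $d_L(x,x)=0$ and, for $x\neq y$, $d_L(x,y)=1+\max\{|c| : c \text{ is an } L\text{-chain separating } x \text{ from } y\}$. **Curtain model.** Fix numbers $\lambda_L\in(0,1)$,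 $L\ge1$, with $\sum\lambda_L<\sum L\lambda_L<\sum L^2\lambda_L=\Lambda<\infty$. Put $D(x,y)=\sum_{L=1}^\infty\lambda_L d_L(x,y)$. The curtain model is the (hyperbolic) space $X_D=(X,D)$, on which $\operatorname{Isom}X$ acts by isometries. **Isometries.** A geodesic $\gamma$ is $R$-contracting if $\operatorname{diam}\pi_\gamma(B)\le R$ for every ball $B$ disjoint from $\gamma$, and contracting if it is $R$-contracting for some $R$. An isometry is semisimple if its displacement function attains its infimum, and hyperbolic if moreover this infimum is positive (so that it has an axis). A hyperbolic isometry is contracting if one (hence all) of its axes is contracting. A rank-one isometry is a hyperbolic isometry with an axis that does not bound a flat half-plane. An isometry $g$ skewers curtains $h_1,h_2$ if, perhaps after relabelling (including the choice of halfspaces), there is $m\in\mathbb N$ such that $g^mh_1,h_2,h_1$ are pairwise disjoint and $g^mh_1^+\subsetneq h_2^+\subsetneq h_1^+$. An isometry acts loxodromically on a metric space if its orbit maps $\mathbb Z\to$ (space), $n\mapsto g^nx$, are quasiisometric embeddings. *)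

theory Defs
  imports "HOL-Analysis.Analysis"
begin

section \<open>CAT(0) spaces\<close>

definition geodesic_on :: "real set \<Rightarrow> (real \<Rightarrow> 'a::metric_space) \<Rightarrow> bool" where
  "geodesic_on I \<alpha> \<longleftrightarrow> is_interval I \<and> (\<forall>s\<in>I. \<forall>t\<in>I. dist (\<alpha> s) (\<alpha> t) = \<bar>s - t\<bar>)"

definition geodesic_segment :: "'a::metric_space set \<Rightarrow> 'a \<Rightarrow> 'a \<Rightarrow> bool" where
  "geodesic_segment S p q \<longleftrightarrow> (\<exists>\<alpha>. geodesic_on {0..dist p q} \<alpha> \<and>
     \<alpha> 0 = p \<and> \<alpha> (dist p q) = q \<and> S = \<alpha> ` {0..dist p q})"

text \<open>
  Geodesic triangles are no fatter than their comparison triangles in the Euclidean plane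
  (the product metric on \<^typ>\<open>real \<times> real\<close> is the Euclidean one).  Two points on different sides
  of a triangle lie on two sides with a common vertex, here \<open>p\<close>, and for two points on the
  same side the inequality is trivial; so the third side need not be mentioned.
\<close>

class cat0_space = metric_space +
  assumes geodesic_space: "\<exists>S. geodesic_segment S p q"
  and comparison:
    "geodesic_segment S p q \<Longrightarrow> geodesic_segment T p r \<Longrightarrow> x \<in> S \<Longrightarrow> y \<in> T \<Longrightarrow>
     dist p' q' = dist p q \<Longrightarrow> dist q' r' = dist q r \<Longrightarrow> dist p' r' = dist p r \<Longrightarrow>
     x' \<in> closed_segment p' q' \<Longrightarrow> dist p' x' = dist p x \<Longrightarrow>
     y' \<in> closed_segment p' r' \<Longrightarrow> dist p' y' = dist p y \<Longrightarrow>
     dist x y \<le> dist (x' :: real \<times> real) y'"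

section \<open>Curtains\<close>

definition is_closest :: "'a::metric_space set \<Rightarrow> 'a \<Rightarrow> 'a \<Rightarrow> bool" where
  "is_closest S x p \<longleftrightarrow> p \<in> S \<and> (\<forall>q\<in>S. dist x p \<le> dist x q)"

definition proj :: "'a::metric_space set \<Rightarrow> 'a \<Rightarrow> 'a" where
  "proj S x = (THE p. is_closest S x p)"

definition proj_defined :: "'a::metric_space set \<Rightarrow> bool" where
  "proj_defined S \<longleftrightarrow> (\<forall>x. \<exists>!p. is_closest S x p)"

text \<open>
  \<open>curtain_halfspaces h A B\<close>: \<open>h\<close> is a curtain dual to some geodesic \<open>\<alpha> : I \<rightarrow> X\<close> at some \<open>r\<close>,
  with \<open>A = h\<^sup>-\<close> and \<open>B = h\<^sup>+\<close>.  The interval \<open>I\<close> need not be closed, but the closest-point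
  projection to \<open>\<alpha>\<close> has to exist; for closed \<open>I\<close> it always does.

  A curtain is treated as a set: in a CAT(0) space its two halfspaces are the path components of
  its complement, so up to exchanging them they do not depend on the choice of \<open>\<alpha>\<close> and \<open>r\<close>.
\<close>

definition curtain_halfspaces :: "'a::metric_space set \<Rightarrow> 'a set \<Rightarrow> 'a set \<Rightarrow> bool" where
  "curtain_halfspaces h A B \<longleftrightarrow> (\<exists>I \<alpha> r.
     geodesic_on I \<alpha> \<and> proj_defined (\<alpha> ` I) \<and> {r - 1/2..r + 1/2} \<subseteq> interior I \<and>
     h = proj (\<alpha> ` I) -` (\<alpha> ` {r - 1/2..r + 1/2}) \<and>
     A = proj (\<alpha> ` I) -` (\<alpha> ` (I \<inter> {..<r - 1/2})) \<and>
     B = proj (\<alpha> ` I) -` (\<alpha> ` (I \<inter> {r + 1/2<..})))"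

definition curtain :: "'a::metric_space set \<Rightarrow> bool" where
  "curtain h \<longleftrightarrow> (\<exists>A B. curtain_halfspaces h A B)"

definition halfspace_of :: "'a::metric_space set \<Rightarrow> 'a set \<Rightarrow> bool" where
  "halfspace_of h P \<longleftrightarrow> (\<exists>Q. curtain_halfspaces h P Q \<or> curtain_halfspaces h Q P)"

definition separates :: "'a::metric_space set \<Rightarrow> 'a set \<Rightarrow> 'a set \<Rightarrow> bool" where
  "separates h A B \<longleftrightarrow> (\<exists>H K. curtain_halfspaces h H K \<and>
     (A \<subseteq> H \<and> B \<subseteq> K \<or> B \<subseteq> H \<and> A \<subseteq> K))"

text \<open>
  The index set \<open>J\<close> of a chain is a finite or infinite, possibly empty, set of consecutive
  integers.  Curtains are nonempty, so disjointness makes the indexing injective.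
\<close>

definition chain :: "'a::metric_space set set \<Rightarrow> bool" where
  "chain c \<longleftrightarrow> (\<exists>(J :: int set) h.
     (\<forall>i\<in>J. \<forall>k\<in>J. {i..k} \<subseteq> J) \<and> c = h ` J \<and>
     (\<forall>i\<in>J. curtain (h i)) \<and>
     (\<forall>i\<in>J. \<forall>j\<in>J. i \<noteq> j \<longrightarrow> h i \<inter> h j = {}) \<and>
     (\<forall>i. i - 1 \<in> J \<and> i + 1 \<in> J \<longrightarrow> separates (h i) (h (i - 1)) (h (i + 1))))"

definition chain_separates :: "'a::metric_space set set \<Rightarrow> 'a set \<Rightarrow> 'a set \<Rightarrow> bool" where
  "chain_separates c A B \<longleftrightarrow> chain c \<and> (\<forall>h\<in>c. separates h A B)"

definition L_separated :: "nat \<Rightarrow> 'a::metric_space set \<Rightarrow> 'a set \<Rightarrow> bool" where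
  "L_separated L h h' \<longleftrightarrow> curtain h \<and> curtain h' \<and> h \<inter> h' = {} \<and>
     (\<forall>c. chain c \<and> (\<forall>k\<in>c. k \<inter> h \<noteq> {} \<and> k \<inter> h' \<noteq> {}) \<longrightarrow> finite c \<and> card c \<le> L)"

definition separated :: "'a::metric_space set \<Rightarrow> 'a set \<Rightarrow> bool" where
  "separated h h' \<longleftrightarrow> (\<exists>L. L_separated L h h')"

definition L_chain :: "nat \<Rightarrow> 'a::metric_space set set \<Rightarrow> bool" where
  "L_chain L c \<longleftrightarrow> chain c \<and> (\<forall>h\<in>c. \<forall>h'\<in>c. h \<noteq> h' \<longrightarrow> L_separated L h h')"

section \<open>The curtain model\<close>

text \<open>
  The maximum is taken over a finite nonempty set: the empty chain is admitted, and a
  chain separating \<open>x\<close> from \<open>y\<close> is finite with at most \<open>dist x y\<close> elements, as a geodesic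
  from \<open>x\<close> to \<open>y\<close> spends length at least 1 in each curtain.
\<close>

definition d_L :: "nat \<Rightarrow> 'a::metric_space \<Rightarrow> 'a \<Rightarrow> nat" where
  "d_L L x y = (if x = y then 0
     else 1 + Max {card c | c. L_chain L c \<and> chain_separates c {x} {y}})"

text \<open>The index \<open>L\<close> starts at 1, so the value at 0 of the sequence of weights is ignored.\<close>

definition curtain_weights :: "(nat \<Rightarrow> real) \<Rightarrow> bool" where
  "curtain_weights w \<longleftrightarrow> (\<forall>L\<ge>1. 0 < w L \<and> w L < 1) \<and>
     summable (\<lambda>n. w (Suc n)) \<and>
     summable (\<lambda>n. real (Suc n) * w (Suc n)) \<and>
     summable (\<lambda>n. real (Suc n) ^ 2 * w (Suc n)) \<and>
     (\<Sum>n. w (Suc n)) < (\<Sum>n. real (Suc n) * w (Suc n)) \<and>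
     (\<Sum>n. real (Suc n) * w (Suc n)) < (\<Sum>n. real (Suc n) ^ 2 * w (Suc n))"

definition curtain_dist :: "(nat \<Rightarrow> real) \<Rightarrow> 'a::metric_space \<Rightarrow> 'a \<Rightarrow> real" where
  "curtain_dist w x y = (\<Sum>n. w (Suc n) * real (d_L (Suc n) x y))"

section \<open>Isometries\<close>

definition isometry :: "('a::metric_space \<Rightarrow> 'a) \<Rightarrow> bool" where
  "isometry g \<longleftrightarrow> bij g \<and> (\<forall>x y. dist (g x) (g y) = dist x y)"

definition translation_length :: "('a::metric_space \<Rightarrow> 'a) \<Rightarrow> real" where
  "translation_length g = (INF x. dist x (g x))"

definition semisimple :: "('a::metric_space \<Rightarrow> 'a) \<Rightarrow> bool" where
  "semisimple g \<longleftrightarrow> isometry g \<and> (\<exists>x. dist x (g x) = translation_length g)"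

definition hyperbolic :: "('a::metric_space \<Rightarrow> 'a) \<Rightarrow> bool" where
  "hyperbolic g \<longleftrightarrow> semisimple g \<and> translation_length g > 0"

definition is_axis :: "('a::metric_space \<Rightarrow> 'a) \<Rightarrow> (real \<Rightarrow> 'a) \<Rightarrow> bool" where
  "is_axis g \<gamma> \<longleftrightarrow> geodesic_on UNIV \<gamma> \<and> (\<exists>l. l \<noteq> 0 \<and> (\<forall>t. g (\<gamma> t) = \<gamma> (t + l)))"

text \<open>
  Contraction is a property of the image \<open>S\<close> of a geodesic.  The function \<^const>\<open>diameter\<close> is
  only meaningful on bounded sets, hence the boundedness condition.
\<close>

definition R_contracting :: "real \<Rightarrow> 'a::metric_space set \<Rightarrow> bool" where
  "R_contracting R S \<longleftrightarrow> (\<forall>x r. ball x r \<inter> S = {} \<longrightarrow>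
     bounded (proj S ` ball x r) \<and> diameter (proj S ` ball x r) \<le> R)"

definition contracting :: "'a::metric_space set \<Rightarrow> bool" where
  "contracting S \<longleftrightarrow> (\<exists>R. R_contracting R S)"

definition contracting_isometry :: "('a::metric_space \<Rightarrow> 'a) \<Rightarrow> bool" where
  "contracting_isometry g \<longleftrightarrow> hyperbolic g \<and> (\<exists>\<gamma>. is_axis g \<gamma> \<and> contracting (range \<gamma>))"

definition bounds_flat_half_plane :: "(real \<Rightarrow> 'a::metric_space) \<Rightarrow> bool" where
  "bounds_flat_half_plane \<gamma> \<longleftrightarrow> (\<exists>f :: real \<times> real \<Rightarrow> 'a.
     (\<forall>u\<in>UNIV \<times> {0..}. \<forall>v\<in>UNIV \<times> {0..}. dist (f u) (f v) = dist u v) \<and>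
     f ` (UNIV \<times> {0}) = range \<gamma>)"

definition rank_one :: "('a::metric_space \<Rightarrow> 'a) \<Rightarrow> bool" where
  "rank_one g \<longleftrightarrow> hyperbolic g \<and> (\<exists>\<gamma>. is_axis g \<gamma> \<and> \<not> bounds_flat_half_plane \<gamma>)"

text \<open>
  Relabelling may exchange the two curtains, and for each of them either halfspace may be
  the positive one.
\<close>

definition skewers :: "('a::metric_space \<Rightarrow> 'a) \<Rightarrow> 'a set \<Rightarrow> 'a set \<Rightarrow> bool" where
  "skewers g h h' \<longleftrightarrow> (\<exists>h1 h2 P1 P2. \<exists>m::nat.
     (h1 = h \<and> h2 = h' \<or> h1 = h' \<and> h2 = h) \<and>
     halfspace_of h1 P1 \<and> halfspace_of h2 P2 \<and>
     (g ^^ m) ` h1 \<inter> h2 = {} \<and> (g ^^ m) ` h1 \<inter> h1 = {} \<and> h2 \<inter> h1 = {} \<and>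
     (g ^^ m) ` P1 \<subset> P2 \<and> P2 \<subset> P1)"

definition int_iterate :: "('a \<Rightarrow> 'a) \<Rightarrow> int \<Rightarrow> 'a \<Rightarrow> 'a" where
  "int_iterate g n = (if 0 \<le> n then g ^^ nat n else inv g ^^ nat (- n))"

definition quasiisometric_embedding_int :: "('a \<Rightarrow> 'a \<Rightarrow> real) \<Rightarrow> (int \<Rightarrow> 'a) \<Rightarrow> bool" where
  "quasiisometric_embedding_int D f \<longleftrightarrow> (\<exists>K C. K \<ge> 1 \<and> C \<ge> 0 \<and> (\<forall>m n.
     \<bar>real_of_int (m - n)\<bar> / K - C \<le> D (f m) (f n) \<and>
     D (f m) (f n) \<le> K * \<bar>real_of_int (m - n)\<bar> + C))"

definition acts_loxodromically :: "('a \<Rightarrow> 'a \<Rightarrow> real) \<Rightarrow> ('a \<Rightarrow> 'a) \<Rightarrow> bool" where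
  "acts_loxodromically D g \<longleftrightarrow> (\<forall>x. quasiisometric_embedding_int D (\<lambda>n. int_iterate g n x))"

end

theory Submission
  imports Defs
begin

text \<open>
  The comparison axiom is used through two consequences: the inequality of Bruhat and Tits
  (\<open>CN_inequality\<close>) and the convexity of the distance between two geodesics (\<open>dist_convex\<close>). They yield
  that projection to a geodesic is nonexpansive and makes obtuse angles. Hence a curtain is the slab
  of a nonexpansive coordinate whose preimages of intervals are connected, and its two sides do not
  depend on the dual geodesic. It follows that only boundedly many elements of a chain meet a given
  ball (\<open>chain_near_ball\<close>).

  The main tool is \<open>L_separated_segments_close\<close>: two geodesic segments that both cross two
  \<open>L\<close>-separated curtains come within distance \<open>2 * (L + 1)\<close> of each other, because the curtains dual
  to a shortest connection would otherwise form a chain of more than \<open>L\<close> curtains meeting both.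

  All three conditions are compared with \<open>linear_L_chains\<close>: for some \<open>L\<close>, the points \<open>x\<close> and \<open>g\<^sup>n x\<close> are
  separated by an \<open>L\<close>-chain whose length grows linearly in \<open>n\<close>.
  If \<open>g\<close> skewers a separated pair, the translates of one of the two curtains under a power of \<open>g\<close> form
  such chains. Linear chains make one summand of the curtain metric grow linearly, so \<open>g\<close> acts
  loxodromically; conversely, since all \<open>d_L\<close> grow at most linearly with a common rate, linear growth
  of the sum is due to finitely many summands.
  Linear chains also rule out fixed points, so \<open>g\<close> has an axis, and any two distant points of the axis
  are close to points separated by a long \<open>L\<close>-chain. If \<open>x\<close> and \<open>y\<close> have distant projections, that chain forces
  \<open>[x, y]\<close> to pass close to the axis, which no geodesic inside a ball disjoint from the axis can do
  (\<open>contracting_if_long_L_chains\<close>). Finally, if an axis is contracting, a curtain that meets two distant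
  curtains dual to it passes through a fixed ball, so these two are separated, and a power of \<open>g\<close>
  skewers them.

  A contracting line bounds no flat half-plane, because balls of the half-plane that touch its boundary
  have arbitrarily long projections. For the converse, call the distance to the axis the height. If for
  some fixed distance of the feet and some height, perpendiculars have always diverged by a definite
  amount at that height, then they diverge linearly from there on, as in a cone; a geodesic inside a
  ball disjoint from the axis can then cross only boundedly many of them
  (\<open>diverging_perpendiculars_contracting\<close>). Otherwise there are almost flat rectangles of all sizes on
  the axis, and in a proper space translates of them accumulate at a flat half-plane.
\<close>

section \<open>Geodesics and comparison\<close>

text \<open>
  The metric interval. In a CAT(0) space it is the geodesic segment, and no parametrisation has to be
  carried along.
\<close>

definition seg :: "'a::metric_space \<Rightarrow> 'a \<Rightarrow> 'a set" where
  "seg x y = {z. dist x z + dist z y = dist x y}"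

lemma seg_commute: "seg x y = seg y x"
  by (auto simp: seg_def dist_commute add.commute)

lemma endpoints_in_seg [simp]: "x \<in> seg x y" "y \<in> seg x y"
  by (auto simp: seg_def)

lemma seg_subset_seg: "z \<in> seg x y \<Longrightarrow> seg x z \<subseteq> seg x y"
proof
  fix u assume z: "z \<in> seg x y" and u: "u \<in> seg x z"
  have "dist u y \<le> dist u z + dist z y" "dist x y \<le> dist x u + dist u y"
    by (rule dist_triangle)+
  with z u show "u \<in> seg x y" by (simp add: seg_def)
qed

text \<open>
  The comparison axiom speaks of points on a given geodesic segment. Before uniqueness of geodesics is
  known, a point of the metric interval is put on one by joining geodesics from it to \<open>p\<close> and \<open>q\<close>.
\<close>

lemma geodesic_segment_exists_through:
  fixes p q z :: "'a::cat0_space"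
  assumes z: "z \<in> seg p q"
  shows "\<exists>S. geodesic_segment S p q \<and> z \<in> S"
proof -
  define d where "d = dist p z"
  define e where "e = dist z q"
  have de: "d + e = dist p q" "0 \<le> d" "0 \<le> e"
    using z by (auto simp: seg_def d_def e_def)
  obtain \<alpha> where \<alpha>: "geodesic_on {0..d} \<alpha>" "\<alpha> 0 = p" "\<alpha> d = z"
    using geodesic_space[of p z] unfolding geodesic_segment_def d_def by blast
  obtain \<beta> where \<beta>: "geodesic_on {0..e} \<beta>" "\<beta> 0 = z" "\<beta> e = q"
    using geodesic_space[of z q] unfolding geodesic_segment_def e_def by blast
  define \<eta> where "\<eta> t = (if t \<le> d then \<alpha> t else \<beta> (t - d))" for t
  have a: "dist (\<alpha> s) (\<alpha> t) = \<bar>s - t\<bar>" if "s \<in> {0..d}" "t \<in> {0..d}" for s t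
    using \<alpha>(1) that unfolding geodesic_on_def by blast
  have b: "dist (\<beta> s) (\<beta> t) = \<bar>s - t\<bar>" if "s \<in> {0..e}" "t \<in> {0..e}" for s t
    using \<beta>(1) that unfolding geodesic_on_def by blast
  have cross: "dist (\<alpha> s) (\<beta> t) = t + d - s" if s: "s \<in> {0..d}" and t: "t \<in> {0..e}" for s t
  proof -
    have 1: "dist (\<alpha> s) z = d - s" "dist p (\<alpha> s) = s"
      using a[of s d] a[of 0 s] s \<alpha> by auto
    have 2: "dist z (\<beta> t) = t" "dist (\<beta> t) q = e - t"
      using b[of 0 t] b[of t e] t \<beta> by auto
    have "dist p q \<le> dist p (\<alpha> s) + dist (\<alpha> s) (\<beta> t) + dist (\<beta> t) q"
      by (metis add_mono_thms_linordered_semiring(3) dist_triangle order_trans)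
    moreover have "dist (\<alpha> s) (\<beta> t) \<le> dist (\<alpha> s) z + dist z (\<beta> t)" by (rule dist_triangle)
    ultimately show ?thesis using 1 2 de by simp
  qed
  have "dist (\<eta> s) (\<eta> t) = \<bar>s - t\<bar>" if "s \<in> {0..d + e}" "t \<in> {0..d + e}" "s \<le> t" for s t
    using that a[of s t] b[of "s - d" "t - d"] cross[of s "t - d"]
    unfolding \<eta>_def by auto
  then have "geodesic_on {0..dist p q} \<eta>"
    unfolding geodesic_on_def de(1)[symmetric]
    by (metis abs_minus_commute dist_commute is_interval_cc linear)
  moreover have "\<eta> 0 = p" "\<eta> (dist p q) = q" "\<eta> d = z" "d \<in> {0..dist p q}"
    using de \<alpha> \<beta> by (auto simp: \<eta>_def simp flip: de(1))
  ultimately show ?thesis unfolding geodesic_segment_def by (metis imageI)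
qed

lemma comparison_triangle_exists:
  fixes a b c :: real
  assumes "0 \<le> a" "0 \<le> b" "c \<le> a + b" "a \<le> b + c" "b \<le> a + c"
  shows "\<exists>p q r :: real \<times> real. dist p q = a \<and> dist p r = b \<and> dist q r = c"
proof (cases "a = 0")
  case True
  then show ?thesis
    using assms by (intro exI[of _ "(0, 0)"] exI[of _ "(b, 0)"]) (auto simp: dist_prod_def dist_real_def)
next
  case False
  define x where "x = (a\<^sup>2 + b\<^sup>2 - c\<^sup>2) / (2 * a)"
  have ax: "2 * a * x = a\<^sup>2 + b\<^sup>2 - c\<^sup>2" using False by (simp add: x_def)
  have "c\<^sup>2 \<le> (a + b)\<^sup>2" using assms by (intro power_mono) auto
  moreover have "(a - b)\<^sup>2 \<le> c\<^sup>2" using assms by (intro power2_le_iff_abs_le[THEN iffD2]) auto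
  ultimately have "\<bar>2 * a * x\<bar> \<le> 2 * a * b" unfolding ax by (auto simp: power2_eq_square algebra_simps)
  then have "\<bar>x\<bar> \<le> b" using False assms by (auto simp: abs_mult)
  then have xb: "x\<^sup>2 \<le> b\<^sup>2" by (metis abs_ge_zero power2_abs power_mono)
  have "(a - x)\<^sup>2 + (b\<^sup>2 - x\<^sup>2) = c\<^sup>2" using ax by (simp add: power2_eq_square algebra_simps)
  then have "dist (a, 0) (x, sqrt (b\<^sup>2 - x\<^sup>2)) = c"
    using xb assms by (simp add: dist_prod_def dist_real_def)
  moreover have "dist (0, 0) (x, sqrt (b\<^sup>2 - x\<^sup>2)) = b" "dist (0::real, 0::real) (a, 0) = a"
    using xb assms by (simp_all add: dist_prod_def dist_real_def)
  ultimately show ?thesis by blast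
qed

lemma comparison_points:
  fixes p q r x y :: "'a::cat0_space"
  assumes x: "x \<in> seg p q" "dist p x = l * dist p q" and y: "y \<in> seg p r" "dist p y = m * dist p r"
    and lm: "0 \<le> l" "l \<le> 1" "0 \<le> m" "m \<le> 1"
  obtains p' q' r' :: "real \<times> real" where "dist p' q' = dist p q" "dist q' r' = dist q r"
    "dist p' r' = dist p r" "dist x y \<le> dist (p' + l *\<^sub>R (q' - p')) (p' + m *\<^sub>R (r' - p'))"
proof -
  obtain S where S: "geodesic_segment S p q" "x \<in> S" using geodesic_segment_exists_through x by blast
  obtain T where T: "geodesic_segment T p r" "y \<in> T" using geodesic_segment_exists_through y by blast
  obtain p' q' r' :: "real \<times> real"
    where t: "dist p' q' = dist p q" "dist p' r' = dist p r" "dist q' r' = dist q r"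
    using comparison_triangle_exists[of "dist p q" "dist p r" "dist q r"]
    by (metis dist_commute dist_triangle zero_le_dist add.commute)
  have cs: "u + k *\<^sub>R (v - u) \<in> closed_segment u v" "dist u (u + k *\<^sub>R (v - u)) = k * dist u v"
    if "0 \<le> k" "k \<le> 1" for u v :: "real \<times> real" and k
    using that by (auto simp: closed_segment_def algebra_simps dist_norm intro!: exI[of _ k])
      (metis abs_of_nonneg norm_minus_commute norm_scaleR scaleR_right_diff_distrib)
  have "dist x y \<le> dist (p' + l *\<^sub>R (q' - p')) (p' + m *\<^sub>R (r' - p'))"
    by (rule comparison[OF S(1) T(1) S(2) T(2) t(1,3,2)]) (use cs lm t x y in auto)
  with t show ?thesis by (intro that) auto
qed

text \<open>
  The inequality of Bruhat and Tits: in the comparison triangle it is the equality of Stewart's theorem.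
  It gives uniqueness of geodesics and all statements about closest points.
\<close>

lemma CN_inequality:
  fixes p x y z :: "'a::cat0_space"
  assumes z: "dist x z = l * dist x y" "dist z y = (1 - l) * dist x y" and l: "0 \<le> l" "l \<le> 1"
  shows "(dist p z)\<^sup>2 \<le> (1 - l) * (dist p x)\<^sup>2 + l * (dist p y)\<^sup>2 - l * (1 - l) * (dist x y)\<^sup>2"
proof -
  have "z \<in> seg x y" using z by (simp add: seg_def algebra_simps)
  then obtain x' y' p' :: "real \<times> real" where t0: "dist x' y' = dist x y" "dist y' p' = dist y p"
    "dist x' p' = dist x p" "dist z p \<le> dist (x' + l *\<^sub>R (y' - x')) (x' + 1 *\<^sub>R (p' - x'))"
    by (rule comparison_points[of z x y l p p 1]) (use z l in \<open>simp_all\<close>)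
  then have t: "dist x' y' = dist x y" "dist y' p' = dist y p" "dist x' p' = dist x p"
    "dist z p \<le> dist (x' + l *\<^sub>R (y' - x')) p'" by simp_all
  have "(norm (x' + l *\<^sub>R (y' - x') - p'))\<^sup>2
      = (1 - l) * (norm (x' - p'))\<^sup>2 + l * (norm (y' - p'))\<^sup>2 - l * (1 - l) * (norm (x' - y'))\<^sup>2"
    by (simp add: power2_norm_eq_inner inner_diff inner_add algebra_simps inner_commute)
  moreover have "(dist z p)\<^sup>2 \<le> (dist (x' + l *\<^sub>R (y' - x')) p')\<^sup>2"
    using t(4) by (intro power_mono) auto
  ultimately show ?thesis using t by (simp add: dist_norm[of "_ :: real \<times> real"] dist_commute)
qed

definition along :: "'a::metric_space \<Rightarrow> 'a \<Rightarrow> real \<Rightarrow> 'a" where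
  "along x y l = (SOME z. dist x z = l * dist x y \<and> dist z y = (1 - l) * dist x y)"

lemma
  fixes x y :: "'a::cat0_space"
  assumes "0 \<le> l" "l \<le> 1"
  shows dist_along: "dist x (along x y l) = l * dist x y" "dist (along x y l) y = (1 - l) * dist x y"
    and along_in_seg: "along x y l \<in> seg x y"
proof -
  obtain \<alpha> where \<alpha>: "geodesic_on {0..dist x y} \<alpha>" "\<alpha> 0 = x" "\<alpha> (dist x y) = y"
    using geodesic_space[of x y] unfolding geodesic_segment_def by blast
  have m: "l * dist x y \<in> {0..dist x y}" using assms by (auto simp: mult_left_le_one_le)
  then have "dist (\<alpha> 0) (\<alpha> (l * dist x y)) = l * dist x y"
    "dist (\<alpha> (l * dist x y)) (\<alpha> (dist x y)) = (1 - l) * dist x y"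
    using \<alpha>(1) by (auto simp: geodesic_on_def algebra_simps)
  then have "\<exists>z. dist x z = l * dist x y \<and> dist z y = (1 - l) * dist x y" using \<alpha> by metis
  then have "dist x (along x y l) = l * dist x y \<and> dist (along x y l) y = (1 - l) * dist x y"
    unfolding along_def by (rule someI_ex)
  then show "dist x (along x y l) = l * dist x y" "dist (along x y l) y = (1 - l) * dist x y"
    "along x y l \<in> seg x y"
    by (auto simp: seg_def algebra_simps)
qed

lemma along_unique:
  fixes x y :: "'a::cat0_space"
  assumes "0 \<le> l" "l \<le> 1" "dist x z = l * dist x y" "dist z y = (1 - l) * dist x y"
  shows "z = along x y l"
proof -
  have "(dist z (along x y l))\<^sup>2
      \<le> (1 - l) * (dist z x)\<^sup>2 + l * (dist z y)\<^sup>2 - l * (1 - l) * (dist x y)\<^sup>2"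
    by (rule CN_inequality) (use dist_along assms in auto)
  also have "\<dots> = 0"
    unfolding dist_commute[of z x] assms(3,4) by (simp add: power2_eq_square algebra_simps)
  finally show ?thesis by simp
qed

lemma along_0 [simp]: "along x y 0 = x" and along_1 [simp]: "along x y 1 = y"
  for x y :: "'a::cat0_space"
  using along_unique[of 0 x x y] along_unique[of 1 x y y] by simp_all

lemma along_flip: "0 \<le> l \<Longrightarrow> l \<le> 1 \<Longrightarrow> along x y l = along y x (1 - l)"
  for x y :: "'a::cat0_space"
  by (rule along_unique) (simp_all add: dist_along dist_commute[of y] dist_commute[of _ x])

lemma seg_along: "z \<in> seg x y \<Longrightarrow> \<exists>l. 0 \<le> l \<and> l \<le> 1 \<and> z = along x y l"
  for x y :: "'a::cat0_space"
proof (cases "x = y")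
  case True
  assume "z \<in> seg x y"
  then have "z = x" using True by (auto simp: seg_def dist_commute)
  then show ?thesis using True by (intro exI[of _ 0]) auto
next
  case False
  assume z: "z \<in> seg x y"
  have "dist x z \<le> dist x y" using z zero_le_dist[of z y] unfolding seg_def mem_Collect_eq by linarith
  then have "0 \<le> dist x z / dist x y" "dist x z / dist x y \<le> 1" using False by auto
  moreover have "z = along x y (dist x z / dist x y)"
    using calculation z False by (intro along_unique) (auto simp: seg_def diff_divide_distrib left_diff_distrib)
  ultimately show ?thesis by blast
qed

lemma seg_eq_image: "seg x y = along x y ` {0..1}" for x y :: "'a::cat0_space"
  using seg_along[of _ x y] along_in_seg[of _ x y] by fastforce

lemma dist_along_along:
  fixes x y :: "'a::cat0_space"
  assumes "0 \<le> l" "l \<le> 1" "0 \<le> m" "m \<le> 1"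
  shows "dist (along x y l) (along x y m) = \<bar>l - m\<bar> * dist x y"
proof -
  have *: "dist (along x y l) (along x y m) = (m - l) * dist x y" if "0 \<le> l" "l \<le> m" "m \<le> 1" for l m
  proof -
    let ?z = "along x y m"
    let ?u = "along x ?z (l / m)"
    have lm: "0 \<le> l / m" "l / m \<le> 1" using that by (auto simp: divide_le_eq)
    have m: "l / m * m = l" using that by (cases "m = 0") auto
    have d: "dist x ?z = m * dist x y" "dist ?z y = (1 - m) * dist x y"
      using dist_along[of m x y] that by simp_all
    have u: "?u \<in> seg x ?z" by (rule along_in_seg[OF lm])
    have "?z \<in> seg x y" using that by (simp add: along_in_seg)
    with u have "?u \<in> seg x y" using seg_subset_seg by blast
    moreover have "dist x ?u = l * dist x y"
      using dist_along(1)[OF lm, of x ?z] d m by (simp flip: mult.assoc)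
    ultimately have "?u = along x y l"
      using that by (intro along_unique) (auto simp: seg_def algebra_simps)
    then show ?thesis using dist_along(2)[OF lm, of x ?z] d m
      by (simp add: left_diff_distrib flip: mult.assoc)
  qed
  show ?thesis using *[of l m] *[of m l] assms by (cases "l \<le> m") (auto simp: dist_commute)
qed

lemma continuous_on_along: "continuous_on {0..1} (along x y)" for x y :: "'a::cat0_space"
proof (rule lipschitz_on_continuous_on)
  show "(dist x y)-lipschitz_on {0..1} (along x y)"
    by (rule lipschitz_onI) (auto simp: dist_along_along dist_real_def mult.commute)
qed

lemma compact_seg: "compact (seg x y)" and connected_seg: "connected (seg x y)"
  for x y :: "'a::cat0_space"
  unfolding seg_eq_image
  by (auto intro!: compact_continuous_image connected_continuous_image continuous_on_along)

text \<open>
  In the comparison triangle the two points divide their sides in the same ratio, so equality holds there.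
\<close>

lemma dist_along_common_point:
  fixes p q r :: "'a::cat0_space"
  assumes l: "0 \<le> l" "l \<le> 1"
  shows "dist (along p q l) (along p r l) \<le> l * dist q r"
proof -
  obtain p' q' r' :: "real \<times> real" where t: "dist p' q' = dist p q" "dist q' r' = dist q r"
    "dist p' r' = dist p r"
    "dist (along p q l) (along p r l) \<le> dist (p' + l *\<^sub>R (q' - p')) (p' + l *\<^sub>R (r' - p'))"
    using comparison_points[of "along p q l" p q l "along p r l" r l] l dist_along along_in_seg
    by metis
  have "p' + l *\<^sub>R (q' - p') - (p' + l *\<^sub>R (r' - p')) = l *\<^sub>R (q' - r')" by (simp add: algebra_simps)
  then have "dist (p' + l *\<^sub>R (q' - p')) (p' + l *\<^sub>R (r' - p')) = l * dist q' r'"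
    using l by (simp add: dist_norm)
  then show ?thesis using t by simp
qed

lemma dist_convex:
  fixes a b a' b' :: "'a::cat0_space"
  assumes l: "0 \<le> l" "l \<le> 1"
  shows "dist (along a b l) (along a' b' l) \<le> (1 - l) * dist a a' + l * dist b b'"
proof -
  have "dist (along a b l) (along a b' l) \<le> l * dist b b'" by (rule dist_along_common_point[OF l])
  moreover have "dist (along a b' l) (along a' b' l) \<le> (1 - l) * dist a a'"
    using dist_along_common_point[of "1 - l" b' a a'] l
    by (simp add: along_flip[OF l, of a b'] along_flip[OF l, of a' b'])
  ultimately show ?thesis using dist_triangle[of "along a b l" "along a' b' l" "along a b' l"] by simp
qed

lemma dist_add_square_le:
  fixes a b :: real
  shows "(a + b)\<^sup>2 \<le> 2 * a\<^sup>2 + 2 * b\<^sup>2"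
proof -
  have "0 \<le> (a - b)\<^sup>2" by simp
  then show ?thesis by (simp add: power2_eq_square algebra_simps)
qed

text \<open>Both halves of the diagonal \<open>b d\<close> are bounded by the inequality of Bruhat and Tits, applied to the midpoint of \<open>a c\<close>.\<close>

lemma quadrilateral_inequality:
  fixes a b c d :: "'a::cat0_space"
  shows "(dist a c)\<^sup>2 + (dist b d)\<^sup>2 \<le> (dist a b)\<^sup>2 + (dist b c)\<^sup>2 + (dist c d)\<^sup>2 + (dist d a)\<^sup>2"
proof -
  define m where "m = along a c (1/2)"
  have CN: "(dist p m)\<^sup>2 \<le> (1 - 1/2) * (dist p a)\<^sup>2 + 1/2 * (dist p c)\<^sup>2 - 1/2 * (1 - 1/2) * (dist a c)\<^sup>2" for p
    by (rule CN_inequality) (auto simp: m_def dist_along)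
  have "dist b d \<le> dist b m + dist d m" by (metis dist_commute dist_triangle)
  then have "(dist b d)\<^sup>2 \<le> (dist b m + dist d m)\<^sup>2" by (intro power_mono) auto
  also have "\<dots> \<le> 2 * (dist b m)\<^sup>2 + 2 * (dist d m)\<^sup>2" by (rule dist_add_square_le)
  finally show ?thesis using CN[of b] CN[of d] by (simp add: dist_commute)
qed

section \<open>Closest points in convex sets\<close>

definition geo_convex :: "'a::metric_space set \<Rightarrow> bool" where
  "geo_convex C \<longleftrightarrow> (\<forall>x\<in>C. \<forall>y\<in>C. seg x y \<subseteq> C)"

lemma geo_convex_seg: "geo_convex (seg x y)" for x y :: "'a::cat0_space"
  unfolding geo_convex_def
proof (intro ballI)
  fix u v assume u: "u \<in> seg x y" and v: "v \<in> seg x y"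
  obtain l m where l: "0 \<le> l" "l \<le> 1" "u = along x y l" and m: "0 \<le> m" "m \<le> 1" "v = along x y m"
    using seg_along u v by metis
  have d: "dist u v = \<bar>l - m\<bar> * dist x y" using dist_along_along l m by blast
  have D: "dist x u = l * dist x y" "dist x v = m * dist x y" "dist u y = (1 - l) * dist x y"
    "dist v y = (1 - m) * dist x y" using l m dist_along by metis+
  have "v \<in> seg u y \<or> u \<in> seg v y"
    using d D l m u v by (cases "l \<le> m") (auto simp: seg_def dist_commute algebra_simps)
  then show "seg u v \<subseteq> seg x y"
  proof
    assume "v \<in> seg u y"
    then have "seg u v \<subseteq> seg u y" by (rule seg_subset_seg)
    then show ?thesis using seg_subset_seg[of u y x] u by (auto simp: seg_commute)
  next
    assume "u \<in> seg v y"
    then have "seg v u \<subseteq> seg v y" by (rule seg_subset_seg)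
    then show ?thesis using seg_subset_seg[of v y x] v by (auto simp: seg_commute)
  qed
qed

text \<open>
  Moving from \<open>p\<close> towards \<open>q\<close> cannot decrease the distance to \<open>x\<close>. The Bruhat-Tits inequality for the
  points near \<open>p\<close> turns this into an obtuse angle at \<open>p\<close>.
\<close>

lemma closest_point_obtuse:
  fixes x p q :: "'a::cat0_space"
  assumes C: "geo_convex C" and p: "is_closest C x p" and q: "q \<in> C"
  shows "(dist x p)\<^sup>2 + (dist p q)\<^sup>2 \<le> (dist x q)\<^sup>2"
proof -
  have "k * (dist p q)\<^sup>2 \<le> (dist x q)\<^sup>2 - (dist x p)\<^sup>2" if k: "0 < k" "k < 1" for k
  proof -
    define l where "l = 1 - k"
    have l: "0 < l" "0 \<le> l" "l \<le> 1" "1 - l = k" using k by (auto simp: l_def)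
    have "along p q l \<in> C" using C p q l along_in_seg unfolding geo_convex_def is_closest_def by blast
    then have "(dist x p)\<^sup>2 \<le> (dist x (along p q l))\<^sup>2"
      using p by (intro power_mono) (auto simp: is_closest_def)
    also have "\<dots> \<le> (1 - l) * (dist x p)\<^sup>2 + l * (dist x q)\<^sup>2 - l * (1 - l) * (dist p q)\<^sup>2"
      by (rule CN_inequality) (use l(2,3) in \<open>auto simp: dist_along\<close>)
    finally have "l * (k * (dist p q)\<^sup>2) \<le> l * ((dist x q)\<^sup>2 - (dist x p)\<^sup>2)"
      unfolding l(4)[symmetric] by (simp add: algebra_simps)
    then show ?thesis using l by simp
  qed
  then have "(dist p q)\<^sup>2 \<le> (dist x q)\<^sup>2 - (dist x p)\<^sup>2" by (rule field_le_mult_one_interval)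
  then show ?thesis by simp
qed

text \<open>
  Add the obtuse angle inequalities at \<open>p\<close> and \<open>q\<close> and compare with the quadrilateral \<open>x, y, q, p\<close>.
\<close>

lemma closest_point_nonexpansive:
  fixes x y :: "'a::cat0_space"
  assumes C: "geo_convex C" and p: "is_closest C x p" and q: "is_closest C y q"
  shows "dist p q \<le> dist x y"
proof -
  have "(dist x p)\<^sup>2 + (dist p q)\<^sup>2 \<le> (dist x q)\<^sup>2" "(dist y q)\<^sup>2 + (dist q p)\<^sup>2 \<le> (dist y p)\<^sup>2"
    using closest_point_obtuse[OF C] p q by (auto simp: is_closest_def)
  moreover have "(dist x q)\<^sup>2 + (dist y p)\<^sup>2 \<le> (dist x y)\<^sup>2 + (dist y q)\<^sup>2 + (dist q p)\<^sup>2 + (dist p x)\<^sup>2"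
    by (rule quadrilateral_inequality)
  ultimately have "(dist p q)\<^sup>2 \<le> (dist x y)\<^sup>2" 
    unfolding dist_commute[of q p] dist_commute[of p x] by linarith
  then show ?thesis by (rule power2_le_imp_le) simp
qed

lemma closest_point_unique:
  fixes x :: "'a::cat0_space"
  shows "geo_convex C \<Longrightarrow> is_closest C x p \<Longrightarrow> is_closest C x q \<Longrightarrow> p = q"
  using closest_point_nonexpansive[of C x p x q] by simp

lemma is_closest_on_seg:
  assumes p: "is_closest C x p" and z: "z \<in> seg x p"
  shows "is_closest C z p"
  unfolding is_closest_def
proof (intro conjI ballI)
  show "p \<in> C" using p by (simp add: is_closest_def)
  fix q assume "q \<in> C"
  then have "dist x p \<le> dist x q" using p by (simp add: is_closest_def)
  moreover have "dist x q \<le> dist x z + dist z q" by (rule dist_triangle)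
  ultimately show "dist z p \<le> dist z q" using z by (simp add: seg_def)
qed

section \<open>Coordinates along a geodesic\<close>

lemma geodesic_on_dist: "geodesic_on I \<alpha> \<Longrightarrow> s \<in> I \<Longrightarrow> t \<in> I \<Longrightarrow> dist (\<alpha> s) (\<alpha> t) = \<bar>s - t\<bar>"
  by (simp add: geodesic_on_def)

lemma continuous_on_geodesic: "geodesic_on I \<alpha> \<Longrightarrow> continuous_on I \<alpha>"
proof (rule lipschitz_on_continuous_on)
  assume "geodesic_on I \<alpha>"
  then show "1-lipschitz_on I \<alpha>"
    by (intro lipschitz_onI) (auto simp: geodesic_on_def dist_real_def)
qed

lemma geodesic_on_between: "geodesic_on I \<alpha> \<Longrightarrow> s \<in> I \<Longrightarrow> t \<in> I \<Longrightarrow> s \<le> u \<Longrightarrow> u \<le> t \<Longrightarrow> u \<in> I"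
  unfolding geodesic_on_def by (blast intro: mem_is_interval_1_I)

lemma seg_geodesic:
  fixes \<alpha> :: "real \<Rightarrow> 'a::cat0_space"
  assumes \<alpha>: "geodesic_on I \<alpha>" and st: "s \<in> I" "t \<in> I" "s \<le> t"
  shows "seg (\<alpha> s) (\<alpha> t) = \<alpha> ` {s..t}"
proof
  have I: "u \<in> I" if "s \<le> u" "u \<le> t" for u using geodesic_on_between[OF \<alpha> st(1,2)] that .
  show "\<alpha> ` {s..t} \<subseteq> seg (\<alpha> s) (\<alpha> t)"
    using I st geodesic_on_dist[OF \<alpha>] by (auto simp: seg_def)
  show "seg (\<alpha> s) (\<alpha> t) \<subseteq> \<alpha> ` {s..t}"
  proof
    fix z assume "z \<in> seg (\<alpha> s) (\<alpha> t)"
    then obtain l where l: "0 \<le> l" "l \<le> 1" "z = along (\<alpha> s) (\<alpha> t) l" using seg_along by blast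
    have "0 \<le> l * (t - s)" "l * (t - s) \<le> t - s"
      using l st mult_right_mono[of l 1 "t - s"] by simp_all
    then have u: "s + l * (t - s) \<in> {s..t}" by auto
    then have "\<alpha> (s + l * (t - s)) = along (\<alpha> s) (\<alpha> t) l"
      using l st I by (intro along_unique) (auto simp: geodesic_on_dist[OF \<alpha>] algebra_simps)
    then show "z \<in> \<alpha> ` {s..t}" using l u by (metis imageI)
  qed
qed

lemma geo_convex_geodesic:
  fixes \<alpha> :: "real \<Rightarrow> 'a::cat0_space"
  assumes \<alpha>: "geodesic_on I \<alpha>"
  shows "geo_convex (\<alpha> ` I)"
proof -
  have *: "seg (\<alpha> s) (\<alpha> t) \<subseteq> \<alpha> ` I" if "s \<in> I" "t \<in> I" "s \<le> t" for s t
    unfolding seg_geodesic[OF \<alpha> that]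
    by (intro image_mono subsetI geodesic_on_between[OF \<alpha> that(1,2)]) simp_all
  have "seg (\<alpha> s) (\<alpha> t) \<subseteq> \<alpha> ` I" if "s \<in> I" "t \<in> I" for s t
    using *[of s t] *[of t s] that seg_commute[of "\<alpha> s" "\<alpha> t"] by (cases "s \<le> t") auto
  then show ?thesis unfolding geo_convex_def by blast
qed

lemma proj_defined_geodesic:
  fixes \<alpha> :: "real \<Rightarrow> 'a::cat0_space"
  assumes \<alpha>: "geodesic_on I \<alpha>" and I: "closed I" "I \<noteq> {}"
  shows "proj_defined (\<alpha> ` I)"
  unfolding proj_defined_def
proof
  fix x
  obtain t0 where t0: "t0 \<in> I" using I by blast
  define r where "r = 2 * dist x (\<alpha> t0)"
  have r: "0 \<le> r" by (simp add: r_def)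
  have K: "compact (I \<inter> cball t0 r)" using I by (simp add: closed_Int_compact)
  have "continuous_on (I \<inter> cball t0 r) (\<lambda>t. dist x (\<alpha> t))"
    using continuous_on_subset[OF continuous_on_geodesic[OF \<alpha>]] by (auto intro!: continuous_intros)
  then obtain t where t: "t \<in> I \<inter> cball t0 r" and min: "\<forall>s \<in> I \<inter> cball t0 r. dist x (\<alpha> t) \<le> dist x (\<alpha> s)"
    using continuous_attains_inf[OF K, of "\<lambda>t. dist x (\<alpha> t)"] t0 r by force
  have "dist x (\<alpha> t) \<le> dist x (\<alpha> s)" if s: "s \<in> I" for s
  proof (cases "s \<in> cball t0 r")
    case True then show ?thesis using min s by blast
  next
    case False
    then have "r < dist (\<alpha> t0) (\<alpha> s)" using geodesic_on_dist[OF \<alpha> t0 s] by (simp add: dist_real_def)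
    moreover have "dist (\<alpha> t0) (\<alpha> s) \<le> dist x (\<alpha> t0) + dist x (\<alpha> s)"
      by (metis dist_commute dist_triangle)
    moreover have "dist x (\<alpha> t) \<le> dist x (\<alpha> t0)" using min t0 r by simp
    ultimately show ?thesis by (simp add: r_def)
  qed
  then have "is_closest (\<alpha> ` I) x (\<alpha> t)" using t by (auto simp: is_closest_def)
  then show "\<exists>!p. is_closest (\<alpha> ` I) x p"
    using closest_point_unique[OF geo_convex_geodesic[OF \<alpha>]] by (intro ex1I)
qed

text \<open>
  The parameter of the closest point. Working with this real function rather than with \<^const>\<open>proj\<close>
  reduces statements about curtains to inequalities between numbers.
\<close>

definition coord :: "real set \<Rightarrow> (real \<Rightarrow> 'a::metric_space) \<Rightarrow> 'a \<Rightarrow> real" where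
  "coord I \<alpha> x = (SOME t. t \<in> I \<and> is_closest (\<alpha> ` I) x (\<alpha> t))"

context
  fixes I and \<alpha> :: "real \<Rightarrow> 'a::cat0_space"
  assumes \<alpha>: "geodesic_on I \<alpha>" and pd: "proj_defined (\<alpha> ` I)"
begin

lemma coord_in: "coord I \<alpha> x \<in> I" and is_closest_coord: "is_closest (\<alpha> ` I) x (\<alpha> (coord I \<alpha> x))"
proof -
  have "\<exists>t. t \<in> I \<and> is_closest (\<alpha> ` I) x (\<alpha> t)"
  proof -
    obtain p where p: "is_closest (\<alpha> ` I) x p" using pd unfolding proj_defined_def by blast
    then obtain t where "t \<in> I" "p = \<alpha> t" unfolding is_closest_def by blast
    then show ?thesis using p by blast
  qed
  then have "coord I \<alpha> x \<in> I \<and> is_closest (\<alpha> ` I) x (\<alpha> (coord I \<alpha> x))"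
    unfolding coord_def by (rule someI_ex)
  then show "coord I \<alpha> x \<in> I" "is_closest (\<alpha> ` I) x (\<alpha> (coord I \<alpha> x))" by auto
qed

lemma proj_eq_coord: "proj (\<alpha> ` I) x = \<alpha> (coord I \<alpha> x)"
  unfolding proj_def
proof (rule the_equality)
  show "is_closest (\<alpha> ` I) x (\<alpha> (coord I \<alpha> x))" by (rule is_closest_coord)
  show "p = \<alpha> (coord I \<alpha> x)" if "is_closest (\<alpha> ` I) x p" for p
    by (rule closest_point_unique[OF geo_convex_geodesic[OF \<alpha>] that is_closest_coord])
qed

lemma coord_eqI:
  assumes "t \<in> I" "is_closest (\<alpha> ` I) x (\<alpha> t)"
  shows "coord I \<alpha> x = t"
proof -
  have "\<alpha> (coord I \<alpha> x) = \<alpha> t"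
    by (rule closest_point_unique[OF geo_convex_geodesic[OF \<alpha>] is_closest_coord assms(2)])
  then show ?thesis using geodesic_on_dist[OF \<alpha> coord_in[of x] assms(1)] by simp
qed

lemma coord_geodesic: "t \<in> I \<Longrightarrow> coord I \<alpha> (\<alpha> t) = t"
  by (rule coord_eqI) (auto simp: is_closest_def)

lemma coord_nonexpansive: "\<bar>coord I \<alpha> x - coord I \<alpha> y\<bar> \<le> dist x y"
  using closest_point_nonexpansive[OF geo_convex_geodesic[OF \<alpha>] is_closest_coord is_closest_coord, of x y]
    geodesic_on_dist[OF \<alpha> coord_in coord_in, of x y] by simp

lemma coord_on_seg: "z \<in> seg x (\<alpha> (coord I \<alpha> x)) \<Longrightarrow> coord I \<alpha> z = coord I \<alpha> x"
  by (rule coord_eqI[OF coord_in is_closest_on_seg[OF is_closest_coord]])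

text \<open>
  Every fibre is star-shaped about its point on the geodesic, so all of the preimage is connected to
  the part of the geodesic over \<open>J\<close>.
\<close>

lemma connected_coord_vimage:
  assumes J: "is_interval J"
  shows "connected (coord I \<alpha> -` J)"
proof -
  let ?core = "\<alpha> ` (I \<inter> J)"
  let ?S = "(\<lambda>x. seg x (\<alpha> (coord I \<alpha> x)) \<union> ?core) ` (coord I \<alpha> -` J)"
  have "is_interval (I \<inter> J)" using J \<alpha> by (simp add: geodesic_on_def is_interval_Int)
  then have core: "connected ?core"
    using continuous_on_subset[OF continuous_on_geodesic[OF \<alpha>]]
    by (intro connected_continuous_image) (auto simp: is_interval_connected_1)
  have "connected (\<Union> ?S)"
  proof (rule connected_Union)
    fix s assume "s \<in> ?S"
    then obtain x where x: "coord I \<alpha> x \<in> J" "s = seg x (\<alpha> (coord I \<alpha> x)) \<union> ?core" by auto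
    then have "\<alpha> (coord I \<alpha> x) \<in> seg x (\<alpha> (coord I \<alpha> x)) \<inter> ?core" using coord_in by auto
    then show "connected s" unfolding x(2) by (intro connected_Un connected_seg core) blast
  next
    show "\<Inter> ?S \<noteq> {}"
    proof (cases "coord I \<alpha> -` J = {}")
      case False
      then obtain x where "coord I \<alpha> x \<in> J" by blast
      then have "\<alpha> (coord I \<alpha> x) \<in> ?core" using coord_in by auto
      then show ?thesis by blast
    qed simp
  qed
  moreover have "\<Union> ?S = coord I \<alpha> -` J"
  proof (intro equalityI subsetI)
    fix y assume "y \<in> \<Union> ?S"
    then obtain x where x: "coord I \<alpha> x \<in> J" and "y \<in> seg x (\<alpha> (coord I \<alpha> x)) \<or> y \<in> ?core" by blast
    then consider "y \<in> seg x (\<alpha> (coord I \<alpha> x))" | t where "t \<in> I" "t \<in> J" "y = \<alpha> t" by blast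
    then show "y \<in> coord I \<alpha> -` J"
      by cases (use x coord_on_seg coord_geodesic in simp_all)
  next
    fix y assume "y \<in> coord I \<alpha> -` J"
    then show "y \<in> \<Union> ?S" by (intro UnionI[OF imageI]) auto
  qed
  ultimately show ?thesis by simp
qed

lemma vimage_proj_eq:
  assumes "J \<subseteq> I"
  shows "proj (\<alpha> ` I) -` (\<alpha> ` J) = coord I \<alpha> -` J"
proof -
  have "\<alpha> (coord I \<alpha> x) \<in> \<alpha> ` J \<longleftrightarrow> coord I \<alpha> x \<in> J" for x
  proof
    assume "\<alpha> (coord I \<alpha> x) \<in> \<alpha> ` J"
    then obtain t where t: "t \<in> J" "\<alpha> (coord I \<alpha> x) = \<alpha> t" by blast
    then have "coord I \<alpha> x = t"
      using coord_geodesic[OF coord_in[of x]] coord_geodesic[of t] assms by auto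
    then show "coord I \<alpha> x \<in> J" using t by simp
  qed simp
  then show ?thesis unfolding vimage_def proj_eq_coord by simp
qed

end

section \<open>Curtains and their halfspaces\<close>

lemma abs_diff_le_half: "\<bar>c - r\<bar> \<le> 1/2 \<longleftrightarrow> c \<in> {r - 1/2..r + 1/2}" for c r :: real
  unfolding atLeastAtMost_iff by linarith

lemma curtain_halfspaces_coord:
  fixes \<alpha> :: "real \<Rightarrow> 'a::cat0_space"
  assumes \<alpha>: "geodesic_on I \<alpha>" and pd: "proj_defined (\<alpha> ` I)" and r: "{r - 1/2..r + 1/2} \<subseteq> interior I"
  shows "curtain_halfspaces {x. \<bar>coord I \<alpha> x - r\<bar> \<le> 1/2} {x. coord I \<alpha> x < r - 1/2} {x. r + 1/2 < coord I \<alpha> x}"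
proof -
  note v = vimage_proj_eq[OF \<alpha> pd]
  have "proj (\<alpha> ` I) -` (\<alpha> ` {r - 1/2..r + 1/2}) = {x. \<bar>coord I \<alpha> x - r\<bar> \<le> 1/2}"
    unfolding abs_diff_le_half using r interior_subset[of I] by (subst v) auto
  moreover have "proj (\<alpha> ` I) -` (\<alpha> ` (I \<inter> {..<r - 1/2})) = {x. coord I \<alpha> x < r - 1/2}"
    using coord_in[OF \<alpha> pd] by (subst v) auto
  moreover have "proj (\<alpha> ` I) -` (\<alpha> ` (I \<inter> {r + 1/2<..})) = {x. r + 1/2 < coord I \<alpha> x}"
    using coord_in[OF \<alpha> pd] by (subst v) auto
  ultimately show ?thesis unfolding curtain_halfspaces_def using assms by metis
qed

text \<open>
  What is remembered of the coordinate along a dual geodesic, shifted so that the curtain is the slab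
  between -1/2 and 1/2. In the last clause, \<open>x'\<close> and \<open>z'\<close> are the projections of two points of the
  curtain: they are joined inside the curtain by three geodesics, the middle one of length at most 1.
\<close>

definition slab_function :: "('a::metric_space \<Rightarrow> real) \<Rightarrow> bool" where
  "slab_function f \<longleftrightarrow> (\<forall>x y. \<bar>f x - f y\<bar> \<le> dist x y) \<and> (\<forall>J. is_interval J \<longrightarrow> connected (f -` J)) \<and>
     (\<exists>x. f x < -1/2) \<and> (\<exists>x. 1/2 < f x) \<and>
     (\<forall>x z. \<bar>f x\<bar> \<le> 1/2 \<longrightarrow> \<bar>f z\<bar> \<le> 1/2 \<longrightarrow> (\<exists>x' z'. dist x' z' \<le> 1 \<and>
        (\<forall>y \<in> seg x x' \<union> seg x' z' \<union> seg z' z. \<bar>f y\<bar> \<le> 1/2)))"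

lemma curtain_halfspaces_slab:
  fixes h :: "'a::cat0_space set"
  assumes "curtain_halfspaces h A B"
  shows "\<exists>f. slab_function f \<and> h = {x. \<bar>f x\<bar> \<le> 1/2} \<and> A = {x. f x < -1/2} \<and> B = {x. 1/2 < f x}"
proof -
  obtain I \<alpha> r where \<alpha>: "geodesic_on I \<alpha>" and pd: "proj_defined (\<alpha> ` I)"
    and r: "{r - 1/2..r + 1/2} \<subseteq> interior I"
    and h: "h = proj (\<alpha> ` I) -` (\<alpha> ` {r - 1/2..r + 1/2})"
    and A: "A = proj (\<alpha> ` I) -` (\<alpha> ` (I \<inter> {..<r - 1/2}))"
    and B: "B = proj (\<alpha> ` I) -` (\<alpha> ` (I \<inter> {r + 1/2<..}))"
    using assms unfolding curtain_halfspaces_def by blast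
  let ?c = "coord I \<alpha>"
  define f where "f x = ?c x - r" for x
  note v = vimage_proj_eq[OF \<alpha> pd] and cin = coord_in[OF \<alpha> pd]
  have rI: "{r - 1/2..r + 1/2} \<subseteq> I" using r interior_subset by blast
  have "h = {x. \<bar>f x\<bar> \<le> 1/2}" unfolding h f_def abs_diff_le_half using rI by (subst v) auto
  moreover have "A = {x. f x < -1/2}" "B = {x. 1/2 < f x}"
    unfolding A B f_def using cin by (subst v; auto)+
  moreover have "slab_function f"
    unfolding slab_function_def
  proof (intro conjI allI impI)
    fix x y show "\<bar>f x - f y\<bar> \<le> dist x y"
      using coord_nonexpansive[OF \<alpha> pd, of x y] by (simp add: f_def)
  next
    fix J :: "real set" assume "is_interval J"
    moreover have "f -` J = ?c -` ((+) r ` J)" by (force simp: f_def)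
    ultimately show "connected (f -` J)" using connected_coord_vimage[OF \<alpha> pd] by simp
  next
    have "r - 1/2 \<in> interior I" "r + 1/2 \<in> interior I" using r by (auto simp: subset_iff)
    then obtain e e' where e: "0 < e" "ball (r - 1/2) e \<subseteq> I" "0 < e'" "ball (r + 1/2) e' \<subseteq> I"
      unfolding mem_interior by blast
    have "r - 1/2 - e/2 \<in> ball (r - 1/2) e" "r + 1/2 + e'/2 \<in> ball (r + 1/2) e'"
      using e by (auto simp: dist_real_def)
    then have ce: "?c (\<alpha> (r - 1/2 - e/2)) = r - 1/2 - e/2" "?c (\<alpha> (r + 1/2 + e'/2)) = r + 1/2 + e'/2"
      using coord_geodesic[OF \<alpha> pd] e by blast+
    show "\<exists>x. f x < -1/2"
      using e ce by (intro exI[of _ "\<alpha> (r - 1/2 - e/2)"]) (simp add: f_def)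
    show "\<exists>x. 1/2 < f x"
      using e ce by (intro exI[of _ "\<alpha> (r + 1/2 + e'/2)"]) (simp add: f_def)
  next
    fix x z assume xz: "\<bar>f x\<bar> \<le> 1/2" "\<bar>f z\<bar> \<le> 1/2"
    have *: "\<bar>f y\<bar> \<le> 1/2" if "y \<in> seg (\<alpha> s) (\<alpha> t)" "s \<in> {r - 1/2..r + 1/2}" "t \<in> {r - 1/2..r + 1/2}" "s \<le> t" for s t y
    proof -
      have "seg (\<alpha> s) (\<alpha> t) = \<alpha> ` {s..t}" using that rI by (intro seg_geodesic[OF \<alpha>]) auto
      with that(1) obtain u where u: "u \<in> {s..t}" "y = \<alpha> u" by (metis imageE)
      then have ur: "u \<in> {r - 1/2..r + 1/2}" using that(2,3) by simp
      then have "?c y = u" using coord_geodesic[OF \<alpha> pd, of u] rI u(2) by blast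
      then show ?thesis using ur unfolding f_def abs_diff_le_half by simp
    qed
    have "?c x \<in> {r - 1/2..r + 1/2}" "?c z \<in> {r - 1/2..r + 1/2}" using xz unfolding f_def abs_diff_le_half by auto
    then have "\<bar>f y\<bar> \<le> 1/2" if "y \<in> seg (\<alpha> (?c x)) (\<alpha> (?c z))" for y
      using that * seg_commute by (metis linear)
    moreover have "\<bar>f y\<bar> \<le> 1/2" if "y \<in> seg x (\<alpha> (?c x)) \<union> seg (\<alpha> (?c z)) z" for y
      using that xz coord_on_seg[OF \<alpha> pd] unfolding f_def by (auto simp: seg_commute[of _ z])
    moreover have "dist (\<alpha> (?c x)) (\<alpha> (?c z)) \<le> 1"
      unfolding geodesic_on_dist[OF \<alpha> cin cin] using xz unfolding f_def by linarith
    ultimately show "\<exists>x' z'. dist x' z' \<le> 1 \<and> (\<forall>y \<in> seg x x' \<union> seg x' z' \<union> seg z' z. \<bar>f y\<bar> \<le> 1/2)"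
      by blast
  qed
  ultimately show ?thesis by (intro exI[of _ f] conjI)
qed

lemma curtain_halfspaces_commute:
  assumes "curtain_halfspaces h A B"
  shows "curtain_halfspaces h B A"
proof -
  obtain I \<alpha> r where *: "geodesic_on I \<alpha>" "proj_defined (\<alpha> ` I)"
    "{r - 1/2..r + 1/2} \<subseteq> interior I"
    "h = proj (\<alpha> ` I) -` (\<alpha> ` {r - 1/2..r + 1/2})"
    "A = proj (\<alpha> ` I) -` (\<alpha> ` (I \<inter> {..<r - 1/2}))"
    "B = proj (\<alpha> ` I) -` (\<alpha> ` (I \<inter> {r + 1/2<..}))"
    using assms unfolding curtain_halfspaces_def by blast
  define \<beta> where "\<beta> t = \<alpha> (- t)" for t
  have im: "\<beta> ` (uminus ` S) = \<alpha> ` S" for S by (force simp: \<beta>_def)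
  have "geodesic_on (uminus ` I) \<beta>"
    using *(1) unfolding geodesic_on_def \<beta>_def by (auto simp: is_interval_uminus)
  moreover have "{- r - 1/2..- r + 1/2} = uminus ` {r - 1/2..r + 1/2}" by (auto simp: image_uminus_atLeastAtMost)
  moreover from this have "{- r - 1/2..- r + 1/2} \<subseteq> interior (uminus ` I)"
    unfolding interior_negations using *(3) by (metis image_mono)
  moreover have "uminus ` I \<inter> {..<- r - 1/2} = uminus ` (I \<inter> {r + 1/2<..})"
    "uminus ` I \<inter> {- r + 1/2<..} = uminus ` (I \<inter> {..<r - 1/2})" by force+
  ultimately show ?thesis
    unfolding curtain_halfspaces_def using *(2,4-6) im by metis
qed

text \<open>
  Most later arguments refer to a curtain only through these facts. The connectedness of a curtain together with
  one of its sides is what makes chains monotone. The centre is a point whose coordinate vanishes; as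
  the coordinate is nonexpansive, a ball of radius 1/2 about it stays in the curtain.
\<close>

lemma
  fixes h :: "'a::cat0_space set"
  assumes "curtain_halfspaces h A B"
  shows connected_curtain: "connected h" and connected_halfspace: "connected A"
    and connected_closed_halfspace: "connected (h \<union> A)"
    and halfspaces_disjoint: "A \<inter> B = {}" "h \<inter> A = {}"
    and halfspaces_cover: "h \<union> A \<union> B = UNIV"
    and halfspace_nonempty: "A \<noteq> {}" and curtain_nonempty: "h \<noteq> {}"
    and open_halfspace: "open A"
    and curtain_has_centre: "x \<in> A \<Longrightarrow> y \<in> B \<Longrightarrow> \<exists>z\<in>seg x y. \<forall>u. dist z u \<le> 1/2 \<longrightarrow> u \<in> h"
proof -
  obtain f where f: "slab_function f" and h: "h = {x. \<bar>f x\<bar> \<le> 1/2}" and A: "A = {x. f x < -1/2}"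
    and B: "B = {x. 1/2 < f x}"
    using curtain_halfspaces_slab[OF assms] by blast
  have lip: "\<bar>f x - f y\<bar> \<le> dist x y" for x y using f by (simp add: slab_function_def)
  have "1-lipschitz_on UNIV f" using lip by (intro lipschitz_onI) (auto simp: dist_real_def)
  then have cont: "continuous_on S f" for S
    by (meson lipschitz_on_continuous_on continuous_on_subset subset_UNIV)
  have conn: "connected (f -` J)" if "is_interval J" for J using f that by (simp add: slab_function_def)
  have "h = f -` {-1/2..1/2}" "A = f -` {..<-1/2}" "h \<union> A = f -` {..1/2}" by (auto simp: h A)
  then show "connected h" "connected A" "connected (h \<union> A)" using conn by (auto simp: is_interval_1)
  show "A \<inter> B = {}" "h \<inter> A = {}" "h \<union> A \<union> B = UNIV" by (auto simp: h A B)
  obtain x0 y0 where xy0: "x0 \<in> A" "y0 \<in> B" using f by (auto simp: slab_function_def A B)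
  show "A \<noteq> {}" using xy0 by blast
  show "open A" unfolding A using cont by (intro open_Collect_less) (auto intro!: continuous_intros)
  have centre: "\<exists>z\<in>seg x y. \<forall>u. dist z u \<le> 1/2 \<longrightarrow> u \<in> h" if "x \<in> A" "y \<in> B" for x y
  proof -
    have "connected (f ` seg x y)" using connected_continuous_image[OF cont connected_seg] .
    moreover have "f x \<in> f ` seg x y" "f y \<in> f ` seg x y" by simp_all
    moreover have "f x \<le> 0" "0 \<le> f y" using that unfolding A B by simp_all
    ultimately have "0 \<in> f ` seg x y" by (rule connectedD_interval)
    then obtain z where z: "z \<in> seg x y" "f z = 0" by auto
    have "u \<in> h" if "dist z u \<le> 1/2" for u using lip[of z u] z that by (auto simp: h)
    with z show ?thesis by blast
  qed
  then show "x \<in> A \<Longrightarrow> y \<in> B \<Longrightarrow> \<exists>z\<in>seg x y. \<forall>u. dist z u \<le> 1/2 \<longrightarrow> u \<in> h" by blast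
  obtain z where "\<forall>u. dist z u \<le> 1/2 \<longrightarrow> u \<in> h" using centre[OF xy0] by blast
  then have "z \<in> h" by (auto elim: allE[of _ z])
  then show "h \<noteq> {}" by blast
qed

lemma connected_in_halfspace:
  fixes h :: "'a::cat0_space set"
  assumes h: "curtain_halfspaces h A B" and C: "connected C" "C \<inter> h = {}"
  shows "C \<subseteq> A \<or> C \<subseteq> B"
proof -
  have cov: "C \<subseteq> A \<union> B" using halfspaces_cover[OF h] C(2) by auto
  have "A \<inter> C = {} \<or> B \<inter> C = {}"
  proof (rule connectedD[OF C(1) open_halfspace[OF h] open_halfspace[OF curtain_halfspaces_commute[OF h]] _ cov])
    show "A \<inter> B \<inter> C = {}" using halfspaces_disjoint(1)[OF h] by simp
  qed
  with cov show ?thesis by auto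
qed

text \<open>
  The sides are the components of the complement, hence independent of the dual geodesic. This makes
  \<^const>\<open>separates\<close> computable from any one description of the curtain.
\<close>

lemma halfspaces_unique:
  fixes h :: "'a::cat0_space set"
  assumes h: "curtain_halfspaces h A B" and h': "curtain_halfspaces h A' B'"
  shows "A' = A \<and> B' = B \<or> A' = B \<and> B' = A"
proof -
  note k = curtain_halfspaces_commute[OF h] and k' = curtain_halfspaces_commute[OF h']
  have A': "A' \<subseteq> A \<or> A' \<subseteq> B"
    by (rule connected_in_halfspace[OF h connected_halfspace[OF h']])
      (use halfspaces_disjoint(2)[OF h'] in blast)
  have B': "B' \<subseteq> A \<or> B' \<subseteq> B"
    by (rule connected_in_halfspace[OF h connected_halfspace[OF k']])
      (use halfspaces_disjoint(2)[OF k'] in blast)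
  have U: "A \<union> B = A' \<union> B'"
    using halfspaces_cover[OF h] halfspaces_cover[OF h'] halfspaces_disjoint(2)[OF h]
      halfspaces_disjoint(2)[OF h'] halfspaces_disjoint(2)[OF k] halfspaces_disjoint(2)[OF k'] by blast
  note d = halfspaces_disjoint(1)[OF h] halfspace_nonempty[OF h] halfspace_nonempty[OF k]
  show ?thesis using A' B'
  proof (elim disjE)
    assume "A' \<subseteq> A" "B' \<subseteq> B" then show ?thesis using U d by blast
  next
    assume "A' \<subseteq> B" "B' \<subseteq> A" then show ?thesis using U d by blast
  next
    assume "A' \<subseteq> A" "B' \<subseteq> A" then show ?thesis using U d by blast
  next
    assume "A' \<subseteq> B" "B' \<subseteq> B" then show ?thesis using U d by blast
  qed
qed

lemma separates_iff:
  fixes h :: "'a::cat0_space set"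
  assumes h: "curtain_halfspaces h A B"
  shows "separates h S T \<longleftrightarrow> S \<subseteq> A \<and> T \<subseteq> B \<or> T \<subseteq> A \<and> S \<subseteq> B"
  unfolding separates_def using h halfspaces_unique[OF h] by blast

lemma separates_commute: "separates h S T \<longleftrightarrow> separates h T S"
  unfolding separates_def by blast

lemma separatesE:
  assumes "separates h S T"
  obtains A B where "curtain_halfspaces h A B" "S \<subseteq> A" "T \<subseteq> B"
  using assms curtain_halfspaces_commute unfolding separates_def by blast

lemma separates_subset: "separates h S T \<Longrightarrow> S' \<subseteq> S \<Longrightarrow> T' \<subseteq> T \<Longrightarrow> separates h S' T'"
  unfolding separates_def by blast

lemma separates_meets:
  fixes h :: "'a::cat0_space set"
  assumes "separates h {x} {y}" "connected C" "x \<in> C" "y \<in> C"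
  shows "C \<inter> h \<noteq> {}"
proof
  assume 0: "C \<inter> h = {}"
  obtain A B where h: "curtain_halfspaces h A B" "x \<in> A" "y \<in> B" using assms(1) by (auto elim: separatesE)
  have "C \<subseteq> A \<or> C \<subseteq> B" by (rule connected_in_halfspace[OF h(1) assms(2) 0])
  moreover have "A \<inter> B = {}" by (rule halfspaces_disjoint(1)[OF h(1)])
  ultimately show False using h assms(3,4) by auto
qed

lemma separates_move:
  fixes h :: "'a::cat0_space set"
  assumes "separates h {x} {y}" "connected C" "x \<in> C" "x' \<in> C" "C \<inter> h = {}"
  shows "separates h {x'} {y}"
proof -
  obtain A B where h: "curtain_halfspaces h A B" "x \<in> A" "y \<in> B" using assms(1) by (auto elim: separatesE)
  have "C \<subseteq> A \<or> C \<subseteq> B" by (rule connected_in_halfspace[OF h(1) assms(2,5)])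
  moreover have "A \<inter> B = {}" by (rule halfspaces_disjoint(1)[OF h(1)])
  ultimately have "x' \<in> A" using h assms(3,4) by auto
  then show ?thesis unfolding separates_iff[OF h(1)] using h by simp
qed

section \<open>Chains of curtains\<close>

lemma dist_on_seg: "u \<in> seg x y \<Longrightarrow> v \<in> seg x y \<Longrightarrow> dist u v = \<bar>dist x u - dist x v\<bar>"
  for x y :: "'a::cat0_space"
proof -
  assume u: "u \<in> seg x y" and v: "v \<in> seg x y"
  obtain l where l: "0 \<le> l" "l \<le> 1" "u = along x y l" using seg_along[OF u] by auto
  obtain m where m: "0 \<le> m" "m \<le> 1" "v = along x y m" using seg_along[OF v] by auto
  show ?thesis
    unfolding l(3) m(3) dist_along_along[OF l(1,2) m(1,2)] dist_along(1)[OF l(1,2)] dist_along(1)[OF m(1,2)]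
    by (simp add: abs_mult flip: left_diff_distrib)
qed

text \<open>
  The geodesic from \<open>x\<close> to \<open>y\<close> passes through the centre of each curtain of the family, and the
  ball of radius 1/2 about that centre lies in the curtain; hence disjoint curtains have centres
  more than 1/2 apart.
\<close>

lemma card_disjoint_separating:
  fixes x y :: "'a::cat0_space"
  assumes sep: "\<And>h. h \<in> F \<Longrightarrow> separates h {x} {y}"
    and dis: "\<And>h k. h \<in> F \<Longrightarrow> k \<in> F \<Longrightarrow> h \<noteq> k \<Longrightarrow> h \<inter> k = {}"
  shows "finite F \<and> real (card F) \<le> 2 * dist x y + 1"
proof -
  have "\<exists>z\<in>seg x y. \<forall>u. dist z u \<le> 1/2 \<longrightarrow> u \<in> h" if h: "h \<in> F" for h
  proof -
    obtain A B where "curtain_halfspaces h A B" "x \<in> A" "y \<in> B"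
      using sep[OF h] by (auto elim: separatesE)
    then show ?thesis by (rule curtain_has_centre)
  qed
  then obtain z where z: "\<And>h. h \<in> F \<Longrightarrow> z h \<in> seg x y"
    "\<And>h u. h \<in> F \<Longrightarrow> dist (z h) u \<le> 1/2 \<Longrightarrow> u \<in> h" by metis
  define n where "n h = nat \<lfloor>2 * dist x (z h)\<rfloor>" for h
  have inj: "inj_on n F"
  proof (rule inj_onI, rule ccontr)
    fix h k assume hk: "h \<in> F" "k \<in> F" "n h = n k" "h \<noteq> k"
    have "\<lfloor>2 * dist x (z h)\<rfloor> = \<lfloor>2 * dist x (z k)\<rfloor>" 
      using hk(3) unfolding n_def by (subst (asm) eq_nat_nat_iff) simp_all
    then have "\<bar>2 * dist x (z h) - 2 * dist x (z k)\<bar> < 1" by linarith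
    then have "dist (z h) (z k) \<le> 1/2" unfolding dist_on_seg[OF z(1)[OF hk(1)] z(1)[OF hk(2)]] by linarith
    then have "z k \<in> h" using z(2) hk by simp
    moreover have "z k \<in> k" using z(2)[OF hk(2), of "z k"] by simp
    ultimately show False using dis hk by auto
  qed
  have sub: "n ` F \<subseteq> {..nat \<lfloor>2 * dist x y\<rfloor>}"
  proof (rule image_subsetI)
    fix h assume "h \<in> F"
    then have "dist x (z h) \<le> dist x y" using z(1)[of h] unfolding seg_def mem_Collect_eq by (smt (verit) zero_le_dist)
    then show "n h \<in> {..nat \<lfloor>2 * dist x y\<rfloor>}" unfolding n_def by (simp add: floor_mono nat_mono)
  qed
  then have fin: "finite F" using inj by (meson finite_atMost finite_imageD finite_subset)
  have "card F \<le> card {..nat \<lfloor>2 * dist x y\<rfloor>}"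
    by (rule card_inj_on_le[OF inj sub]) simp
  then have "card F \<le> nat \<lfloor>2 * dist x y\<rfloor> + 1" by simp
  then have "int (card F) \<le> int (nat \<lfloor>2 * dist x y\<rfloor> + 1)" by (simp only: of_nat_le_iff)
  then have "int (card F) \<le> \<lfloor>2 * dist x y\<rfloor> + 1" by simp
  then have "real (card F) \<le> 2 * dist x y + 1" by linarith
  then show ?thesis using fin by simp
qed

lemma chain_disjoint: "chain c \<Longrightarrow> h \<in> c \<Longrightarrow> k \<in> c \<Longrightarrow> h \<noteq> k \<Longrightarrow> h \<inter> k = {}"
  unfolding chain_def by (elim exE conjE) (simp, metis (no_types, lifting) imageE)

lemma chain_curtain: "chain c \<Longrightarrow> h \<in> c \<Longrightarrow> curtain h"
  unfolding chain_def by (elim exE conjE) auto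

lemma curtainE:
  assumes "curtain h" obtains A B where "curtain_halfspaces h A B"
  using assms by (auto simp: curtain_def)

text \<open>
  A chain is monotone: since \<open>h\<^sub>k\<close> lies on the negative side of \<open>h\<^sub>k\<^sub>+\<^sub>1\<close>, the connected set
  consisting of \<open>h\<^sub>k\<^sub>+\<^sub>1\<close> and its positive side misses \<open>h\<^sub>k\<close>, so it lies in the positive side of \<open>h\<^sub>k\<close>.
\<close>

lemma halfspace_nesting:
  fixes h k :: "'a::cat0_space set"
  assumes h: "curtain_halfspaces h A B" and k: "curtain_halfspaces k A' B'"
    and "h \<subseteq> A'" "k \<subseteq> B"
  shows "k \<union> B' \<subseteq> B" "h \<union> A \<subseteq> A'"
proof -
  have *: "k \<union> B' \<subseteq> B" if h: "curtain_halfspaces h A B" and k: "curtain_halfspaces k A' B'"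
    and hA: "h \<subseteq> A'" and kB: "k \<subseteq> B" for h k A B A' B' :: "'a set"
  proof -
    note k' = curtain_halfspaces_commute[OF k]
    have "(k \<union> B') \<inter> h = {}"
      using hA halfspaces_disjoint(1)[OF k] halfspaces_disjoint(2)[OF k] by auto
    then have "k \<union> B' \<subseteq> A \<or> k \<union> B' \<subseteq> B"
      by (rule connected_in_halfspace[OF h connected_closed_halfspace[OF k']])
    moreover have "\<not> k \<subseteq> A"
    proof
      assume "k \<subseteq> A"
      then have "k \<subseteq> A \<inter> B" using kB by simp
      then show False using curtain_nonempty[OF k] halfspaces_disjoint(1)[OF h] by simp
    qed
    ultimately show ?thesis by simp
  qed
  show "k \<union> B' \<subseteq> B" by (rule *[OF assms])
  show "h \<union> A \<subseteq> A'"
    by (rule *[OF curtain_halfspaces_commute[OF k] curtain_halfspaces_commute[OF h] assms(4,3)])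
qed

lemma chain_separates_between:
  fixes h :: "int \<Rightarrow> 'a::cat0_space set"
  assumes conv: "\<forall>i\<in>J. \<forall>k\<in>J. {i..k} \<subseteq> J"
    and sep: "\<forall>i. i - 1 \<in> J \<and> i + 1 \<in> J \<longrightarrow> separates (h i) (h (i - 1)) (h (i + 1))"
    and ikj: "i \<in> J" "j \<in> J" "i < k" "k < j"
  shows "separates (h k) (h i) (h j)"
proof -
  let ?I = "\<lambda>k. k - 1 \<in> J \<and> k + 1 \<in> J"
  have "\<forall>k. \<exists>A B. ?I k \<longrightarrow> curtain_halfspaces (h k) A B \<and> h (k - 1) \<subseteq> A \<and> h (k + 1) \<subseteq> B"
    using sep by (metis separatesE)
  then obtain A B where AB: "\<And>k. ?I k \<Longrightarrow> curtain_halfspaces (h k) (A k) (B k)"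
    "\<And>k. ?I k \<Longrightarrow> h (k - 1) \<subseteq> A k" "\<And>k. ?I k \<Longrightarrow> h (k + 1) \<subseteq> B k" by metis
  have inJ: "m \<in> J" if "i \<le> m" "m \<le> j" for m using conv ikj that by (meson atLeastAtMost_iff subsetD)
  have I: "?I m" if "i < m" "m < j" for m using inJ[of "m - 1"] inJ[of "m + 1"] that by simp
  have step: "B (m + 1) \<subseteq> B m" "A m \<subseteq> A (m + 1)" if "i < m" "m + 1 < j" for m
  proof -
    have "h m \<subseteq> A (m + 1)" "h (m + 1) \<subseteq> B m" using AB(2)[OF I, of "m + 1"] AB(3)[OF I, of m] that by auto
    then show "B (m + 1) \<subseteq> B m" "A m \<subseteq> A (m + 1)"
      using halfspace_nesting[OF AB(1)[OF I] AB(1)[OF I], of m "m + 1"] that by auto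
  qed
  have up: "k + int n < j \<Longrightarrow> B (k + int n) \<subseteq> B k" for n
  proof (induction n)
    case (Suc n)
    then have "B (k + int n + 1) \<subseteq> B (k + int n)" using ikj by (intro step(1)) auto
    then show ?case using Suc by (simp add: add.assoc add.commute[of 1])
  qed simp
  have down: "i < k - int n \<Longrightarrow> A (k - int n) \<subseteq> A k" for n
  proof (induction n)
    case (Suc n)
    then have "A (k - int (Suc n)) \<subseteq> A (k - int (Suc n) + 1)" using ikj by (intro step(2)) auto
    then show ?case using Suc by (auto simp: algebra_simps)
  qed simp
  have "h j \<subseteq> B (j - 1)" using AB(3)[OF I, of "j - 1"] ikj by simp
  moreover have "B (j - 1) \<subseteq> B k" using up[of "nat (j - 1 - k)"] ikj by simp
  moreover have "h i \<subseteq> A (i + 1)" using AB(2)[OF I, of "i + 1"] ikj by simp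
  moreover have "A (i + 1) \<subseteq> A k" using down[of "nat (k - i - 1)"] ikj by simp
  ultimately have "h i \<subseteq> A k" "h j \<subseteq> B k" by (simp_all only: subset_trans)
  then show ?thesis
    unfolding separates_def using AB(1)[OF I[OF ikj(3,4)]] by (intro exI[of _ "A k"] exI[of _ "B k"]) simp
qed

text \<open>
  Indices of curtains that meet a ball of radius \<open>\<rho>\<close> differ by at most \<open>4 * \<rho> + 2\<close>, so all of them lie
  within that distance of any one of them.
\<close>

definition ball_bound :: "real \<Rightarrow> nat" where
  "ball_bound \<rho> = nat (2 * \<lfloor>4 * \<rho> + 2\<rfloor> + 1)"

text \<open>
  Chains cannot have many elements near one point: the curtains between two elements that meet
  \<open>cball z \<rho>\<close> separate two points at distance at most \<open>2 * \<rho>\<close>.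
\<close>

lemma chain_near_ball:
  fixes c :: "'a::cat0_space set set"
  assumes c: "chain c"
  shows "finite {h \<in> c. h \<inter> cball z \<rho> \<noteq> {}} \<and> card {h \<in> c. h \<inter> cball z \<rho> \<noteq> {}} \<le> ball_bound \<rho>"
proof -
  obtain J h where conv: "\<forall>i\<in>J. \<forall>k\<in>J. {i..k} \<subseteq> J" and ch: "c = h ` J"
    and cur: "\<forall>i\<in>J. curtain (h i)" and dis: "\<forall>i\<in>J. \<forall>j\<in>J. i \<noteq> j \<longrightarrow> h i \<inter> h j = {}"
    and sep: "\<forall>i :: int. i - 1 \<in> J \<and> i + 1 \<in> J \<longrightarrow> separates (h i) (h (i - 1)) (h (i + 1))"
    using c unfolding chain_def by auto
  define I where "I = {i \<in> J. h i \<inter> cball z \<rho> \<noteq> {}}"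
  define N where "N = \<lfloor>4 * \<rho> + 2\<rfloor>"
  have ne: "h i \<noteq> {}" if "i \<in> J" for i using cur that by (auto elim!: curtainE dest: curtain_nonempty)
  have gap: "j - i \<le> N" if ij: "i \<in> I" "j \<in> I" "i < j" for i j
  proof -
    obtain p q where p: "p \<in> h i" "dist z p \<le> \<rho>" and q: "q \<in> h j" "dist z q \<le> \<rho>"
      using ij by (auto simp: I_def)
    have iJ: "i \<in> J" "j \<in> J" using ij by (simp_all add: I_def)
    then have "{i..j} \<subseteq> J" using conv by simp
    then have J: "i \<in> J" "j \<in> J" "{i<..<j} \<subseteq> J" using iJ by auto
    have "real (card (h ` {i<..<j})) \<le> 2 * dist p q + 1"
    proof (rule conjunct2[OF card_disjoint_separating])
      fix k assume "k \<in> h ` {i<..<j}"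
      then obtain m where m: "k = h m" "i < m" "m < j" by auto
      have "separates (h m) (h i) (h j)"
        by (rule chain_separates_between[OF conv sep J(1,2) m(2,3)])
      then show "separates k {p} {q}" unfolding m(1) by (rule separates_subset) (use p q in auto)
    next
      show "k \<inter> l = {}" if "k \<in> h ` {i<..<j}" "l \<in> h ` {i<..<j}" "k \<noteq> l" for k l
        using that dis J(3) by (metis (no_types, lifting) imageE subsetD)
    qed
    moreover have "inj_on h {i<..<j}"
    proof (rule inj_onI, rule ccontr)
      fix m l assume "m \<in> {i<..<j}" "l \<in> {i<..<j}" "h m = h l" "m \<noteq> l"
      then show False using dis ne J(3) by (metis inf.idem subsetD)
    qed
    then have "card (h ` {i<..<j}) = nat (j - i - 1)" by (simp add: card_image)
    moreover have "dist p q \<le> \<rho> + \<rho>" using dist_triangle3[of p q z] p q by linarith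
    ultimately have "real_of_int (j - i) \<le> 4 * \<rho> + 2" using ij(3) by (simp add: of_nat_nat)
    then show ?thesis unfolding N_def le_floor_iff .
  qed
  have "finite I \<and> card I \<le> nat (2 * N + 1)"
  proof (cases "I = {}")
    case False
    then obtain i where i: "i \<in> I" by blast
    have "I \<subseteq> {i - N..i + N}"
    proof
      fix j assume j: "j \<in> I"
      show "j \<in> {i - N..i + N}"
      proof (cases i j rule: linorder_cases)
        case equal
        obtain p where "dist z p \<le> \<rho>" using i by (auto simp: I_def)
        then have "0 \<le> \<rho>" using zero_le_dist[of z p] by linarith
        then have "0 \<le> N" by (simp add: N_def le_floor_iff)
        then show ?thesis using equal by simp
      qed (use gap[OF i j] gap[OF j i] in auto)
    qed
    then have "finite I" "card I \<le> card {i - N..i + N}"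
      using finite_subset card_mono finite_atLeastAtMost_int by blast+
    moreover have "card {i - N..i + N} = nat (2 * N + 1)" by simp
    ultimately show ?thesis by simp
  qed simp
  then have fin: "finite I" and card: "card I \<le> ball_bound \<rho>" by (simp_all add: ball_bound_def N_def)
  have eq: "{k \<in> c. k \<inter> cball z \<rho> \<noteq> {}} = h ` I" unfolding ch I_def by auto
  show ?thesis unfolding eq using fin card le_trans[OF card_image_le[OF fin, of h] card] by simp
qed

section \<open>Curtains dual to a segment\<close>

text \<open>
  The curtains dual to the segment at 1, 3, 5 and so on are disjoint, and the last one ends at
  \<open>2 * n - 1/2\<close>, before the end of the segment.
\<close>

lemma dual_chain_exists:
  fixes \<eta> :: "real \<Rightarrow> 'a::cat0_space"
  assumes \<eta>: "geodesic_on {0..D} \<eta>" and n: "2 * real n \<le> D" "0 \<le> D"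
  shows "\<exists>c. chain c \<and> card c = n \<and> (\<forall>k\<in>c. \<forall>x y. is_closest (\<eta> ` {0..D}) x (\<eta> 0) \<longrightarrow>
    is_closest (\<eta> ` {0..D}) y (\<eta> D) \<longrightarrow> separates k {x} {y})"
proof -
  have pd: "proj_defined (\<eta> ` {0..D})" by (rule proj_defined_geodesic[OF \<eta>]) (use n in auto)
  let ?f = "coord {0..D} \<eta>"
  define h where "h i = {x. \<bar>?f x - (2 * real_of_int i + 1)\<bar> \<le> 1/2}" for i
  define A where "A i = {x. ?f x < (2 * real_of_int i + 1) - 1/2}" for i
  define B where "B i = {x. (2 * real_of_int i + 1) + 1/2 < ?f x}" for i
  define J where "J = {0..<int n}"
  have ch: "curtain_halfspaces (h i) (A i) (B i)" if i: "i \<in> J" for i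
    unfolding h_def A_def B_def
  proof (rule curtain_halfspaces_coord[OF \<eta> pd])
    have "real_of_int i + 1 \<le> real n" using i by (simp add: J_def)
    moreover have "0 \<le> real_of_int i" using i by (simp add: J_def)
    ultimately show "{(2 * real_of_int i + 1) - 1/2..(2 * real_of_int i + 1) + 1/2} \<subseteq> interior {0..D}"
      using n by (auto simp: interior_atLeastAtMost_real)
  qed
  have dis: "h i \<inter> h j = {}" if "i \<noteq> j" for i j
  proof (rule ccontr)
    assume "h i \<inter> h j \<noteq> {}"
    then obtain x where "\<bar>?f x - (2 * real_of_int i + 1)\<bar> \<le> 1/2" "\<bar>?f x - (2 * real_of_int j + 1)\<bar> \<le> 1/2"
      by (auto simp: h_def)
    then have "\<bar>real_of_int i - real_of_int j\<bar> < 1" by linarith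
    then show False using that by linarith
  qed
  have ne: "h i \<noteq> {}" if "i \<in> J" for i using curtain_nonempty[OF ch[OF that]] .
  have "chain (h ` J)"
    unfolding chain_def
  proof (intro exI[of _ J] exI[of _ h] conjI ballI impI allI)
    fix i assume "i - 1 \<in> J \<and> i + 1 \<in> J"
    then have i: "i \<in> J" by (auto simp: J_def)
    have "h (i - 1) \<subseteq> A i" "h (i + 1) \<subseteq> B i" 
      unfolding h_def A_def B_def abs_diff_le_half by auto
    then show "separates (h i) (h (i - 1)) (h (i + 1))"
      unfolding separates_def using ch[OF i] by auto
  qed (use ch dis in \<open>auto simp: curtain_def J_def\<close>)
  moreover have "inj_on h J"
  proof (rule inj_onI, rule ccontr)
    fix i j assume "i \<in> J" "j \<in> J" "h i = h j" "i \<noteq> j"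
    then show False using dis[of i j] ne[of i] by simp
  qed
  then have "card (h ` J) = n" by (simp add: card_image J_def)
  moreover have "separates k {x} {y}" if k: "k \<in> h ` J" and x: "is_closest (\<eta> ` {0..D}) x (\<eta> 0)"
    and y: "is_closest (\<eta> ` {0..D}) y (\<eta> D)" for k x y
  proof -
    obtain i where i: "i \<in> J" "k = h i" using k by auto
    have f: "?f x = 0" "?f y = D" using coord_eqI[OF \<eta> pd _ x] coord_eqI[OF \<eta> pd _ y] n by auto
    have "real_of_int i + 1 \<le> real n" "0 \<le> real_of_int i" using i by (auto simp: J_def)
    then have "x \<in> A i" "y \<in> B i" unfolding A_def B_def using f n by auto
    then show ?thesis unfolding i(2) separates_def using ch[OF i(1)] by auto
  qed
  ultimately show ?thesis by blast
qed

lemma seg_geodesic_segment: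
  fixes p q :: "'a::cat0_space"
  obtains \<eta> where "geodesic_on {0..dist p q} \<eta>" "\<eta> 0 = p" "\<eta> (dist p q) = q" "\<eta> ` {0..dist p q} = seg p q"
proof -
  obtain \<eta> where \<eta>: "geodesic_on {0..dist p q} \<eta>" "\<eta> 0 = p" "\<eta> (dist p q) = q"
    using geodesic_space[of p q] unfolding geodesic_segment_def by auto
  have "seg (\<eta> 0) (\<eta> (dist p q)) = \<eta> ` {0..dist p q}" by (rule seg_geodesic[OF \<eta>(1)]) auto
  with \<eta> that show ?thesis by simp
qed

lemma L_separated_connected: "L_separated L h k \<Longrightarrow> connected h \<and> connected k"
  for h :: "'a::cat0_space set"
  unfolding L_separated_def by (auto elim!: curtainE dest: connected_curtain)

text \<open>
  Let \<open>s0\<close>, \<open>t0\<close> be a closest pair of points of the two segments. If they were far apart, more than \<open>L\<close>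
  curtains dual to the geodesic from \<open>t0\<close> to \<open>s0\<close> would separate the segments, and would therefore
  meet both \<open>h\<close> and \<open>k\<close>, which are connected and meet both segments.
\<close>

lemma L_separated_segments_close:
  fixes h k :: "'a::cat0_space set"
  assumes L: "L_separated L h k"
    and S: "seg u v \<inter> h \<noteq> {}" "seg u v \<inter> k \<noteq> {}"
    and T: "seg a b \<inter> h \<noteq> {}" "seg a b \<inter> k \<noteq> {}"
  shows "\<exists>s\<in>seg u v. \<exists>t\<in>seg a b. dist s t < 2 * (real L + 1)"
proof (rule ccontr)
  assume far: "\<not> ?thesis"
  have "compact (seg u v \<times> seg a b)" by (intro compact_Times compact_seg)
  moreover have "seg u v \<times> seg a b \<noteq> {}" using S T by auto
  moreover have "continuous_on (seg u v \<times> seg a b) (\<lambda>z. dist (fst z) (snd z))"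
    by (intro continuous_intros)
  ultimately obtain z where z: "z \<in> seg u v \<times> seg a b"
    "\<forall>y\<in>seg u v \<times> seg a b. dist (fst z) (snd z) \<le> dist (fst y) (snd y)"
    using continuous_attains_inf by blast
  define s0 where "s0 = fst z"
  define t0 where "t0 = snd z"
  have st: "s0 \<in> seg u v" "t0 \<in> seg a b" using z(1) by (auto simp: s0_def t0_def)
  have min: "dist s0 t0 \<le> dist s t" if "s \<in> seg u v" "t \<in> seg a b" for s t
    using z(2) that by (force simp: s0_def t0_def)
  obtain \<eta> where \<eta>: "geodesic_on {0..dist t0 s0} \<eta>" "\<eta> 0 = t0" "\<eta> (dist t0 s0) = s0"
    "\<eta> ` {0..dist t0 s0} = seg t0 s0" by (rule seg_geodesic_segment)
  have proj: "is_closest (seg p q) s q" if q: "q \<in> S'" and C: "geo_convex S'"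
    and m: "\<And>s. s \<in> S' \<Longrightarrow> dist p q \<le> dist p s" and s: "s \<in> S'" for p q s :: 'a and S'
    unfolding is_closest_def
  proof (intro conjI ballI)
    fix w assume w: "w \<in> seg p q"
    have "is_closest S' p q" using q m by (simp add: is_closest_def)
    then have "is_closest S' w q" using w by (rule is_closest_on_seg)
    then have "(dist w q)\<^sup>2 + (dist q s)\<^sup>2 \<le> (dist w s)\<^sup>2" using closest_point_obtuse[OF C] s by blast
    then have "(dist q s)\<^sup>2 \<le> (dist w s)\<^sup>2" using zero_le_power2[of "dist w q"] by linarith
    then have "dist q s \<le> dist w s" by (rule power2_le_imp_le) simp
    then show "dist s q \<le> dist s w" by (simp only: dist_commute)
  qed simp
  have "2 * real (L + 1) \<le> dist t0 s0" using far st by (force simp: dist_commute not_less)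
  then obtain c where c: "chain c" "card c = L + 1" and csep: "\<forall>k\<in>c. \<forall>x y. is_closest (seg t0 s0) x t0 \<longrightarrow>
      is_closest (seg t0 s0) y s0 \<longrightarrow> separates k {x} {y}"
    using dual_chain_exists[OF \<eta>(1), of "L + 1"] unfolding \<eta> by auto
  have sep: "separates j {t} {s}" if "j \<in> c" "t \<in> seg a b" "s \<in> seg u v" for j s t
  proof -
    \<comment> \<open>Each segment projects to its end of the shortest connection, so the dual curtains separate the two.\<close>
    have "is_closest (seg t0 s0) s s0"
      by (rule proj[OF st(1) geo_convex_seg _ that(3)]) (use min[OF _ st(2)] in \<open>simp add: dist_commute\<close>)
    moreover have "is_closest (seg s0 t0) t t0"
      by (rule proj[OF st(2) geo_convex_seg _ that(2)]) (use min[OF st(1)] in simp)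
    ultimately show ?thesis using csep that(1) by (simp add: seg_commute[of s0])
  qed
  have "j \<inter> h \<noteq> {} \<and> j \<inter> k \<noteq> {}" if j: "j \<in> c" for j
  proof -
    obtain p q p' q' where "p \<in> seg u v" "p \<in> h" "q \<in> seg a b" "q \<in> h" "p' \<in> seg u v" "p' \<in> k" "q' \<in> seg a b" "q' \<in> k"
      using S T by auto
    then have "h \<inter> j \<noteq> {}" "k \<inter> j \<noteq> {}"
      using separates_meets[OF sep[OF j]] L_separated_connected[OF L] by blast+
    then show ?thesis by (simp add: Int_commute)
  qed
  then have "card c \<le> L" using L c(1) unfolding L_separated_def by blast
  then show False using c(2) by simp
qed

section \<open>Contracting geodesic lines\<close>

abbreviation foot :: "(real \<Rightarrow> 'a::metric_space) \<Rightarrow> 'a \<Rightarrow> real" where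
  "foot \<gamma> \<equiv> coord UNIV \<gamma>"

definition height :: "(real \<Rightarrow> 'a::metric_space) \<Rightarrow> 'a \<Rightarrow> real" where
  "height \<gamma> x = dist x (\<gamma> (foot \<gamma> x))"

lemma height_nonneg [simp]: "0 \<le> height \<gamma> x"
  by (simp add: height_def)

context
  fixes \<gamma> :: "real \<Rightarrow> 'a::cat0_space"
  assumes \<gamma>: "geodesic_on UNIV \<gamma>"
begin

lemma line_dist: "dist (\<gamma> s) (\<gamma> t) = \<bar>s - t\<bar>"
  using geodesic_on_dist[OF \<gamma>] by simp

lemma line_proj_defined: "proj_defined (range \<gamma>)"
  by (rule proj_defined_geodesic[OF \<gamma>]) auto

lemma foot_line [simp]: "foot \<gamma> (\<gamma> t) = t"
  by (rule coord_geodesic[OF \<gamma> line_proj_defined]) simp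

lemma foot_nonexpansive: "\<bar>foot \<gamma> x - foot \<gamma> y\<bar> \<le> dist x y"
  by (rule coord_nonexpansive[OF \<gamma> line_proj_defined])

lemma foot_closest: "is_closest (range \<gamma>) x (\<gamma> (foot \<gamma> x))"
  by (rule is_closest_coord[OF \<gamma> line_proj_defined])

lemma proj_line: "proj (range \<gamma>) x = \<gamma> (foot \<gamma> x)"
  by (rule proj_eq_coord[OF \<gamma> line_proj_defined])

lemma height_le: "height \<gamma> x \<le> dist x (\<gamma> t)"
  using foot_closest[of x] by (simp add: is_closest_def height_def)

lemma foot_le: "\<bar>foot \<gamma> x - t\<bar> \<le> dist x (\<gamma> t)"
  using foot_nonexpansive[of x "\<gamma> t"] by simp

lemma height_nonexpansive: "\<bar>height \<gamma> x - height \<gamma> y\<bar> \<le> dist x y"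
proof -
  have "height \<gamma> x \<le> height \<gamma> y + dist x y" for x y
    using height_le[of x "foot \<gamma> y"] dist_triangle[of x "\<gamma> (foot \<gamma> y)" y] by (simp add: height_def)
  from this[of x y] this[of y x] show ?thesis by (simp add: dist_commute abs_le_iff)
qed

lemma foot_on_perpendicular: "z \<in> seg x (\<gamma> (foot \<gamma> x)) \<Longrightarrow> foot \<gamma> z = foot \<gamma> x"
  by (rule coord_on_seg[OF \<gamma> line_proj_defined])

lemma dist_le_via_line: "dist x y \<le> height \<gamma> x + \<bar>foot \<gamma> x - foot \<gamma> y\<bar> + height \<gamma> y"
  using dist_triangle[of x y "\<gamma> (foot \<gamma> x)"] dist_triangle[of "\<gamma> (foot \<gamma> x)" y "\<gamma> (foot \<gamma> y)"]
  by (simp add: height_def line_dist dist_commute[of y])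

lemma seg_line:
  assumes "z \<in> seg (\<gamma> a) (\<gamma> b)"
  shows "\<exists>u. z = \<gamma> u \<and> min a b \<le> u \<and> u \<le> max a b"
proof (cases "a \<le> b")
  case True
  have "seg (\<gamma> a) (\<gamma> b) = \<gamma> ` {a..b}" by (rule seg_geodesic[OF \<gamma> _ _ True]) auto
  then show ?thesis using assms True by auto
next
  case False
  have "seg (\<gamma> b) (\<gamma> a) = \<gamma> ` {b..a}" by (rule seg_geodesic[OF \<gamma>]) (use False in auto)
  then show ?thesis using assms False seg_commute[of "\<gamma> a"] by auto
qed

lemma contracting_lineI:
  assumes M: "\<And>x y. dist x y < height \<gamma> x \<Longrightarrow> \<bar>foot \<gamma> x - foot \<gamma> y\<bar> \<le> M"
  shows "contracting (range \<gamma>)"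
  unfolding contracting_def R_contracting_def
proof (intro exI[of _ "2 * \<bar>M\<bar>"] allI impI)
  fix x r assume disj: "ball x r \<inter> range \<gamma> = {}"
  let ?P = "proj (range \<gamma>) ` ball x r"
  have "\<gamma> (foot \<gamma> x) \<notin> ball x r" using disj by auto
  then have r: "r \<le> height \<gamma> x" by (simp add: height_def)
  have near: "dist (\<gamma> (foot \<gamma> x)) p \<le> \<bar>M\<bar>" if p: "p \<in> ?P" for p
  proof -
    obtain y where y: "dist x y < r" "p = \<gamma> (foot \<gamma> y)" using p by (auto simp: proj_line)
    then show ?thesis using M[of x y] r by (simp add: line_dist)
  qed
  then have bdd: "bounded ?P" unfolding bounded_def by blast
  have "dist p q \<le> 2 * \<bar>M\<bar>" if "p \<in> ?P" "q \<in> ?P" for p q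
    using near[OF that(1)] near[OF that(2)] dist_triangle3[of p q "\<gamma> (foot \<gamma> x)"] by linarith
  then have "diameter ?P \<le> 2 * \<bar>M\<bar>"
    unfolding diameter_def by (auto intro!: cSUP_least)
  with bdd show "bounded ?P \<and> diameter ?P \<le> 2 * \<bar>M\<bar>" by simp
qed

lemma contracting_lineD:
  assumes R: "R_contracting R (range \<gamma>)" and xy: "dist x y < height \<gamma> x"
  shows "\<bar>foot \<gamma> x - foot \<gamma> y\<bar> \<le> R"
proof -
  let ?P = "proj (range \<gamma>) ` ball x (height \<gamma> x)"
  have "ball x (height \<gamma> x) \<inter> range \<gamma> = {}" using leD[OF height_le] by auto
  then have P: "bounded ?P" "diameter ?P \<le> R" using R by (simp_all add: R_contracting_def)
  have "0 < height \<gamma> x" using xy zero_le_dist[of x y] by linarith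
  then have "proj (range \<gamma>) x \<in> ?P" "proj (range \<gamma>) y \<in> ?P" using xy by auto
  then have "dist (proj (range \<gamma>) x) (proj (range \<gamma>) y) \<le> R"
    using diameter_bounded_bound[OF P(1)] P(2) order_trans by blast
  then show ?thesis by (simp add: proj_line line_dist)
qed

text \<open>
  Of two \<open>L\<close>-separated curtains that cross the line away from its point \<open>\<gamma> s\<close>, only one can meet
  a perpendicular at \<open>\<gamma> s\<close>: otherwise the part of the perpendicular between them is far from the line,
  contrary to \<open>L_separated_segments_close\<close>.
\<close>

lemma perpendicular_meets_one:
  assumes L: "L_separated L h k" and s: "s = foot \<gamma> x"
    and sep: "separates h {\<gamma> s} {\<gamma> t}" "separates k {\<gamma> s} {\<gamma> t}"
    and far: "h \<inter> cball (\<gamma> s) \<rho> = {}" "k \<inter> cball (\<gamma> s) \<rho> = {}" "2 * (real L + 1) \<le> \<rho>"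
    and h: "h \<inter> seg x (\<gamma> s) \<noteq> {}"
  shows "k \<inter> seg x (\<gamma> s) = {}"
proof (rule ccontr)
  assume "\<not> ?thesis"
  with h obtain p q where p: "p \<in> h" "p \<in> seg (\<gamma> s) x" and q: "q \<in> k" "q \<in> seg (\<gamma> s) x"
    by (auto simp: seg_commute)
  have "seg p q \<inter> h \<noteq> {}" "seg p q \<inter> k \<noteq> {}"
    using p(1) q(1) endpoints_in_seg[where x = p and y = q] by blast+
  moreover have "seg (\<gamma> s) (\<gamma> t) \<inter> h \<noteq> {}" "seg (\<gamma> s) (\<gamma> t) \<inter> k \<noteq> {}"
    using separates_meets[OF sep(1) connected_seg] separates_meets[OF sep(2) connected_seg] by auto
  ultimately obtain z w where z: "z \<in> seg p q" and w: "w \<in> seg (\<gamma> s) (\<gamma> t)"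
    and zw: "dist z w < 2 * (real L + 1)"
    using L_separated_segments_close[OF L] by blast
  have zs: "z \<in> seg (\<gamma> s) x" using geo_convex_seg[of "\<gamma> s" x] p q z unfolding geo_convex_def by auto
  have "dist p z + dist z q = dist p q" using z by (simp add: seg_def)
  then have "dist (\<gamma> s) p \<le> dist (\<gamma> s) z \<or> dist (\<gamma> s) q \<le> dist (\<gamma> s) z"
    unfolding dist_on_seg[OF p(2) zs] dist_on_seg[OF zs q(2)] dist_on_seg[OF p(2) q(2)] by linarith
  moreover have "\<rho> < dist (\<gamma> s) p" "\<rho> < dist (\<gamma> s) q" using far(1,2) p(1) q(1) by force+
  ultimately have "\<rho> < dist z (\<gamma> s)" by (auto simp: dist_commute)
  moreover have "foot \<gamma> z = s" using foot_on_perpendicular[of z x] zs s by (simp add: seg_commute)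
  then have "dist z (\<gamma> s) \<le> dist z w" using height_le[of z] seg_line[OF w] unfolding height_def by auto
  ultimately show False using zw far(3) by linarith
qed

text \<open>
  Suppose a ball about \<open>x\<close> misses the line and contains a point \<open>y\<close> whose foot is far from that of
  \<open>x\<close>. Of a long \<open>L\<close>-chain crossing the line between the two feet, only boundedly many curtains
  meet the perpendiculars through \<open>x\<close> and \<open>y\<close>; two remaining ones force \<open>[x, y]\<close> to pass close to
  a point of the line whose distance from the foot of \<open>y\<close> is large. Then \<open>d(x, y)\<close> exceeds the
  distance from \<open>x\<close> to the line, a contradiction. The margin \<open>\<tau>\<close> allows for chains that are only known
  between points near the two feet, such as points of an orbit.
\<close>

lemma contracting_if_long_L_chains:
  assumes chains: "\<And>N. \<exists>M. \<forall>s t. M \<le> \<bar>t - s\<bar> \<longrightarrow> (\<exists>s0 t0 c. \<bar>s - s0\<bar> \<le> \<tau> \<and> \<bar>t - t0\<bar> \<le> \<tau> \<and>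
      L_chain L c \<and> chain_separates c {\<gamma> s0} {\<gamma> t0} \<and> N \<le> card c)"
  shows "contracting (range \<gamma>)"
proof -
  define \<delta> where "\<delta> = 2 * (real L + 1)"
  \<comment> \<open>A ball of radius \<open>\<rho>\<close> about a foot contains the nearby point that the chain separates; a passage within \<open>\<delta>\<close> of the
    line at distance more than \<open>2 * \<delta>\<close> from the foot of \<open>y\<close> makes \<open>[x, y]\<close> too long.\<close>
  define \<rho> where "\<rho> = max \<tau> (2 * \<delta>)"
  define K where "K = ball_bound \<rho>"
  have \<rho>: "\<tau> \<le> \<rho>" "2 * \<delta> \<le> \<rho>" "\<delta> \<le> \<rho>" "0 \<le> \<rho>" by (auto simp: \<rho>_def \<delta>_def)
  \<comment> \<open>At most \<open>K\<close> curtains are lost at each foot and one on each perpendicular, and two must remain.\<close>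
  obtain M where M: "\<And>s t. M \<le> \<bar>t - s\<bar> \<Longrightarrow> \<exists>s0 t0 c. \<bar>s - s0\<bar> \<le> \<tau> \<and> \<bar>t - t0\<bar> \<le> \<tau> \<and>
      L_chain L c \<and> chain_separates c {\<gamma> s0} {\<gamma> t0} \<and> 2 * K + 4 \<le> card c"
    using chains[of "2 * K + 4"] by blast
  show ?thesis
  proof (rule contracting_lineI[of M], rule ccontr)
    fix x y assume xy: "dist x y < height \<gamma> x" and "\<not> \<bar>foot \<gamma> x - foot \<gamma> y\<bar> \<le> M"
    define s where "s = foot \<gamma> x"
    define t where "t = foot \<gamma> y"
    have "M \<le> \<bar>t - s\<bar>" using \<open>\<not> _\<close> by (simp add: s_def t_def)
    from M[OF this] obtain s0 t0 c where st0: "\<bar>s - s0\<bar> \<le> \<tau>" "\<bar>t - t0\<bar> \<le> \<tau>" and c: "L_chain L c"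
      and csep: "chain_separates c {\<gamma> s0} {\<gamma> t0}" and card: "2 * K + 4 \<le> card c" by blast
    have ch: "chain c" using c by (simp add: L_chain_def)
    have fin: "finite c" using card by (metis card.infinite le_zero_eq add_is_0 zero_neq_numeral)
    define c1 where "c1 = {h \<in> c. h \<inter> cball (\<gamma> s) \<rho> \<noteq> {}}"
    define c2 where "c2 = {h \<in> c. h \<inter> cball (\<gamma> t) \<rho> \<noteq> {}}"
    define c3 where "c3 = {h \<in> c - c1 - c2. h \<inter> seg x (\<gamma> s) \<noteq> {}}"
    define c4 where "c4 = {h \<in> c - c1 - c2. h \<inter> seg y (\<gamma> t) \<noteq> {}}"
    have Lsep: "L_separated L h k" if "h \<in> c" "k \<in> c" "h \<noteq> k" for h k
      using c that by (simp add: L_chain_def)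
    have near: "seg (\<gamma> a0) (\<gamma> a) \<subseteq> cball (\<gamma> a) \<rho>" if "\<bar>a - a0\<bar> \<le> \<tau>" for a a0
    proof
      fix z assume "z \<in> seg (\<gamma> a0) (\<gamma> a)"
      then have "dist (\<gamma> a) z \<le> dist (\<gamma> a0) (\<gamma> a)"
        unfolding seg_def mem_Collect_eq dist_commute[of z] using zero_le_dist[of "\<gamma> a0" z] by linarith
      then show "z \<in> cball (\<gamma> a) \<rho>" using that \<rho>(1) by (simp add: line_dist abs_minus_commute)
    qed
    have sep: "separates h {\<gamma> s} {\<gamma> t}" if h: "h \<in> c - c1 - c2" for h
    proof -
      have 0: "separates h {\<gamma> s0} {\<gamma> t0}" using csep h by (simp add: chain_separates_def)
      have 1: "separates h {\<gamma> s} {\<gamma> t0}"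
        by (rule separates_move[OF 0 connected_seg[of "\<gamma> s0" "\<gamma> s"]])
          (use h near[OF st0(1)] in \<open>auto simp: c1_def\<close>)
      have 2: "separates h {\<gamma> t0} {\<gamma> s}" using 1 separates_commute by blast
      have "separates h {\<gamma> t} {\<gamma> s}"
        by (rule separates_move[OF 2 connected_seg[of "\<gamma> t0" "\<gamma> t"]])
          (use h near[OF st0(2)] in \<open>auto simp: c2_def\<close>)
      then show ?thesis using separates_commute by blast
    qed
    have "card c1 \<le> K" "card c2 \<le> K"
      unfolding c1_def c2_def K_def using chain_near_ball[OF ch] by auto
    moreover have "card c3 \<le> 1"
    proof -
      have "h = k" if hk: "h \<in> c3" "k \<in> c3" for h k
      proof (rule ccontr)
        assume "h \<noteq> k"
        then have L: "L_separated L h k" using Lsep hk by (auto simp: c3_def)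
        have "k \<inter> seg x (\<gamma> s) = {}"
          by (rule perpendicular_meets_one[OF L s_def sep sep])
            (use hk \<rho>(3) in \<open>auto simp: c3_def c1_def \<delta>_def\<close>)
        then show False using hk by (simp add: c3_def)
      qed
      then show ?thesis by (metis card_le_Suc0_iff_eq One_nat_def card.infinite zero_le)
    qed
    moreover have "card c4 \<le> 1"
    proof -
      have "h = k" if hk: "h \<in> c4" "k \<in> c4" for h k
      proof (rule ccontr)
        assume "h \<noteq> k"
        then have L: "L_separated L h k" using Lsep hk by (auto simp: c4_def)
        have "k \<inter> seg y (\<gamma> t) = {}"
        proof (rule perpendicular_meets_one[OF L t_def])
          show "separates h {\<gamma> t} {\<gamma> s}" "separates k {\<gamma> t} {\<gamma> s}"
            using sep[of h] sep[of k] hk separates_commute by (auto simp: c4_def)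
        qed (use hk \<rho>(3) in \<open>auto simp: c4_def c2_def \<delta>_def\<close>)
        then show False using hk by (simp add: c4_def)
      qed
      then show ?thesis by (metis card_le_Suc0_iff_eq One_nat_def card.infinite zero_le)
    qed
    moreover have "card c - card c1 \<le> card (c - c1)" "card (c - c1) - card c2 \<le> card (c - c1 - c2)"
      "card (c - c1 - c2) - card c3 \<le> card (c - c1 - c2 - c3)"
      "card (c - c1 - c2 - c3) - card c4 \<le> card (c - c1 - c2 - c3 - c4)"
      by (rule diff_card_le_card_Diff, use fin in \<open>simp add: c1_def c2_def c3_def c4_def\<close>)+
    ultimately have "\<not> card (c - c1 - c2 - c3 - c4) \<le> Suc 0" using card by linarith
    then obtain h k where hk: "h \<in> c - c1 - c2 - c3 - c4" "k \<in> c - c1 - c2 - c3 - c4" "h \<noteq> k"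
      using fin by (metis card_le_Suc0_iff_eq finite_Diff)
    have sepxy: "separates h {x} {y}" if h: "h \<in> c - c1 - c2 - c3 - c4" for h
    proof -
      have 0: "separates h {\<gamma> s} {\<gamma> t}" using sep h by simp
      have 1: "separates h {x} {\<gamma> t}"
        by (rule separates_move[OF 0 connected_seg[of x "\<gamma> s"]]) (use h in \<open>auto simp: c3_def\<close>)
      have 2: "separates h {\<gamma> t} {x}" using 1 separates_commute by blast
      have "separates h {y} {x}"
        by (rule separates_move[OF 2 connected_seg[of y "\<gamma> t"]]) (use h in \<open>auto simp: c4_def\<close>)
      then show ?thesis using separates_commute by blast
    qed
    have crosses: "\<exists>a. \<gamma> a \<in> h \<and> min s t \<le> a \<and> a \<le> max s t \<and> \<rho> < \<bar>t - a\<bar>"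
      if h: "h \<in> c - c1 - c2 - c3 - c4" for h
    proof -
      have "seg (\<gamma> s) (\<gamma> t) \<inter> h \<noteq> {}"
        by (rule separates_meets[OF sep connected_seg]) (use h in auto)
      then obtain z where z: "z \<in> seg (\<gamma> s) (\<gamma> t)" "z \<in> h" by blast
      obtain a where a: "z = \<gamma> a" "min s t \<le> a" "a \<le> max s t" using seg_line[OF z(1)] by blast
      have "\<gamma> a \<notin> cball (\<gamma> t) \<rho>" using h z(2) a(1) by (auto simp: c2_def)
      then have "\<rho> < \<bar>t - a\<bar>" by (simp add: line_dist)
      then show ?thesis using a z by blast
    qed
    obtain a where a: "\<gamma> a \<in> h" "min s t \<le> a" "a \<le> max s t" "\<rho> < \<bar>t - a\<bar>" using crosses hk by blast
    obtain b where b: "\<gamma> b \<in> k" "min s t \<le> b" "b \<le> max s t" "\<rho> < \<bar>t - b\<bar>" using crosses hk by blast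
    have "seg x y \<inter> h \<noteq> {}" "seg x y \<inter> k \<noteq> {}"
      using separates_meets[OF sepxy[OF hk(1)] connected_seg] separates_meets[OF sepxy[OF hk(2)] connected_seg] by auto
    moreover have "seg (\<gamma> a) (\<gamma> b) \<inter> h \<noteq> {}" "seg (\<gamma> a) (\<gamma> b) \<inter> k \<noteq> {}"
      using a(1) b(1) endpoints_in_seg[where x = "\<gamma> a" and y = "\<gamma> b"] by blast+
    moreover have "L_separated L h k" using Lsep hk by simp
    ultimately obtain z w where z: "z \<in> seg x y" and w: "w \<in> seg (\<gamma> a) (\<gamma> b)" and zw: "dist z w < \<delta>"
      using L_separated_segments_close unfolding \<delta>_def by metis
    obtain u where u: "w = \<gamma> u" "min a b \<le> u" "u \<le> max a b" using seg_line[OF w] by blast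
    have "\<rho> < \<bar>t - u\<bar>" using a(2-4) b(2-4) u(2,3) by (auto simp: min_def max_def split: if_splits)
    moreover have "\<bar>t - u\<bar> \<le> dist y w" using foot_le[of y u] u(1) by (simp add: t_def)
    moreover have "height \<gamma> x \<le> dist x w" using height_le u(1) by simp
    moreover have "dist x w \<le> dist x z + dist z w" "dist y w \<le> dist z y + dist z w"
      using dist_triangle[of x w z] dist_triangle[of y w z] by (simp_all add: dist_commute)
    moreover have "dist x z + dist z y = dist x y" using z by (simp add: seg_def)
    ultimately show False using xy zw \<rho>(2) by linarith
  qed
qed

text \<open>Contraction concerns open balls; points on the boundary sphere are approximated along \<open>[x, y]\<close>.\<close>

lemma contracting_closed_ball:
  assumes R: "R_contracting R (range \<gamma>)" "0 \<le> R" and xy: "dist x y \<le> height \<gamma> x"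
  shows "\<bar>foot \<gamma> x - foot \<gamma> y\<bar> \<le> R"
proof (rule field_le_epsilon)
  fix e :: real assume e: "0 < e"
  define d where "d = dist x y"
  have d: "0 \<le> d" by (simp add: d_def)
  show "\<bar>foot \<gamma> x - foot \<gamma> y\<bar> \<le> R + e"
  proof (cases "d = 0")
    case True
    then show ?thesis using R e by (simp add: d_def)
  next
    case False
    define l where "l = d / (d + e)"
    have l: "0 \<le> l" "l < 1" "l \<le> 1" "(1 - l) * d \<le> e" using d e False by (auto simp: l_def field_simps)
    have "dist x (along x y l) = l * d" "dist (along x y l) y = (1 - l) * d"
      using dist_along[of l x y] l by (auto simp: d_def)
    moreover have "l * d < d" using l(2) d False by simp
    ultimately have "\<bar>foot \<gamma> x - foot \<gamma> (along x y l)\<bar> \<le> R" "\<bar>foot \<gamma> (along x y l) - foot \<gamma> y\<bar> \<le> e"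
      using contracting_lineD[OF R(1), of x "along x y l"] foot_nonexpansive[of "along x y l" y] xy l(4)
      by (auto simp: d_def)
    then show ?thesis by linarith
  qed
qed

text \<open>
  The balls about \<open>y\<close> and \<open>z\<close> that just reach the line have short projections, so \<open>[y, z]\<close> leaves
  them at points \<open>p\<close> and \<open>q\<close> whose feet are more than \<open>R\<close> apart; hence \<open>q\<close> is outside the ball about \<open>p\<close>
  that just reaches the line. As \<open>d(p, q)\<close> is at most the distance between the feet of \<open>y\<close> and \<open>z\<close>, this
  bounds the height of \<open>p\<close>.
\<close>

lemma contracting_seg_passes_near:
  assumes R: "R_contracting R (range \<gamma>)" "0 \<le> R" and yz: "\<bar>foot \<gamma> y - foot \<gamma> z\<bar> = 3 * R + 1"
  shows "\<exists>p\<in>seg y z. height \<gamma> p \<le> 3 * R + 1 \<and> \<bar>foot \<gamma> y - foot \<gamma> p\<bar> \<le> R"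
proof -
  note cb = contracting_closed_ball[OF R]
  define D where "D = dist y z"
  have Hy: "height \<gamma> y < D" using cb[of y z] yz R(2) unfolding D_def by linarith
  have Hz: "height \<gamma> z < D" using cb[of z y] yz R(2) unfolding D_def dist_commute[of z y] by linarith
  have D: "0 < D" using Hy height_nonneg[of \<gamma> y] by linarith
  define l where "l = height \<gamma> y / D"
  define m where "m = 1 - height \<gamma> z / D"
  have l: "0 \<le> l" "l \<le> 1" "l * D = height \<gamma> y" using Hy D by (auto simp: l_def)
  have m: "0 \<le> m" "m \<le> 1" "(1 - m) * D = height \<gamma> z" using Hz D by (auto simp: m_def)
  define p where "p = along y z l"
  define q where "q = along y z m"
  have p: "dist y p = height \<gamma> y" "dist p z = D - height \<gamma> y"
    using dist_along[OF l(1,2), of y z] l(3) by (auto simp: p_def D_def algebra_simps)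
  have q: "dist z q = height \<gamma> z" using dist_along[OF m(1,2), of y z] m(3) by (auto simp: q_def D_def dist_commute)
  have fp: "\<bar>foot \<gamma> y - foot \<gamma> p\<bar> \<le> R" using cb[of y p] p by simp
  have fq: "\<bar>foot \<gamma> z - foot \<gamma> q\<bar> \<le> R" using cb[of z q] q by simp
  have "height \<gamma> y + height \<gamma> z < D"
  proof (rule ccontr)
    assume "\<not> ?thesis"
    then have "dist z p \<le> height \<gamma> z" using p(2) by (simp add: dist_commute)
    then have "\<bar>foot \<gamma> z - foot \<gamma> p\<bar> \<le> R" by (rule cb)
    then show False using fp yz R(2) by linarith
  qed
  moreover have pq: "dist p q = \<bar>l * D - m * D\<bar>"
    unfolding p_def q_def D_def using dist_along_along[of l m y z] l m by (simp add: abs_mult flip: left_diff_distrib)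
  moreover have "m * D = D - height \<gamma> z" using m(3) by (simp add: algebra_simps)
  ultimately have "dist p q = D - height \<gamma> z - height \<gamma> y" using l(3) by simp
  then have pq': "dist p q \<le> 3 * R + 1" using dist_le_via_line[of y z] yz by (simp add: D_def)
  have "\<not> dist p q < height \<gamma> p"
  proof
    assume "dist p q < height \<gamma> p"
    then have "\<bar>foot \<gamma> p - foot \<gamma> q\<bar> \<le> R" by (rule contracting_lineD[OF R(1)])
    then show False using fp fq yz R(2) by linarith
  qed
  then have "height \<gamma> p \<le> 3 * R + 1" using pq' by linarith
  moreover have "p \<in> seg y z" unfolding p_def by (rule along_in_seg[OF l(1,2)])
  ultimately show ?thesis using fp by blast
qed

lemma continuous_on_foot: "continuous_on S (foot \<gamma>)"
proof (rule lipschitz_on_continuous_on)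
  show "1-lipschitz_on S (foot \<gamma>)"
    using foot_nonexpansive by (intro lipschitz_onI) (auto simp: dist_real_def)
qed

lemma contracting_seg_near_point:
  assumes R: "R_contracting R (range \<gamma>)" "0 \<le> R" and yz: "3 * R + 1 \<le> \<bar>foot \<gamma> y - foot \<gamma> z\<bar>"
  shows "\<exists>p\<in>seg y z. dist (\<gamma> 0) p \<le> \<bar>foot \<gamma> y\<bar> + 4 * R + 1"
proof -
  have "connected ((\<lambda>u. \<bar>foot \<gamma> y - foot \<gamma> u\<bar>) ` seg y z)"
    by (intro connected_continuous_image connected_seg continuous_intros continuous_on_foot)
  moreover have "\<bar>foot \<gamma> y - foot \<gamma> y\<bar> \<in> (\<lambda>u. \<bar>foot \<gamma> y - foot \<gamma> u\<bar>) ` seg y z"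
    "\<bar>foot \<gamma> y - foot \<gamma> z\<bar> \<in> (\<lambda>u. \<bar>foot \<gamma> y - foot \<gamma> u\<bar>) ` seg y z"
    by (rule imageI, simp)+
  ultimately have "3 * R + 1 \<in> (\<lambda>u. \<bar>foot \<gamma> y - foot \<gamma> u\<bar>) ` seg y z"
    by (rule connectedD_interval) (use R(2) yz in auto)
  then obtain z' where z': "z' \<in> seg y z" "\<bar>foot \<gamma> y - foot \<gamma> z'\<bar> = 3 * R + 1" by force
  obtain p where p: "p \<in> seg y z'" "height \<gamma> p \<le> 3 * R + 1" "\<bar>foot \<gamma> y - foot \<gamma> p\<bar> \<le> R"
    using contracting_seg_passes_near[OF R z'(2)] by blast
  have "p \<in> seg y z" using seg_subset_seg[OF z'(1)] p(1) by blast
  moreover have "dist (\<gamma> 0) p \<le> \<bar>foot \<gamma> p\<bar> + height \<gamma> p"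
    using dist_triangle[of "\<gamma> 0" p "\<gamma> (foot \<gamma> p)"] by (simp add: line_dist height_def dist_commute)
  ultimately show ?thesis using p(2,3) by (intro bexI[of _ p]) linarith+
qed

lemma line_curtain:
  "curtain_halfspaces {x. \<bar>foot \<gamma> x - r\<bar> \<le> 1/2} {x. foot \<gamma> x < r - 1/2} {x. r + 1/2 < foot \<gamma> x}"
  by (rule curtain_halfspaces_coord[OF \<gamma> line_proj_defined]) simp

text \<open>
  A curtain \<open>k\<close> that meets two distant curtains dual to the line contains a path of three geodesics,
  the middle one short, whose feet move far along the line. So one of the other two passes within
  a bounded distance of \<open>\<gamma> 0\<close>, and \<open>chain_near_ball\<close> bounds the number of such curtains in a chain.
\<close>

lemma contracting_dual_curtains_separated:
  assumes "contracting (range \<gamma>)"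
  shows "\<exists>M>1. separated {x. \<bar>foot \<gamma> x - 0\<bar> \<le> 1/2} {x. \<bar>foot \<gamma> x - M\<bar> \<le> 1/2}"
proof -
  obtain R0 where R0: "R_contracting R0 (range \<gamma>)" using assms by (auto simp: contracting_def)
  define R where "R = max 0 R0"
  have R: "R_contracting R (range \<gamma>)" "0 \<le> R"
    using R0 unfolding R_contracting_def R_def by (auto simp: le_max_iff_disj)
  define D where "D = 3 * R + 1"
  \<comment> \<open>If the first geodesic of the path moves the foot by less than \<open>D\<close>, the second one starts at a foot
    of modulus less than \<open>D + 1/2\<close> and moves it by at most 1; \<open>M\<close> leaves at least \<open>D\<close> for the third.\<close>
  define M where "M = 2 * D + 3"
  define \<rho> where "\<rho> = D + 3/2 + 4 * R + 1"
  let ?h = "{x. \<bar>foot \<gamma> x - 0\<bar> \<le> 1/2}" and ?h' = "{x. \<bar>foot \<gamma> x - M\<bar> \<le> 1/2}"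
  have meets: "k \<inter> cball (\<gamma> 0) \<rho> \<noteq> {}" if k: "curtain k" "k \<inter> ?h \<noteq> {}" "k \<inter> ?h' \<noteq> {}" for k
  proof -
    obtain A B where "curtain_halfspaces k A B" using k(1) by (rule curtainE)
    from curtain_halfspaces_slab[OF this] obtain f where f: "slab_function f" "k = {x. \<bar>f x\<bar> \<le> 1/2}" by blast
    obtain y z where y: "y \<in> k" "\<bar>foot \<gamma> y\<bar> \<le> 1/2" and z: "z \<in> k" "\<bar>foot \<gamma> z - M\<bar> \<le> 1/2" using k by auto
    have "\<bar>f y\<bar> \<le> 1/2" "\<bar>f z\<bar> \<le> 1/2" using y(1) z(1) f(2) by simp_all
    with f(1) have "\<exists>y' z'. dist y' z' \<le> 1 \<and> (\<forall>u \<in> seg y y' \<union> seg y' z' \<union> seg z' z. \<bar>f u\<bar> \<le> 1/2)"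
      unfolding slab_function_def by simp
    then obtain y' z' where y'z': "dist y' z' \<le> 1"
      and "\<forall>u \<in> seg y y' \<union> seg y' z' \<union> seg z' z. \<bar>f u\<bar> \<le> 1/2" by (elim exE conjE)
    then have sub: "seg y y' \<union> seg y' z' \<union> seg z' z \<subseteq> k" unfolding f(2) by (intro subsetI CollectI) simp
    show ?thesis
    proof (cases "D \<le> \<bar>foot \<gamma> y - foot \<gamma> y'\<bar>")
      case True
      then obtain p where p: "p \<in> seg y y'" "dist (\<gamma> 0) p \<le> \<bar>foot \<gamma> y\<bar> + 4 * R + 1"
        using contracting_seg_near_point[OF R] unfolding D_def by blast
      then have "p \<in> k \<inter> cball (\<gamma> 0) \<rho>" using sub y(2) R(2) by (auto simp: \<rho>_def D_def)
      then show ?thesis by blast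
    next
      case False
      have "\<bar>foot \<gamma> y' - foot \<gamma> z'\<bar> \<le> 1" using foot_nonexpansive[of y' z'] y'z' by linarith
      then have z'0: "\<bar>foot \<gamma> z'\<bar> \<le> D + 3/2" using False y(2) by linarith
      then have "D \<le> \<bar>foot \<gamma> z' - foot \<gamma> z\<bar>" using z(2) unfolding M_def by linarith
      then obtain p where p: "p \<in> seg z' z" "dist (\<gamma> 0) p \<le> \<bar>foot \<gamma> z'\<bar> + 4 * R + 1"
        using contracting_seg_near_point[OF R] unfolding D_def by blast
      then have "p \<in> k \<inter> cball (\<gamma> 0) \<rho>" using sub z'0 by (auto simp: \<rho>_def)
      then show ?thesis by blast
    qed
  qed
  have "L_separated (ball_bound \<rho>) ?h ?h'"
    unfolding L_separated_def
  proof (intro conjI allI impI)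
    show "curtain ?h" "curtain ?h'" unfolding curtain_def using line_curtain by blast+
    show "?h \<inter> ?h' = {}"
    proof (rule ccontr)
      assume "?h \<inter> ?h' \<noteq> {}"
      then obtain x where x: "x \<in> ?h" "x \<in> ?h'" by blast
      have "foot \<gamma> x \<le> 1/2" using x(1) unfolding mem_Collect_eq by linarith
      moreover have "M - 1/2 \<le> foot \<gamma> x" using x(2) unfolding mem_Collect_eq by linarith
      ultimately show False using R(2) by (simp add: M_def D_def)
    qed
  next
    fix c assume c: "chain c \<and> (\<forall>k\<in>c. k \<inter> ?h \<noteq> {} \<and> k \<inter> ?h' \<noteq> {})"
    then have "{k \<in> c. k \<inter> cball (\<gamma> 0) \<rho> \<noteq> {}} = c" using meets chain_curtain by blast
    then show "finite c" "card c \<le> ball_bound \<rho>" using chain_near_ball[of c "\<gamma> 0" \<rho>] c by auto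
  qed
  then have "separated ?h ?h'" unfolding separated_def by blast
  moreover have "1 < M" using R(2) by (simp add: M_def D_def)
  ultimately show ?thesis by blast
qed

end

section \<open>Isometries move curtains\<close>

lemma isometry_dist: "isometry g \<Longrightarrow> dist (g x) (g y) = dist x y"
  by (simp add: isometry_def)

lemma isometry_inj: "isometry g \<Longrightarrow> inj g"
  by (simp add: isometry_def bij_is_inj)

lemma isometry_inv: "isometry g \<Longrightarrow> isometry (inv g)"
  unfolding isometry_def by (metis bij_betw_def bij_imp_bij_inv surj_f_inv_f)

lemma isometry_id: "isometry id"
  by (simp add: isometry_def)

lemma isometry_comp: "isometry f \<Longrightarrow> isometry g \<Longrightarrow> isometry (f \<circ> g)"
  by (simp add: isometry_def bij_comp)

lemma isometry_funpow: "isometry g \<Longrightarrow> isometry (g ^^ n)"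
  by (induction n) (auto simp: isometry_id isometry_comp)

lemma isometry_int_iterate: "isometry g \<Longrightarrow> isometry (int_iterate g n)"
  by (simp add: int_iterate_def isometry_funpow isometry_inv)

lemma int_iterate_0 [simp]: "int_iterate g 0 = id"
  by (simp add: int_iterate_def)

lemma int_iterate_of_nat: "int_iterate g (int n) = g ^^ n"
  by (simp add: int_iterate_def)

lemma int_iterate_Suc: "isometry g \<Longrightarrow> int_iterate g (n + 1) x = g (int_iterate g n x)"
proof (cases "0 \<le> n")
  case True
  then have "nat (n + 1) = Suc (nat n)" by simp
  then show ?thesis using True by (simp add: int_iterate_def)
next
  case False
  assume g: "isometry g"
  have "nat (- n) = Suc (nat (- n - 1))" using False by simp
  then have "g ((inv g ^^ nat (- n)) x) = (inv g ^^ nat (- n - 1)) x"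
    using g by (simp add: isometry_def bij_is_surj surj_f_inv_f)
  then show ?thesis using False by (cases "n = -1") (auto simp: int_iterate_def)
qed

lemma int_iterate_add:
  assumes g: "isometry g"
  shows "int_iterate g (m + n) x = int_iterate g m (int_iterate g n x)"
proof (induction m rule: int_induct[where k = 0])
  case base
  then show ?case by simp
next
  case (step1 i)
  have "i + 1 + n = (i + n) + 1" by simp
  then show ?case using step1 int_iterate_Suc[OF g, of "i + n" x] int_iterate_Suc[OF g, of i] by metis
next
  case (step2 i)
  have "g (int_iterate g (i - 1 + n) x) = int_iterate g (i + n) x"
    using int_iterate_Suc[OF g, of "i - 1 + n" x] by (simp add: algebra_simps)
  moreover have "g (int_iterate g (i - 1) (int_iterate g n x)) = int_iterate g i (int_iterate g n x)"
    using int_iterate_Suc[OF g, of "i - 1"] by simp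
  ultimately show ?case using step2 isometry_inj[OF g] by (metis injD)
qed

lemma is_closest_isometry:
  assumes g: "isometry g"
  shows "is_closest (g ` S) (g x) (g p) \<longleftrightarrow> is_closest S x p"
  using isometry_inj[OF g] by (auto simp: is_closest_def isometry_dist[OF g] inj_image_mem_iff)

lemma
  assumes g: "isometry g" and S: "proj_defined S"
  shows proj_defined_isometry: "proj_defined (g ` S)"
    and proj_isometry: "proj (g ` S) (g x) = g (proj S x)"
proof -
  have im: "\<exists>q. p = g q" if "is_closest (g ` S) y p" for p y using that by (auto simp: is_closest_def)
  have ex1: "\<exists>!p. is_closest (g ` S) (g y) p" for y
  proof -
    obtain q where q: "is_closest S y q" "\<And>p. is_closest S y p \<Longrightarrow> p = q" using S unfolding proj_defined_def by metis
    show ?thesis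
    proof (rule ex1I[of _ "g q"])
      show "is_closest (g ` S) (g y) (g q)" using q(1) is_closest_isometry[OF g] by blast
      fix p assume p: "is_closest (g ` S) (g y) p"
      then obtain p' where "p = g p'" using im by blast
      then show "p = g q" using p q(2) is_closest_isometry[OF g] by blast
    qed
  qed
  then show "proj_defined (g ` S)"
    unfolding proj_defined_def using g by (metis isometry_def bij_is_surj surj_f_inv_f)
  have "is_closest S x (proj S x)"
    unfolding proj_def using S unfolding proj_defined_def by (metis theI')
  then have "is_closest (g ` S) (g x) (g (proj S x))" using is_closest_isometry[OF g] by blast
  then show "proj (g ` S) (g x) = g (proj S x)"
    unfolding proj_def using ex1[of x] by (metis the1_equality)
qed

lemma image_vimage_proj_isometry:
  assumes g: "isometry g" and S: "proj_defined S"
  shows "g ` (proj S -` T) = proj (g ` S) -` (g ` T)"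
proof (intro equalityI subsetI)
  fix y assume "y \<in> g ` (proj S -` T)"
  then show "y \<in> proj (g ` S) -` (g ` T)" by (auto simp: proj_isometry[OF g S])
next
  fix y assume y: "y \<in> proj (g ` S) -` (g ` T)"
  obtain x where x: "y = g x" using g by (metis isometry_def bij_is_surj surjD)
  then have "proj S x \<in> T" using y isometry_inj[OF g] by (simp add: proj_isometry[OF g S] inj_image_mem_iff)
  then show "y \<in> g ` (proj S -` T)" using x by blast
qed

lemma curtain_halfspaces_isometry:
  assumes g: "isometry g" and h: "curtain_halfspaces h A B"
  shows "curtain_halfspaces (g ` h) (g ` A) (g ` B)"
proof -
  obtain I \<alpha> r where \<alpha>: "geodesic_on I \<alpha>" "proj_defined (\<alpha> ` I)" "{r - 1/2..r + 1/2} \<subseteq> interior I"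
    and *: "h = proj (\<alpha> ` I) -` (\<alpha> ` {r - 1/2..r + 1/2})"
    "A = proj (\<alpha> ` I) -` (\<alpha> ` (I \<inter> {..<r - 1/2}))"
    "B = proj (\<alpha> ` I) -` (\<alpha> ` (I \<inter> {r + 1/2<..}))"
    using h unfolding curtain_halfspaces_def by metis
  have "geodesic_on I (g \<circ> \<alpha>)" using \<alpha>(1) by (simp add: geodesic_on_def isometry_dist[OF g])
  moreover have "proj_defined ((g \<circ> \<alpha>) ` I)" using proj_defined_isometry[OF g \<alpha>(2)] by (simp add: image_comp)
  moreover note im = image_vimage_proj_isometry[OF g \<alpha>(2)]
  ultimately show ?thesis
    unfolding curtain_halfspaces_def using \<alpha>(3)
    by (intro exI[of _ I] exI[of _ "g \<circ> \<alpha>"] exI[of _ r]) (simp add: * im image_comp)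
qed

lemma curtain_isometry: "isometry g \<Longrightarrow> curtain h \<Longrightarrow> curtain (g ` h)"
  unfolding curtain_def using curtain_halfspaces_isometry by metis

lemma separates_isometry: "isometry g \<Longrightarrow> separates h S T \<Longrightarrow> separates (g ` h) (g ` S) (g ` T)"
  unfolding separates_def using curtain_halfspaces_isometry by (metis image_mono)

lemma chain_isometry:
  assumes g: "isometry g" and c: "chain c"
  shows "chain ((`) g ` c)"
proof -
  obtain J h where *: "\<forall>i\<in>J. \<forall>k\<in>J. {i..k} \<subseteq> J" "c = h ` J"
    "\<forall>i\<in>J. curtain (h i)" "\<forall>i\<in>J. \<forall>j\<in>J. i \<noteq> j \<longrightarrow> h i \<inter> h j = {}"
    "\<forall>i :: int. i - 1 \<in> J \<and> i + 1 \<in> J \<longrightarrow> separates (h i) (h (i - 1)) (h (i + 1))"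
    using c unfolding chain_def by auto
  show ?thesis
    unfolding chain_def
  proof (intro exI[of _ J] exI[of _ "\<lambda>i. g ` h i"] conjI)
    show "\<forall>i\<in>J. \<forall>j\<in>J. i \<noteq> j \<longrightarrow> g ` h i \<inter> g ` h j = {}"
      using *(4) by (simp flip: image_Int[OF isometry_inj[OF g]])
  qed (use * curtain_isometry[OF g] separates_isometry[OF g] in \<open>auto simp: image_image\<close>)
qed

lemma card_image_isometry: "isometry g \<Longrightarrow> card ((`) g ` c) = card c"
  by (rule card_image) (meson inj_image_eq_iff inj_onI isometry_inj)

lemma finite_image_isometry: "isometry g \<Longrightarrow> finite ((`) g ` c) \<Longrightarrow> finite c"
  by (rule finite_imageD) (auto intro!: inj_onI simp: inj_image_eq_iff isometry_inj)

lemma L_separatedD: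
  "L_separated L h k \<Longrightarrow> chain c \<Longrightarrow> (\<And>j. j \<in> c \<Longrightarrow> j \<inter> h \<noteq> {} \<and> j \<inter> k \<noteq> {}) \<Longrightarrow> finite c \<and> card c \<le> L"
  unfolding L_separated_def by simp

lemma L_separated_isometry:
  assumes g: "isometry g" and L: "L_separated L h k"
  shows "L_separated L (g ` h) (g ` k)"
  unfolding L_separated_def
proof (intro conjI allI impI)
  show "curtain (g ` h)" "curtain (g ` k)" using L curtain_isometry[OF g] by (auto simp: L_separated_def)
  show "g ` h \<inter> g ` k = {}"
    using L by (simp add: L_separated_def flip: image_Int[OF isometry_inj[OF g]])
next
  fix c assume c: "chain c \<and> (\<forall>j\<in>c. j \<inter> g ` h \<noteq> {} \<and> j \<inter> g ` k \<noteq> {})"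
  note g' = isometry_inv[OF g]
  have m: "inv g ` j \<inter> s \<noteq> {}" if "j \<inter> g ` s \<noteq> {}" for j s
  proof -
    from that obtain x where "x \<in> s" "g x \<in> j" by auto
    then show ?thesis using inv_f_f[OF isometry_inj[OF g], of x] by force
  qed
  have "chain ((`) (inv g) ` c)" using chain_isometry[OF g'] c by blast
  moreover have "j \<inter> h \<noteq> {} \<and> j \<inter> k \<noteq> {}" if "j \<in> (`) (inv g) ` c" for j
  proof -
    from that obtain l where l: "j = inv g ` l" "l \<in> c" by (rule imageE)
    then have "l \<inter> g ` h \<noteq> {}" "l \<inter> g ` k \<noteq> {}" using c by simp_all
    then show ?thesis unfolding l(1) by (intro conjI m)
  qed
  ultimately have "finite ((`) (inv g) ` c) \<and> card ((`) (inv g) ` c) \<le> L"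
    by (rule L_separatedD[OF L])
  then show "finite c" "card c \<le> L" 
    using finite_image_isometry[OF g', of c] card_image_isometry[OF g', of c] by simp_all
qed

lemma L_chain_isometry: "isometry g \<Longrightarrow> L_chain L c \<Longrightarrow> L_chain L ((`) g ` c)"
  unfolding L_chain_def
proof (intro conjI ballI impI)
  fix p q assume g: "isometry g" and c: "chain c \<and> (\<forall>h\<in>c. \<forall>h'\<in>c. h \<noteq> h' \<longrightarrow> L_separated L h h')"
    and pq: "p \<in> (`) g ` c" "q \<in> (`) g ` c" "p \<noteq> q"
  obtain p' where p': "p = g ` p'" "p' \<in> c" using pq(1) by (rule imageE)
  obtain q' where q': "q = g ` q'" "q' \<in> c" using pq(2) by (rule imageE)
  show "L_separated L p q"
    unfolding p'(1) q'(1) by (rule L_separated_isometry[OF g]) (use c p' q' pq(3) in auto)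
qed (simp add: chain_isometry)

lemma chain_separates_isometry:
  "isometry g \<Longrightarrow> chain_separates c {x} {y} \<Longrightarrow> chain_separates ((`) g ` c) {g x} {g y}"
  unfolding chain_separates_def using separates_isometry[of g _ "{x}" "{y}"] by (auto simp: chain_isometry)

lemma L_separated_commute: "L_separated L h k \<longleftrightarrow> L_separated L k h"
  unfolding L_separated_def by (auto simp: Int_commute)

lemma chain_separates_finite:
  fixes x :: "'a::cat0_space"
  assumes "chain_separates c {x} {y}"
  shows "finite c" "real (card c) \<le> 2 * dist x y + 1"
  using card_disjoint_separating[of c x y] assms chain_disjoint[of c] unfolding chain_separates_def by simp_all

section \<open>Skewering produces long chains along orbits\<close>

text \<open>
  The common form to which skewering and loxodromicity are reduced. The additive constant \<open>a\<close> allows a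
  bounded number of curtains to be lost at the two ends.
\<close>

definition linear_L_chains :: "('a::metric_space \<Rightarrow> 'a) \<Rightarrow> 'a \<Rightarrow> bool" where
  "linear_L_chains g x \<longleftrightarrow> (\<exists>L \<kappa> a. 0 < \<kappa> \<and> (\<forall>n::nat. \<exists>c. L_chain L c \<and>
     chain_separates c {x} {(g ^^ n) x} \<and> \<kappa> * real n - a \<le> real (card c)))"

lemma closed_halfspace_subset:
  fixes h :: "'a::cat0_space set"
  assumes h: "curtain_halfspaces h P Q" and k: "curtain_halfspaces k P' Q'"
    and "k \<inter> h = {}" "P' \<subseteq> P"
  shows "k \<union> P' \<subseteq> P"
proof -
  have "(k \<union> P') \<inter> h = {}" using assms(3,4) halfspaces_disjoint(2)[OF h] by auto
  then have "k \<union> P' \<subseteq> P \<or> k \<union> P' \<subseteq> Q"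
    by (rule connected_in_halfspace[OF h connected_closed_halfspace[OF k]])
  moreover have "\<not> P' \<subseteq> Q"
  proof
    assume "P' \<subseteq> Q"
    then have "P' \<subseteq> P \<inter> Q" using assms(4) by simp
    then show False using halfspaces_disjoint(1)[OF h] halfspace_nonempty[OF k] by simp
  qed
  ultimately show ?thesis by simp
qed

text \<open>
  \<open>G\<close> is the power of the isometry that occurs in the definition of skewering; the chain consists of the
  translates of \<open>h\<close>, while \<open>k\<close> only serves to separate consecutive translates.
\<close>

locale skewered =
  fixes G :: "'a::cat0_space \<Rightarrow> 'a" and h k P P' Q Q' :: "'a set" and L :: nat
  assumes G: "isometry G" and h: "curtain_halfspaces h P Q" and k: "curtain_halfspaces k P' Q'"
    and L: "L_separated L h k"
    and disj: "G ` h \<inter> k = {}" "G ` h \<inter> h = {}" "k \<inter> h = {}"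
    and nested: "G ` P \<subseteq> P'" "P' \<subseteq> P"
begin

abbreviation "it \<equiv> int_iterate G"
abbreviation "H i \<equiv> it i ` h"
abbreviation "PP i \<equiv> it i ` P"
abbreviation "QQ i \<equiv> it i ` Q"

lemma it: "isometry (it i)" by (rule isometry_int_iterate[OF G])

lemma it_image: "it (i + j) ` S = it i ` it j ` S"
  by (auto simp: int_iterate_add[OF G] image_image)

lemma curtain_H: "curtain_halfspaces (H i) (PP i) (QQ i)"
  by (rule curtain_halfspaces_isometry[OF it h])

lemma curtain_k: "curtain_halfspaces (it i ` k) (it i ` P') (it i ` Q')"
  by (rule curtain_halfspaces_isometry[OF it k])

lemma step: "H (i + 1) \<union> PP (i + 1) \<subseteq> it i ` P'" "it i ` P' \<subseteq> PP i"
proof -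
  have Gk: "curtain_halfspaces (G ` h) (G ` P) (G ` Q)" by (rule curtain_halfspaces_isometry[OF G h])
  have "G ` h \<union> G ` P \<subseteq> P'" by (rule closed_halfspace_subset[OF k Gk disj(1) nested(1)])
  then have "it i ` (G ` h \<union> G ` P) \<subseteq> it i ` P'" by (rule image_mono)
  moreover have "it 1 = G" using int_iterate_of_nat[of G 1] by simp
  ultimately show "H (i + 1) \<union> PP (i + 1) \<subseteq> it i ` P'" by (simp add: it_image image_Un)
  show "it i ` P' \<subseteq> PP i" using nested(2) by (rule image_mono)
qed

lemma nest: "i < j \<Longrightarrow> H j \<union> PP j \<subseteq> it i ` P'"
proof (induction j rule: int_gr_induct)
  case base then show ?case by (rule step(1))
next
  case (step j)
  have "H (j + 1) \<union> PP (j + 1) \<subseteq> PP j" using skewered.step[OF skewered_axioms, of j] by (rule subset_trans)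
  moreover have "PP j \<subseteq> it i ` P'" using step by simp
  ultimately show ?case by (rule subset_trans)
qed

lemma nest_PP: "i < j \<Longrightarrow> H j \<union> PP j \<subseteq> PP i"
  using nest[of i j] step(2)[of i] by (rule subset_trans)

lemma PP_antimono: "i \<le> j \<Longrightarrow> PP j \<subseteq> PP i"
  using nest_PP[of i j] by (cases "i = j") auto

lemma H_disjoint: "i \<noteq> j \<Longrightarrow> H i \<inter> H j = {}"
proof -
  have *: "H i \<inter> H j = {}" if "i < j" for i j
    using nest_PP[OF that] halfspaces_disjoint(2)[OF curtain_H[of i]] by blast
  assume "i \<noteq> j" then show ?thesis using *[of i j] *[of j i] by (cases "i < j") (auto simp: Int_commute)
qed

lemma H_inj: "inj_on H S"
proof (rule inj_onI, rule ccontr)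
  fix i j assume ij: "H i = H j" "i \<noteq> j"
  show False using H_disjoint[OF ij(2)] curtain_nonempty[OF curtain_H[of i]] by (simp add: ij(1))
qed

lemma in_QQ: "x \<notin> H i \<Longrightarrow> x \<notin> PP i \<Longrightarrow> x \<in> QQ i"
  using halfspaces_cover[OF curtain_H[of i]] by auto

lemma H_subset_QQ:
  assumes "i < j" shows "H i \<subseteq> QQ j"
proof
  fix x assume x: "x \<in> H i"
  then have "x \<notin> PP i" using halfspaces_disjoint(2)[OF curtain_H[of i]] by auto
  then show "x \<in> QQ j" using nest_PP[OF assms] by (intro in_QQ) auto
qed

lemma chain_H: "chain (H ` {a..b})"
  unfolding chain_def
proof (intro exI[of _ "{a..b}"] exI[of _ H] conjI allI impI)
  show "\<forall>i\<in>{a..b}. curtain (H i)" using curtain_H by (auto simp: curtain_def)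
  show "separates (H i) (H (i - 1)) (H (i + 1))" for i
    unfolding separates_def using curtain_H[of i] H_subset_QQ[of "i - 1" i] nest_PP[of i "i + 1"]
    by (intro exI[of _ "PP i"] exI[of _ "QQ i"]) auto
qed (use H_disjoint in auto)

text \<open>
  A connected set that meets two translates of \<open>h\<close> also meets a translate of \<open>k\<close> in between, so the
  bound for \<open>h\<close> and \<open>k\<close> applies to every chain that crosses both.
\<close>

lemma L_separated_H: assumes ij: "i < j" shows "L_separated L (H i) (H j)"
proof -
  have Lk: "L_separated L (H i) (it i ` k)" by (rule L_separated_isometry[OF it L])
  show ?thesis
    unfolding L_separated_def
  proof (intro conjI allI impI)
    show "curtain (H i)" "curtain (H j)" using curtain_H by (auto simp: curtain_def)
    show "H i \<inter> H j = {}" using H_disjoint ij by simp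
  next
    fix c assume c: "chain c \<and> (\<forall>l\<in>c. l \<inter> H i \<noteq> {} \<and> l \<inter> H j \<noteq> {})"
    have "l \<inter> it i ` k \<noteq> {}" if l: "l \<in> c" for l
    proof -
      obtain x y where x: "x \<in> l" "x \<in> H i" and y: "y \<in> l" "y \<in> H j" using c l by blast
      have "x \<notin> PP i" using halfspaces_disjoint(2)[OF curtain_H[of i]] x(2) by auto
      then have "x \<notin> it i ` P'" using step(2)[of i] by auto
      moreover have "x \<notin> it i ` k" using Lk x(2) unfolding L_separated_def by auto
      ultimately have "x \<in> it i ` Q'" using halfspaces_cover[OF curtain_k[of i]] by auto
      moreover have "y \<in> it i ` P'" using nest[OF ij] y(2) by auto
      ultimately have "separates (it i ` k) {y} {x}" unfolding separates_def using curtain_k[of i] by auto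
      moreover have "connected l"
        using chain_curtain[of c l] c l connected_curtain by (auto elim!: curtainE)
      ultimately show ?thesis using separates_meets x(1) y(1) by blast
    qed
    then have "finite c \<and> card c \<le> L" using c by (intro L_separatedD[OF Lk]) simp_all
    then show "finite c" "card c \<le> L" by simp_all
  qed
qed

lemma L_chain_H: "L_chain L (H ` {a..b})"
  unfolding L_chain_def
proof (intro conjI ballI impI chain_H)
  fix p q assume pq: "p \<in> H ` {a..b}" "q \<in> H ` {a..b}" "p \<noteq> q"
  then obtain i j where ij: "p = H i" "q = H j" by auto
  then have "i < j \<or> j < i" using pq(3) by (metis linorder_neqE)
  then show "L_separated L p q"
    unfolding ij using L_separated_H L_separated_commute by blast
qed

lemma separates_H: "x \<in> QQ i \<Longrightarrow> y \<in> PP i \<Longrightarrow> separates (H i) {x} {y}"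
  unfolding separates_def using curtain_H[of i] by auto

lemma not_all_separate:
  assumes "infinite S" shows "\<exists>i\<in>S. \<not> separates (H i) {x} {y}"
proof (rule ccontr)
  assume "\<not> ?thesis"
  then have sep: "separates (H i) {x} {y}" if "i \<in> S" for i using that by blast
  have "finite (H ` S)"
  proof (intro conjunct1[OF card_disjoint_separating[of _ x y]])
    show "separates l {x} {y}" if "l \<in> H ` S" for l
      using that sep by (elim imageE) simp
    show "l \<inter> l' = {}" if "l \<in> H ` S" "l' \<in> H ` S" "l \<noteq> l'" for l l'
      using that by (elim imageE) (metis H_disjoint)
  qed
  then show False using assms H_inj finite_imageD by blast
qed

text \<open>
  A point that never left the nested halfspaces, or never entered them, would be separated from a
  point of \<open>h\<close> by infinitely many disjoint translates.
\<close>

lemma leaves_PP: "\<exists>a\<ge>0. x \<notin> PP a"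
proof (rule ccontr)
  assume no: "\<not> ?thesis"
  obtain y where y: "y \<in> H 0" using curtain_nonempty[OF curtain_H[of 0]] by auto
  have "infinite {0::int<..}" by (rule infinite_Ioi)
  then obtain i where "0 < i" "\<not> separates (H i) {y} {x}" using not_all_separate by force
  then show False using no separates_H[of y i x] H_subset_QQ[of 0 i] y by auto
qed

lemma enters_PP: "\<exists>b\<ge>0. x \<in> PP (- b)"
proof (rule ccontr)
  assume no: "\<not> ?thesis"
  obtain y where y: "y \<in> H 0" using curtain_nonempty[OF curtain_H[of 0]] by auto
  have "infinite {..<0::int}" by (rule infinite_Iio)
  then obtain i where i: "i < 0" "\<not> separates (H i) {x} {y}" using not_all_separate by force
  have n: "x \<notin> PP j" if "j \<le> 0" for j using no that by (metis minus_minus neg_0_le_iff_le)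
  have "x \<notin> H i" using nest_PP[of "i - 1" i] n[of "i - 1"] i(1) by auto
  then have "x \<in> QQ i" using n[of i] i(1) by (intro in_QQ) auto
  moreover have "y \<in> PP i" using nest_PP[OF i(1)] y by auto
  ultimately show False using separates_H i(2) by blast
qed

lemma chain_along_orbit:
  assumes x: "x \<notin> PP a" and y: "y \<in> PP b"
  shows "\<exists>c. L_chain L c \<and> chain_separates c {x} {y} \<and> real_of_int (b - a) \<le> real (card c)"
proof (intro exI[of _ "H ` {a + 1..b}"] conjI L_chain_H)
  show "chain_separates (H ` {a + 1..b}) {x} {y}"
    unfolding chain_separates_def
  proof (intro conjI chain_H ballI)
    fix l assume "l \<in> H ` {a + 1..b}"
    then obtain i where i: "l = H i" "a < i" "i \<le> b" by auto
    have "x \<in> QQ i" using nest_PP[OF i(2)] x by (intro in_QQ) auto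
    moreover have "y \<in> PP i" using PP_antimono[OF i(3)] y by auto
    ultimately show "separates l {x} {y}" unfolding i(1) by (rule separates_H)
  qed
  have "card (H ` {a + 1..b}) = card {a + 1..b}" using H_inj by (rule card_image)
  then show "real_of_int (b - a) \<le> real (card (H ` {a + 1..b}))" by simp
qed

end

lemma skewers_linear_L_chains:
  fixes g :: "'a::cat0_space \<Rightarrow> 'a"
  assumes g: "isometry g" and sep: "separated h h'" and sk: "skewers g h h'"
  shows "linear_L_chains g x"
proof -
  obtain h1 h2 P1 P2 m where h12: "h1 = h \<and> h2 = h' \<or> h1 = h' \<and> h2 = h"
    and hs: "halfspace_of h1 P1" "halfspace_of h2 P2"
    and disj: "(g ^^ m) ` h1 \<inter> h2 = {}" "(g ^^ m) ` h1 \<inter> h1 = {}" "h2 \<inter> h1 = {}"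
    and nest: "(g ^^ m) ` P1 \<subset> P2" "P2 \<subset> P1"
    using sk unfolding skewers_def by metis
  obtain Q1 where h1: "curtain_halfspaces h1 P1 Q1"
    using hs(1) curtain_halfspaces_commute unfolding halfspace_of_def by blast
  obtain Q2 where h2: "curtain_halfspaces h2 P2 Q2"
    using hs(2) curtain_halfspaces_commute unfolding halfspace_of_def by blast
  obtain L where L: "L_separated L h1 h2"
    using sep h12 L_separated_commute unfolding separated_def by blast
  interpret skewered "g ^^ m" h1 h2 P1 P2 Q1 Q2 L
    by unfold_locales (use isometry_funpow[OF g] h1 h2 L disj nest in auto)
  have m: "0 < m" using disj(2) curtain_nonempty[OF h1] by (cases m) auto
  have "\<forall>r. \<exists>b\<ge>0. (g ^^ r) x \<in> PP (- b)" using enters_PP by blast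
  then obtain b where b: "\<And>r. 0 \<le> b r" "\<And>r. (g ^^ r) x \<in> PP (- b r)" by metis
  \<comment> \<open>A common index for the finitely many remainders modulo \<open>m\<close>; the sum is merely an upper bound.\<close>
  define B where "B = (\<Sum>r<m. b r)"
  have B: "(g ^^ r) x \<in> PP (- B)" if r: "r < m" for r
  proof -
    have "b r \<le> B" unfolding B_def using r b(1) by (intro member_le_sum) auto
    then show ?thesis using PP_antimono[of "- B" "- b r"] b(2)[of r] by auto
  qed
  obtain a where a: "0 \<le> a" "x \<notin> PP a" using leaves_PP by blast
  have main: "\<exists>c. L_chain L c \<and> chain_separates c {x} {(g ^^ n) x} \<and>
      1 / real m * real n - (real_of_int (a + B) + 1) \<le> real (card c)" for n
  proof -
    define q where "q = n div m"
    define r where "r = n mod m"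
    have n: "n = m * q + r" "r < m" using m by (auto simp: q_def r_def)
    have "(g ^^ n) x = ((g ^^ m) ^^ q) ((g ^^ r) x)" by (simp add: n(1) funpow_add funpow_mult)
    also have "\<dots> = it (int q) ((g ^^ r) x)" by (simp add: int_iterate_of_nat)
    also have "\<dots> \<in> it (int q) ` PP (- B)" using B[OF n(2)] by blast
    also have "\<dots> = PP (int q - B)" using it_image[of "int q" "- B" P1] by simp
    finally obtain c where c: "L_chain L c" "chain_separates c {x} {(g ^^ n) x}" "real_of_int (int q - B - a) \<le> real (card c)"
      using chain_along_orbit[OF a(2)] by blast
    have "real n \<le> real m * (real q + 1)" using n by (simp add: algebra_simps of_nat_le_iff flip: of_nat_mult of_nat_add)
    then have "1 / real m * real n \<le> real q + 1" using m by (simp add: field_simps)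
    then have "1 / real m * real n - (real_of_int (a + B) + 1) \<le> real (card c)" using c(3) by simp
    with c show ?thesis by blast
  qed
  show ?thesis
    unfolding linear_L_chains_def
    by (rule exI[of _ L], rule exI[of _ "1 / real m"], rule exI[of _ "real_of_int (a + B) + 1"])
      (intro conjI allI main, use m in simp)
qed

section \<open>The curtain metric\<close>

lemma chain_empty: "chain {}"
  unfolding chain_def by (rule exI[of _ "{}"]) simp

lemma L_chain_mono: "L \<le> L' \<Longrightarrow> L_chain L c \<Longrightarrow> L_chain L' c"
  unfolding L_chain_def L_separated_def by (meson le_trans)

text \<open>The maximum in the definition of \<^const>\<open>d_L\<close> is over these values, so it is attained.\<close>

lemma d_L_values:
  fixes x y :: "'a::cat0_space" and L :: nat
  defines "S \<equiv> {card c | c. L_chain L c \<and> chain_separates c {x} {y}}"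
  shows "finite S" "S \<noteq> {}" "n \<in> S \<Longrightarrow> real n \<le> 2 * dist x y + 1"
proof -
  show b: "real n \<le> 2 * dist x y + 1" if "n \<in> S" for n
    using that chain_separates_finite(2)[of _ x y] unfolding S_def by auto
  have "S \<subseteq> {..nat \<lceil>2 * dist x y + 1\<rceil>}"
  proof
    fix n assume "n \<in> S"
    then show "n \<in> {..nat \<lceil>2 * dist x y + 1\<rceil>}" using b[of n] by simp linarith
  qed
  then show "finite S" by (rule finite_subset) simp
  have "card ({} :: 'a set set) \<in> S"
    unfolding S_def using chain_empty by (auto simp: L_chain_def chain_separates_def intro!: exI[of _ "{}"])
  then show "S \<noteq> {}" by blast
qed

lemma d_L_ge:
  fixes x y :: "'a::cat0_space"
  assumes "x \<noteq> y" "L_chain L c" "chain_separates c {x} {y}"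
  shows "card c + 1 \<le> d_L L x y"
proof -
  have "card c \<in> {card c | c. L_chain L c \<and> chain_separates c {x} {y}}" using assms by auto
  then have "card c \<le> Max {card c | c. L_chain L c \<and> chain_separates c {x} {y}}"
    by (rule Max_ge[OF d_L_values(1)])
  then show ?thesis using assms(1) by (simp add: d_L_def)
qed

lemma d_L_attained:
  fixes x y :: "'a::cat0_space"
  assumes "x \<noteq> y"
  shows "\<exists>c. L_chain L c \<and> chain_separates c {x} {y} \<and> d_L L x y = card c + 1"
proof -
  have "Max {card c | c. L_chain L c \<and> chain_separates c {x} {y}} \<in> {card c | c. L_chain L c \<and> chain_separates c {x} {y}}"
    by (rule Max_in[OF d_L_values(1,2)])
  then obtain c where "Max {card c | c. L_chain L c \<and> chain_separates c {x} {y}} = card c"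
    "L_chain L c" "chain_separates c {x} {y}" by auto
  then show ?thesis using assms by (auto simp: d_L_def)
qed

lemma d_L_upper: "real (d_L L x y) \<le> 2 * dist x y + 2" for x y :: "'a::cat0_space"
proof (cases "x = y")
  case False
  then show ?thesis using d_L_attained[OF False, of L] chain_separates_finite(2)[of _ x y] by force
qed (simp add: d_L_def)

lemma d_L_mono: "L \<le> L' \<Longrightarrow> d_L L x y \<le> d_L L' x y" for x y :: "'a::cat0_space"
proof (cases "x = y")
  case False
  assume "L \<le> L'"
  then show ?thesis using d_L_attained[OF False, of L] d_L_ge[OF False] L_chain_mono by metis
qed (simp add: d_L_def)

lemma chain_separates_commute: "chain_separates c A B \<longleftrightarrow> chain_separates c B A"
  unfolding chain_separates_def using separates_commute by metis

lemma d_L_commute: "d_L L x y = d_L L y x"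
  unfolding d_L_def using chain_separates_commute[of _ "{x}" "{y}"] by auto

lemma d_L_isometry:
  fixes x y :: "'a::cat0_space"
  assumes g: "isometry g"
  shows "d_L L (g x) (g y) = d_L L x y"
proof -
  have *: "d_L L x y \<le> d_L L (g x) (g y)" if g: "isometry g" for g and x y :: 'a
  proof (cases "x = y")
    case False
    then obtain c where c: "L_chain L c" "chain_separates c {x} {y}" "d_L L x y = card c + 1"
      using d_L_attained by metis
    have "g x \<noteq> g y" using False isometry_inj[OF g] by (simp add: inj_eq)
    then show ?thesis
      using d_L_ge[OF _ L_chain_isometry[OF g c(1)] chain_separates_isometry[OF g c(2)]] c(3)
      by (simp add: card_image_isometry[OF g])
  qed (simp add: d_L_def)
  have "d_L L (g x) (g y) \<le> d_L L (inv g (g x)) (inv g (g y))" by (rule *[OF isometry_inv[OF g]])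
  then show ?thesis using *[OF g, of x y] isometry_inj[OF g] by (simp add: inv_f_f)
qed

lemma dist_funpow_le: "isometry g \<Longrightarrow> dist x ((g ^^ n) x) \<le> real n * dist x (g x)"
proof (induction n)
  case (Suc n)
  have "dist x ((g ^^ Suc n) x) \<le> dist x ((g ^^ n) x) + dist ((g ^^ n) x) ((g ^^ n) (g x))"
    by (simp add: funpow_swap1 dist_triangle)
  also have "dist ((g ^^ n) x) ((g ^^ n) (g x)) = dist x (g x)"
    by (rule isometry_dist[OF isometry_funpow[OF Suc.prems]])
  finally show ?case using Suc by (simp add: algebra_simps)
qed simp

context
  fixes w :: "nat \<Rightarrow> real"
  assumes w: "curtain_weights w"
begin

lemma weight_pos: "0 < w (Suc n)" and summable_weights: "summable (\<lambda>n. w (Suc n))"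
  using w by (auto simp: curtain_weights_def)

lemma summable_curtain_dist: "summable (\<lambda>n. w (Suc n) * real (d_L (Suc n) x y))" for x y :: "'a::cat0_space"
proof (rule summable_comparison_test')
  show "summable (\<lambda>n. w (Suc n) * (2 * dist x y + 2))" by (rule summable_mult2[OF summable_weights])
  show "norm (w (Suc n) * real (d_L (Suc n) x y)) \<le> w (Suc n) * (2 * dist x y + 2)" if "0 \<le> n" for n
    using weight_pos[of n] d_L_upper[of "Suc n" x y] by (simp add: abs_mult)
qed

lemma curtain_dist_upper:
  fixes x y :: "'a::cat0_space"
  shows "curtain_dist w x y \<le> (\<Sum>n. w (Suc n)) * (2 * dist x y + 2)"
proof -
  have "curtain_dist w x y \<le> (\<Sum>n. w (Suc n) * (2 * dist x y + 2))"
    unfolding curtain_dist_def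
  proof (rule suminf_le[OF _ summable_curtain_dist summable_mult2[OF summable_weights]])
    show "w (Suc n) * real (d_L (Suc n) x y) \<le> w (Suc n) * (2 * dist x y + 2)" for n
      using weight_pos[of n] d_L_upper[of "Suc n" x y] by simp
  qed
  also have "\<dots> = (\<Sum>n. w (Suc n)) * (2 * dist x y + 2)" by (rule suminf_mult2[OF summable_weights, symmetric])
  finally show ?thesis .
qed

lemma curtain_dist_lower:
  fixes x y :: "'a::cat0_space"
  shows "w (Suc n) * real (d_L (Suc n) x y) \<le> curtain_dist w x y"
proof -
  have "sum (\<lambda>n. w (Suc n) * real (d_L (Suc n) x y)) {n} \<le> curtain_dist w x y"
    unfolding curtain_dist_def
    by (rule sum_le_suminf[OF summable_curtain_dist]) (auto simp: weight_pos less_imp_le)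
  then show ?thesis by simp
qed

lemma curtain_dist_commute: "curtain_dist w x y = curtain_dist w y x"
  by (simp add: curtain_dist_def d_L_commute)

lemma curtain_dist_isometry: "isometry g \<Longrightarrow> curtain_dist w (g x) (g y) = curtain_dist w x y"
  for x y :: "'a::cat0_space"
  by (simp add: curtain_dist_def d_L_isometry)

lemma curtain_dist_orbit:
  fixes x :: "'a::cat0_space"
  assumes g: "isometry g"
  shows "curtain_dist w (int_iterate g m x) (int_iterate g n x) = curtain_dist w x ((g ^^ nat \<bar>m - n\<bar>) x)"
proof -
  have *: "curtain_dist w (int_iterate g m x) (int_iterate g n x) = curtain_dist w x ((g ^^ nat (n - m)) x)"
    if "m \<le> n" for m n
  proof -
    have "int_iterate g n x = int_iterate g m ((g ^^ nat (n - m)) x)"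
      using int_iterate_add[OF g, of m "int (nat (n - m))" x] that
      unfolding int_iterate_of_nat by simp
    then show ?thesis using curtain_dist_isometry[OF isometry_int_iterate[OF g]] by simp
  qed
  show ?thesis
  proof (cases "m \<le> n")
    case True
    then show ?thesis using *[OF True] by simp
  next
    case False
    then show ?thesis using *[of n m] by (simp add: curtain_dist_commute[of "int_iterate g m x"])
  qed
qed

text \<open>
  A single summand of the curtain metric already grows linearly. Its index is \<open>Suc L\<close> because the series
  starts at 1 while \<open>L\<close> may be 0.
\<close>

lemma loxodromic_if_linear_L_chains:
  fixes g :: "'a::cat0_space \<Rightarrow> 'a"
  assumes g: "isometry g" and lin: "\<And>x. linear_L_chains g x"
  shows "acts_loxodromically (curtain_dist w) g"
  unfolding acts_loxodromically_def
proof
  fix x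
  obtain L \<kappa> a where \<kappa>: "0 < \<kappa>" and ch: "\<And>n. \<exists>c. L_chain L c \<and>
     chain_separates c {x} {(g ^^ n) x} \<and> \<kappa> * real n - a \<le> real (card c)"
    using lin[of x] unfolding linear_L_chains_def by metis
  define W where "W = (\<Sum>n. w (Suc n))"
  have W: "0 \<le> W" unfolding W_def by (rule suminf_nonneg[OF summable_weights]) (simp add: weight_pos less_imp_le)
  define \<mu> where "\<mu> = w (Suc L)"
  have \<mu>: "0 < \<mu>" by (simp add: \<mu>_def weight_pos)
  let ?\<tau> = "dist x (g x)"
  define D where "D n = curtain_dist w x ((g ^^ n) x)" for n
  have D0: "0 \<le> D n" for n
    unfolding D_def curtain_dist_def
    by (rule suminf_nonneg[OF summable_curtain_dist]) (simp add: weight_pos less_imp_le)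
  have lower: "\<mu> * \<kappa> * real n - \<mu> * \<bar>a\<bar> \<le> D n" for n
  proof -
    obtain c where c: "L_chain L c" "chain_separates c {x} {(g ^^ n) x}" "\<kappa> * real n - a \<le> real (card c)"
      using ch by blast
    show ?thesis
    proof (cases "x = (g ^^ n) x")
      case True
      have "c = {}"
      proof (rule ccontr)
        assume "c \<noteq> {}"
        then obtain h where "separates h {x} {x}" using c(2) True by (auto simp: chain_separates_def)
        then obtain A B where "curtain_halfspaces h A B" "x \<in> A" "x \<in> B" by (auto elim: separatesE)
        then show False using halfspaces_disjoint(1) by blast
      qed
      then have "\<kappa> * real n - \<bar>a\<bar> \<le> 0" using c(3) by simp
      then have "\<mu> * (\<kappa> * real n - \<bar>a\<bar>) \<le> 0" using \<mu> by (simp add: mult_le_0_iff)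
      then show ?thesis using D0[of n] by (simp add: algebra_simps)
    next
      case False
      have "card c + 1 \<le> d_L L x ((g ^^ n) x)" by (rule d_L_ge[OF False c(1,2)])
      also have "\<dots> \<le> d_L (Suc L) x ((g ^^ n) x)" by (rule d_L_mono) simp
      finally have "\<kappa> * real n - \<bar>a\<bar> \<le> real (d_L (Suc L) x ((g ^^ n) x))" using c(3) by linarith
      then have "\<mu> * (\<kappa> * real n - \<bar>a\<bar>) \<le> \<mu> * real (d_L (Suc L) x ((g ^^ n) x))" using \<mu> by simp
      also have "\<dots> \<le> D n" unfolding D_def \<mu>_def by (rule curtain_dist_lower)
      finally show ?thesis by (simp add: algebra_simps)
    qed
  qed
  have upper: "D n \<le> 2 * W * ?\<tau> * real n + 2 * W" for n
  proof -
    have "D n \<le> W * (2 * dist x ((g ^^ n) x) + 2)" unfolding D_def W_def by (rule curtain_dist_upper)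
    also have "\<dots> \<le> W * (2 * (real n * ?\<tau>) + 2)"
      using W dist_funpow_le[OF g, of x n] by (intro mult_left_mono) auto
    finally show ?thesis by (simp add: algebra_simps)
  qed
  define K where "K = max 1 (max (1 / (\<mu> * \<kappa>)) (2 * W * ?\<tau>))"
  define C where "C = max (\<mu> * \<bar>a\<bar>) (2 * W)"
  have K: "1 \<le> K" "1 / K \<le> \<mu> * \<kappa>" "2 * W * ?\<tau> \<le> K"
  proof -
    show "1 \<le> K" "2 * W * ?\<tau> \<le> K" by (simp_all add: K_def)
    have "1 / (\<mu> * \<kappa>) \<le> K" by (simp add: K_def)
    then show "1 / K \<le> \<mu> * \<kappa>" using \<mu> \<kappa> \<open>1 \<le> K\<close> by (simp add: field_simps)
  qed
  have C: "0 \<le> C" "\<mu> * \<bar>a\<bar> \<le> C" "2 * W \<le> C" using W by (auto simp: C_def)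
  have DL: "real n / K - C \<le> D n" for n
  proof -
    have "real n * (1 / K) \<le> real n * (\<mu> * \<kappa>)" using K(2) by (rule mult_left_mono) simp
    then show ?thesis using lower[of n] C(2) by (simp add: algebra_simps)
  qed
  have DU: "D n \<le> K * real n + C" for n
  proof -
    have "2 * W * ?\<tau> * real n \<le> K * real n" using K(3) by (rule mult_right_mono) simp
    then show ?thesis using upper[of n] C(3) by linarith
  qed
  show "quasiisometric_embedding_int (curtain_dist w) (\<lambda>n. int_iterate g n x)"
    unfolding quasiisometric_embedding_int_def
  proof (rule exI[of _ K], rule exI[of _ C], intro conjI allI K(1) C(1))
    fix m n :: int
    have r: "real (nat \<bar>m - n\<bar>) = \<bar>real_of_int (m - n)\<bar>" by simp
    show "\<bar>real_of_int (m - n)\<bar> / K - C \<le> curtain_dist w (int_iterate g m x) (int_iterate g n x)"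
      using DL[of "nat \<bar>m - n\<bar>"] unfolding r D_def curtain_dist_orbit[OF g] .
    show "curtain_dist w (int_iterate g m x) (int_iterate g n x) \<le> K * \<bar>real_of_int (m - n)\<bar> + C"
      using DU[of "nat \<bar>m - n\<bar>"] unfolding r D_def curtain_dist_orbit[OF g] .
  qed
qed

text \<open>
  Conversely, along an orbit every \<open>d_L\<close> grows at most linearly, with a rate that does not depend
  on \<open>L\<close>. So the tail of the weights contributes a small multiple of \<open>n\<close>, and one of the
  finitely many remaining \<open>d_L\<close>, hence the last of them, must grow linearly.
\<close>

lemma linear_L_chains_if_loxodromic:
  fixes g :: "'a::cat0_space \<Rightarrow> 'a"
  assumes g: "isometry g" and lox: "acts_loxodromically (curtain_dist w) g"
  shows "linear_L_chains g x"
proof -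
  obtain K C where K: "1 \<le> K" and "0 \<le> C" and low: "\<And>m n. \<bar>real_of_int (m - n)\<bar> / K - C \<le>
      curtain_dist w (int_iterate g m x) (int_iterate g n x)"
    using lox unfolding acts_loxodromically_def quasiisometric_embedding_int_def by metis
  have D: "real n / K - C \<le> curtain_dist w x ((g ^^ n) x)" for n
    using low[of 0 "int n"] by (simp add: int_iterate_of_nat)
  let ?\<tau> = "dist x (g x)"
  \<comment> \<open>The tail beyond \<open>J\<close> is at most \<open>\<epsilon> * (2 * n * ?\<tau> + 2)\<close>, which must stay below half of \<open>n / K\<close> up to a constant.\<close>
  define d where "d = 2 * ?\<tau> + 1"
  have d: "0 < d" by (simp add: d_def add_nonneg_pos)
  define \<epsilon> where "\<epsilon> = 1 / (2 * K * d)"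
  have \<epsilon>: "0 < \<epsilon>" "\<epsilon> * (2 * ?\<tau> + 1) = 1 / (2 * K)"
    unfolding d_def[symmetric] using K d by (simp_all add: \<epsilon>_def)
  obtain J where J: "norm (\<Sum>i. w (Suc (i + J))) < \<epsilon>"
    using suminf_exist_split[OF \<epsilon>(1) summable_weights] by auto
  define W where "W = (\<Sum>i<J. w (Suc i)) + 1"
  have W: "0 < W" unfolding W_def using weight_pos by (intro add_nonneg_pos sum_nonneg) (auto intro: less_imp_le)
  have main: "real n / (2 * K) - C - 2 * \<epsilon> \<le> W * real (d_L J x ((g ^^ n) x))" for n
  proof -
    let ?y = "(g ^^ n) x"
    let ?f = "\<lambda>i. w (Suc i) * real (d_L (Suc i) x ?y)"
    have "curtain_dist w x ?y = (\<Sum>i. ?f (i + J)) + (\<Sum>i<J. ?f i)"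
      unfolding curtain_dist_def by (rule suminf_split_initial_segment[OF summable_curtain_dist])
    moreover have "(\<Sum>i. ?f (i + J)) \<le> (\<Sum>i. w (Suc (i + J)) * (2 * dist x ?y + 2))"
    proof (rule suminf_le)
      show "?f (i + J) \<le> w (Suc (i + J)) * (2 * dist x ?y + 2)" for i
        using weight_pos[of "i + J"] d_L_upper[of "Suc (i + J)" x ?y] by simp
      show "summable (\<lambda>i. ?f (i + J))" using summable_curtain_dist by (rule summable_ignore_initial_segment)
      show "summable (\<lambda>i. w (Suc (i + J)) * (2 * dist x ?y + 2))"
        using summable_ignore_initial_segment[OF summable_weights, of J] by (intro summable_mult2) simp
    qed
    moreover have "(\<Sum>i. w (Suc (i + J)) * (2 * dist x ?y + 2)) = (\<Sum>i. w (Suc (i + J))) * (2 * dist x ?y + 2)"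
      using summable_ignore_initial_segment[OF summable_weights, of J] by (intro suminf_mult2[symmetric]) simp
    moreover have "(\<Sum>i. w (Suc (i + J))) * (2 * dist x ?y + 2) \<le> \<epsilon> * (2 * (real n * ?\<tau>) + 2)"
      using J \<epsilon>(1) dist_funpow_le[OF g, of x n] by (intro mult_mono) auto
    moreover have "\<epsilon> * (2 * (real n * ?\<tau>) + 2) \<le> real n / (2 * K) + 2 * \<epsilon>"
    proof -
      have "\<epsilon> * (2 * (real n * ?\<tau>)) \<le> real n * (\<epsilon> * (2 * ?\<tau> + 1))" using \<epsilon>(1) by (simp add: algebra_simps)
      also have "\<dots> = real n / (2 * K)" unfolding \<epsilon>(2) by simp
      finally show ?thesis by (simp add: algebra_simps)
    qed
    moreover have "(\<Sum>i<J. ?f i) \<le> W * real (d_L J x ?y)"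
    proof -
      have "(\<Sum>i<J. ?f i) \<le> (\<Sum>i<J. w (Suc i) * real (d_L J x ?y))"
        using weight_pos d_L_mono[of _ J x ?y] by (intro sum_mono mult_left_mono) (auto simp: less_imp_le)
      also have "\<dots> = (\<Sum>i<J. w (Suc i)) * real (d_L J x ?y)" by (simp add: sum_distrib_right)
      also have "\<dots> \<le> W * real (d_L J x ?y)" unfolding W_def by (intro mult_right_mono) auto
      finally show ?thesis .
    qed
    moreover have "real n / K = 2 * (real n / (2 * K))" using K by simp
    ultimately show ?thesis using D[of n] by linarith
  qed
  have chains: "\<exists>c. L_chain J c \<and> chain_separates c {x} {(g ^^ n) x} \<and>
      1 / (2 * K * W) * real n - ((C + 2 * \<epsilon>) / W + 1) \<le> real (card c)" for n
  proof -
    have d: "1 / (2 * K * W) * real n - (C + 2 * \<epsilon>) / W \<le> real (d_L J x ((g ^^ n) x))"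
      using main[of n] W K by (simp add: field_simps)
    show ?thesis
    proof (cases "x = (g ^^ n) x")
      case True
      then have "d_L J x ((g ^^ n) x) = 0" by (simp add: d_L_def)
      then show ?thesis using d chain_empty
        by (intro exI[of _ "{}"]) (auto simp: L_chain_def chain_separates_def)
    next
      case False
      then obtain c where "L_chain J c" "chain_separates c {x} {(g ^^ n) x}" "d_L J x ((g ^^ n) x) = card c + 1"
        using d_L_attained by blast
      then show ?thesis using d by (intro exI[of _ c]) auto
    qed
  qed
  show ?thesis
    unfolding linear_L_chains_def
    by (rule exI[of _ J], rule exI[of _ "1 / (2 * K * W)"], rule exI[of _ "(C + 2 * \<epsilon>) / W + 1"])
      (intro conjI allI chains, use K W in simp)
qed

end

section \<open>Axes\<close>

lemma translation_length_le: "translation_length g \<le> dist x (g x)"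
  unfolding translation_length_def by (rule cINF_lower) (auto intro!: bdd_belowI[of _ 0])

text \<open>
  The midpoint \<open>m\<close> of \<open>[y, g y]\<close> and its image are the midpoints of two sides of the triangle
  \<open>y, g y, g (g y)\<close>, so \<open>d(m, g m)\<close> is at most half of the third side.
\<close>

lemma displacement_square:
  fixes g :: "'a::cat0_space \<Rightarrow> 'a"
  assumes g: "isometry g" and \<tau>: "\<And>y. \<tau> \<le> dist y (g y)"
  shows "2 * \<tau> \<le> dist y (g (g y))"
proof -
  define m where "m = along y (g y) (1/2)"
  have "g m = along (g y) (g (g y)) (1/2)"
    by (rule along_unique) (simp_all add: isometry_dist[OF g] m_def dist_along)
  moreover have "m = along (g y) y (1/2)" unfolding m_def using along_flip[of "1/2" y "g y"] by simp
  ultimately have "dist m (g m) \<le> 1/2 * dist y (g (g y))"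
    using dist_along_common_point[of "1/2" "g y" y "g (g y)"] by simp
  then show ?thesis using \<tau>[of m] by linarith
qed

lemma displacement_power_two:
  fixes g :: "'a::cat0_space \<Rightarrow> 'a"
  assumes g: "isometry g" and \<tau>: "\<And>y. \<tau> \<le> dist y (g y)"
  shows "2 ^ k * \<tau> \<le> dist y ((g ^^ (2 ^ k)) y)"
proof (induction k arbitrary: y)
  case 0
  then show ?case using \<tau> by simp
next
  case (Suc k)
  have "2 * (2 ^ k * \<tau>) \<le> dist y ((g ^^ (2 ^ k)) ((g ^^ (2 ^ k)) y))"
    by (rule displacement_square[OF isometry_funpow[OF g] Suc.IH])
  moreover have "(g ^^ (2 ^ Suc k)) y = (g ^^ (2 ^ k)) ((g ^^ (2 ^ k)) y)"
    by (simp add: mult_2 funpow_add)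
  ultimately show ?case by simp
qed

text \<open>
  Doubling gives the lower bound for powers of two. A shorter stretch of the orbit that failed to be
  geodesic would make a longer one of this kind too short.
\<close>

lemma dist_orbit_of_minimal_displacement:
  fixes g :: "'a::cat0_space \<Rightarrow> 'a"
  assumes g: "isometry g" and \<tau>: "\<And>y. \<tau> \<le> dist y (g y)" and x: "dist x (g x) = \<tau>"
  shows "dist x ((g ^^ n) x) = real n * \<tau>"
proof (rule antisym)
  show "dist x ((g ^^ n) x) \<le> real n * \<tau>" using dist_funpow_le[OF g, of x n] x by simp
  define N where "N = (2::nat) ^ n"
  have n: "n \<le> N" unfolding N_def by (simp add: less_imp_le)
  then have "(g ^^ N) x = (g ^^ n) ((g ^^ (N - n)) x)" by (metis comp_apply funpow_add le_add_diff_inverse)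
  then have "dist x ((g ^^ N) x) \<le> dist x ((g ^^ n) x) + dist ((g ^^ n) x) ((g ^^ n) ((g ^^ (N - n)) x))"
    by (simp add: dist_triangle)
  also have "dist ((g ^^ n) x) ((g ^^ n) ((g ^^ (N - n)) x)) \<le> real (N - n) * \<tau>"
    unfolding isometry_dist[OF isometry_funpow[OF g]] using dist_funpow_le[OF g, of x "N - n"] x by simp
  finally have "real N * \<tau> \<le> dist x ((g ^^ n) x) + real (N - n) * \<tau>"
    using displacement_power_two[OF g \<tau>, of n x] by (simp add: N_def)
  moreover have "real N * \<tau> = real n * \<tau> + real (N - n) * \<tau>"
    using n by (simp add: of_nat_diff algebra_simps)
  ultimately show "real n * \<tau> \<le> dist x ((g ^^ n) x)" by linarith
qed

text \<open>
  The axis is the concatenation of the translates of \<open>[x, g x]\<close>: the distances in the orbit of \<open>x\<close> leave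
  no room for shortcuts.
\<close>

lemma axis_exists:
  fixes g :: "'a::cat0_space \<Rightarrow> 'a"
  assumes g: "isometry g" and \<tau>: "0 < \<tau>" and orb: "\<And>n. dist x ((g ^^ n) x) = real n * \<tau>"
  shows "\<exists>\<gamma>. is_axis g \<gamma>"
proof -
  define node where "node i = int_iterate g i x" for i
  have node: "dist (node i) (node j) = real_of_int (j - i) * \<tau>" if "i \<le> j" for i j
  proof -
    have "node j = int_iterate g i ((g ^^ nat (j - i)) x)"
      using int_iterate_add[OF g, of i "int (nat (j - i))" x] that unfolding int_iterate_of_nat node_def by simp
    then show ?thesis
      using that by (simp add: node_def isometry_dist[OF isometry_int_iterate[OF g]] orb)
  qed
  have dx: "dist x (g x) = \<tau>" using orb[of 1] by simp
  obtain \<sigma> where \<sigma>: "geodesic_on {0..\<tau>} \<sigma>" "\<sigma> 0 = x" "\<sigma> \<tau> = g x"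
    using geodesic_space[of x "g x"] unfolding geodesic_segment_def dx by auto
  define \<gamma> where "\<gamma> t = int_iterate g \<lfloor>t / \<tau>\<rfloor> (\<sigma> (t - \<tau> * \<lfloor>t / \<tau>\<rfloor>))" for t
  have frac: "0 \<le> t - \<tau> * \<lfloor>t / \<tau>\<rfloor>" "t - \<tau> * \<lfloor>t / \<tau>\<rfloor> \<le> \<tau>" for t
  proof -
    have "\<tau> * \<lfloor>t / \<tau>\<rfloor> \<le> \<tau> * (t / \<tau>)" using \<tau> by (intro mult_left_mono) auto
    then show "0 \<le> t - \<tau> * \<lfloor>t / \<tau>\<rfloor>" using \<tau> by simp
    have "\<tau> * (t / \<tau>) \<le> \<tau> * (\<lfloor>t / \<tau>\<rfloor> + 1)" using \<tau> by (intro mult_left_mono) auto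
    then show "t - \<tau> * \<lfloor>t / \<tau>\<rfloor> \<le> \<tau>" using \<tau> by (simp add: algebra_simps)
  qed
  have left: "dist (node \<lfloor>t / \<tau>\<rfloor>) (\<gamma> t) = t - \<tau> * \<lfloor>t / \<tau>\<rfloor>" for t
    unfolding node_def \<gamma>_def isometry_dist[OF isometry_int_iterate[OF g]]
    using geodesic_on_dist[OF \<sigma>(1), of 0 "t - \<tau> * \<lfloor>t / \<tau>\<rfloor>"] \<sigma>(2) frac[of t] \<tau> by simp
  have right: "dist (\<gamma> t) (node (\<lfloor>t / \<tau>\<rfloor> + 1)) = \<tau> - (t - \<tau> * \<lfloor>t / \<tau>\<rfloor>)" for t
  proof -
    have "node (\<lfloor>t / \<tau>\<rfloor> + 1) = int_iterate g \<lfloor>t / \<tau>\<rfloor> (g x)"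
      using int_iterate_add[OF g, of "\<lfloor>t / \<tau>\<rfloor>" 1 x] int_iterate_of_nat[of g 1] by (simp add: node_def)
    then show ?thesis
      unfolding \<gamma>_def using isometry_dist[OF isometry_int_iterate[OF g]]
        geodesic_on_dist[OF \<sigma>(1), of "t - \<tau> * \<lfloor>t / \<tau>\<rfloor>" \<tau>] \<sigma>(3) frac[of t] \<tau> by simp
  qed
  have D: "dist (\<gamma> s) (\<gamma> t) = t - s" if st: "s \<le> t" for s t
  proof -
    let ?i = "\<lfloor>s / \<tau>\<rfloor>" and ?j = "\<lfloor>t / \<tau>\<rfloor>"
    have ij: "?i \<le> ?j" using st \<tau> by (intro floor_mono divide_right_mono) auto
    show ?thesis
    proof (cases "?i = ?j")
      case True
      then show ?thesis
        unfolding \<gamma>_def True isometry_dist[OF isometry_int_iterate[OF g]]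
        using geodesic_on_dist[OF \<sigma>(1), of "s - \<tau> * ?j" "t - \<tau> * ?j"] frac[of s, unfolded True] frac[of t] st by simp
    next
      case False
      then have ij1: "?i + 1 \<le> ?j" using ij by simp
      have "dist (\<gamma> s) (\<gamma> t) \<le> dist (\<gamma> s) (node (?i + 1)) + dist (node (?i + 1)) (node ?j) + dist (node ?j) (\<gamma> t)"
        using dist_triangle[of "\<gamma> s" "\<gamma> t" "node (?i + 1)"] dist_triangle[of "node (?i + 1)" "\<gamma> t" "node ?j"] by linarith
      then have "dist (\<gamma> s) (\<gamma> t) \<le> t - s"
        unfolding left right node[OF ij1] by (simp add: algebra_simps)
      moreover have "dist (node ?i) (node (?j + 1)) \<le> dist (node ?i) (\<gamma> s) + dist (\<gamma> s) (\<gamma> t) + dist (\<gamma> t) (node (?j + 1))"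
        using dist_triangle[of "node ?i" "node (?j + 1)" "\<gamma> s"] dist_triangle[of "\<gamma> s" "node (?j + 1)" "\<gamma> t"] by linarith
      then have "t - s \<le> dist (\<gamma> s) (\<gamma> t)"
        unfolding left right using node[of ?i "?j + 1"] ij by (simp add: algebra_simps)
      ultimately show ?thesis by simp
    qed
  qed
  have "dist (\<gamma> s) (\<gamma> t) = \<bar>s - t\<bar>" for s t
    using D[of s t] D[of t s] dist_commute[of "\<gamma> t" "\<gamma> s"] by (cases "s \<le> t") simp_all
  then have "geodesic_on UNIV \<gamma>" by (simp add: geodesic_on_def)
  moreover have "g (\<gamma> t) = \<gamma> (t + \<tau>)" for t
  proof -
    have e: "\<lfloor>(t + \<tau>) / \<tau>\<rfloor> = \<lfloor>t / \<tau>\<rfloor> + 1" using \<tau> by (simp add: add_divide_distrib)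
    show ?thesis unfolding \<gamma>_def e int_iterate_Suc[OF g] by (simp add: algebra_simps)
  qed
  ultimately show ?thesis unfolding is_axis_def using \<tau> by (intro exI[of _ \<gamma>] conjI exI[of _ \<tau>]) auto
qed

lemma hyperbolic_axis:
  fixes g :: "'a::cat0_space \<Rightarrow> 'a"
  assumes "hyperbolic g"
  shows "\<exists>\<gamma>. is_axis g \<gamma>"
proof -
  have g: "isometry g" using assms by (simp add: hyperbolic_def semisimple_def)
  obtain x where x: "dist x (g x) = translation_length g" using assms unfolding hyperbolic_def semisimple_def by auto
  show ?thesis
    by (rule axis_exists[OF g _ dist_orbit_of_minimal_displacement[OF g translation_length_le x]])
      (use assms in \<open>simp add: hyperbolic_def\<close>)
qed

lemma
  fixes g :: "'a::cat0_space \<Rightarrow> 'a"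
  assumes g: "isometry g" and \<gamma>: "geodesic_on UNIV \<gamma>" and l: "\<And>t. g (\<gamma> t) = \<gamma> (t + l)"
  shows int_iterate_axis: "int_iterate g i (\<gamma> t) = \<gamma> (t + real_of_int i * l)"
    and foot_int_iterate: "foot \<gamma> (int_iterate g i x) = foot \<gamma> x + real_of_int i * l"
    and height_int_iterate: "height \<gamma> (int_iterate g i x) = height \<gamma> x"
proof -
  show it: "int_iterate g i (\<gamma> t) = \<gamma> (t + real_of_int i * l)" for i t
  proof (induction i rule: int_induct[where k = 0])
    case base
    then show ?case by simp
  next
    case (step1 i)
    then show ?case using int_iterate_Suc[OF g, of i] l by (simp add: algebra_simps)
  next
    case (step2 i)
    have "g (int_iterate g (i - 1) (\<gamma> t)) = int_iterate g i (\<gamma> t)"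
      using int_iterate_Suc[OF g, of "i - 1"] by simp
    also have "\<dots> = g (\<gamma> (t + real_of_int (i - 1) * l))" using step2 l by (simp add: algebra_simps)
    finally show ?case using isometry_inj[OF g] by (metis injD)
  qed
  let ?G = "int_iterate g i"
  note G = isometry_int_iterate[OF g, of i]
  have range: "?G ` range \<gamma> = range \<gamma>"
  proof (intro equalityI subsetI)
    fix y assume "y \<in> ?G ` range \<gamma>" then show "y \<in> range \<gamma>" using it by auto
  next
    fix y assume "y \<in> range \<gamma>"
    then obtain s where "y = \<gamma> s" by auto
    then have "y = ?G (\<gamma> (s - real_of_int i * l))" using it by simp
    then show "y \<in> ?G ` range \<gamma>" by blast
  qed
  have "is_closest (range \<gamma>) (?G x) (?G (\<gamma> (foot \<gamma> x)))"
    using is_closest_isometry[OF G] foot_closest[OF \<gamma>, of x] range by metis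
  then have "is_closest (range \<gamma>) (?G x) (\<gamma> (foot \<gamma> x + real_of_int i * l))" by (simp add: it)
  then show f: "foot \<gamma> (?G x) = foot \<gamma> x + real_of_int i * l"
    by (intro coord_eqI[OF \<gamma> line_proj_defined[OF \<gamma>]]) auto
  show "height \<gamma> (?G x) = height \<gamma> x"
    unfolding height_def f it[symmetric] by (rule isometry_dist[OF G])
qed

text \<open>An axis translated backwards is reversed.\<close>

lemma positive_axis:
  assumes "is_axis g \<gamma>"
  obtains \<beta> l where "geodesic_on UNIV \<beta>" "range \<beta> = range \<gamma>" "0 < l" "\<And>t. g (\<beta> t) = \<beta> (t + l)"
proof -
  obtain l where \<gamma>: "geodesic_on UNIV \<gamma>" "l \<noteq> 0" "\<And>t. g (\<gamma> t) = \<gamma> (t + l)"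
    using assms unfolding is_axis_def by metis
  show ?thesis
  proof (cases "0 < l")
    case True
    then show ?thesis using that \<gamma> by blast
  next
    case False
    have "range (\<lambda>t. \<gamma> (- t)) = range \<gamma>"
    proof (intro equalityI image_subsetI)
      fix t show "\<gamma> t \<in> range (\<lambda>t. \<gamma> (- t))" by (rule image_eqI[of _ _ "- t"]) simp_all
    qed simp
    moreover have "geodesic_on UNIV (\<lambda>t. \<gamma> (- t))" using \<gamma>(1) by (simp add: geodesic_on_def abs_minus_commute)
    moreover have "g (\<gamma> (- t)) = \<gamma> (- (t + - l))" for t using \<gamma>(3) by simp
    ultimately show ?thesis using that[of "\<lambda>t. \<gamma> (- t)" "- l"] \<gamma>(2) False by simp
  qed
qed

section \<open>The equivalence of contraction, skewering and loxodromicity\<close>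

text \<open>
  A large power of \<open>g\<close> moves the first of two distant dual curtains beyond the second one.
\<close>

lemma contracting_skewers:
  fixes g :: "'a::cat0_space \<Rightarrow> 'a"
  assumes "contracting_isometry g"
  shows "\<exists>h h'. separated h h' \<and> skewers g h h'"
proof -
  obtain \<gamma>0 where ax: "is_axis g \<gamma>0" and con: "contracting (range \<gamma>0)" and g: "isometry g"
    using assms unfolding contracting_isometry_def hyperbolic_def semisimple_def by blast
  obtain \<gamma> l where \<gamma>: "geodesic_on UNIV \<gamma>" and r: "range \<gamma> = range \<gamma>0" and l: "0 < l" "\<And>t. g (\<gamma> t) = \<gamma> (t + l)"
    using positive_axis[OF ax] by blast
  define C where "C r = {x. \<bar>foot \<gamma> x - r\<bar> \<le> 1/2}" for r
  define B where "B r = {x. r + 1/2 < foot \<gamma> x}" for r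
  have ch: "halfspace_of (C r) (B r)" for r
    unfolding halfspace_of_def C_def B_def using line_curtain[OF \<gamma>, of r] by blast
  obtain M where M: "1 < M" "separated (C 0) (C M)"
    using contracting_dual_curtains_separated[OF \<gamma>] con unfolding r C_def by auto
  obtain m :: nat where m: "M + 1 < real m * l" using reals_Archimedean3[OF l(1)] by blast
  have f: "foot \<gamma> ((g ^^ m) x) = foot \<gamma> x + real m * l" for x
    using foot_int_iterate[OF g \<gamma> l(2), of "int m" x] by (simp add: int_iterate_of_nat)
  have dis: "C r \<inter> C s = {}" if "r + 1 < s" for r s
  proof (rule ccontr)
    assume "C r \<inter> C s \<noteq> {}"
    then obtain x where "\<bar>foot \<gamma> x - r\<bar> \<le> 1/2" "\<bar>foot \<gamma> x - s\<bar> \<le> 1/2" by (auto simp: C_def)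
    then show False using that by linarith
  qed
  have gC: "(g ^^ m) ` C 0 \<subseteq> C (real m * l)" unfolding C_def by (auto simp: f)
  have "(g ^^ m) ` B 0 \<subseteq> B (real m * l)" by (auto simp: f B_def)
  also have "\<dots> \<subset> B M"
  proof
    show "B (real m * l) \<subseteq> B M" using m by (auto simp: B_def)
    have "\<gamma> (M + 1) \<in> B M - B (real m * l)" using m by (simp add: B_def foot_line[OF \<gamma>])
    then show "B (real m * l) \<noteq> B M" by blast
  qed
  finally have 1: "(g ^^ m) ` B 0 \<subset> B M" .
  have 2: "B M \<subset> B 0"
  proof
    show "B M \<subseteq> B 0" using M by (auto simp: B_def)
    have "\<gamma> 1 \<in> B 0 - B M" using M by (simp add: B_def foot_line[OF \<gamma>])
    then show "B M \<noteq> B 0" by blast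
  qed
  have 3: "(g ^^ m) ` C 0 \<inter> C M = {}" "(g ^^ m) ` C 0 \<inter> C 0 = {}" "C M \<inter> C 0 = {}"
    using gC dis[of M "real m * l"] dis[of 0 "real m * l"] dis[of 0 M] m M(1) by auto
  have "skewers g (C 0) (C M)"
    unfolding skewers_def
    by (rule exI[of _ "C 0"], rule exI[of _ "C M"], rule exI[of _ "B 0"],
        rule exI[of _ "B M"], rule exI[of _ m]) (use ch 1 2 3 in simp)
  then show ?thesis using M(2) by blast
qed

text \<open>
  A fixed point cannot be separated from its image, so \<open>g\<close> has an axis. Translates of the chains along
  the orbit of one of its points serve all pairs of distant points of the axis.
\<close>

lemma linear_L_chains_contracting:
  fixes g :: "'a::cat0_space \<Rightarrow> 'a"
  assumes ss: "semisimple g" and lin: "\<And>x. linear_L_chains g x"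
  shows "contracting_isometry g"
proof -
  have g: "isometry g" using ss by (simp add: semisimple_def)
  obtain x where x: "dist x (g x) = translation_length g" using ss unfolding semisimple_def by blast
  have "0 < translation_length g"
  proof (rule ccontr)
    assume "\<not> ?thesis"
    then have "dist x (g x) \<le> 0" unfolding x by simp
    then have fixed: "g x = x" by simp
    have fixn: "(g ^^ n) x = x" for n by (induction n) (simp_all add: fixed)
    obtain L \<kappa> a where \<kappa>: "0 < \<kappa>" and ch: "\<And>n. \<exists>c. L_chain L c \<and>
        chain_separates c {x} {(g ^^ n) x} \<and> \<kappa> * real n - a \<le> real (card c)"
      using lin[of x] unfolding linear_L_chains_def by metis
    obtain n :: nat where "(a + 1) / \<kappa> < real n" using reals_Archimedean2 by blast
    then have n: "a + 1 < \<kappa> * real n" using \<kappa> by (simp add: field_simps)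
    obtain c where "chain_separates c {x} {x}" "\<kappa> * real n - a \<le> real (card c)" using ch[of n] fixn by auto
    then have "c \<noteq> {}" "\<forall>h\<in>c. separates h {x} {x}" using n by (auto simp: chain_separates_def)
    then obtain h where "separates h {x} {x}" by blast
    then obtain A B where "curtain_halfspaces h A B" "x \<in> A" "x \<in> B" by (auto elim: separatesE)
    then show False using halfspaces_disjoint(1) by blast
  qed
  then have hyp: "hyperbolic g" using ss by (simp add: hyperbolic_def)
  then obtain \<gamma>0 where ax: "is_axis g \<gamma>0" using hyperbolic_axis by blast
  obtain \<gamma> l where \<gamma>: "geodesic_on UNIV \<gamma>" and r: "range \<gamma> = range \<gamma>0" and l: "0 < l" "\<And>t. g (\<gamma> t) = \<gamma> (t + l)"
    using positive_axis[OF ax] by blast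
  obtain L \<kappa> a where \<kappa>: "0 < \<kappa>" and ch: "\<And>n. \<exists>c. L_chain L c \<and>
      chain_separates c {\<gamma> 0} {(g ^^ n) (\<gamma> 0)} \<and> \<kappa> * real n - a \<le> real (card c)"
    using lin[of "\<gamma> 0"] unfolding linear_L_chains_def by metis
  have ord: "\<exists>c. L_chain L c \<and> chain_separates c {\<gamma> (real_of_int i * l)} {\<gamma> (real_of_int j * l)} \<and>
      \<kappa> * real_of_int (j - i) - a \<le> real (card c)" if ij: "i \<le> j" for i j
  proof -
    obtain c where c: "L_chain L c" "chain_separates c {\<gamma> 0} {(g ^^ nat (j - i)) (\<gamma> 0)}"
      "\<kappa> * real (nat (j - i)) - a \<le> real (card c)" using ch by blast
    let ?G = "int_iterate g i"
    note G = isometry_int_iterate[OF g, of i]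
    have "(g ^^ nat (j - i)) (\<gamma> 0) = \<gamma> (real_of_int (j - i) * l)"
      using int_iterate_axis[OF g \<gamma> l(2), of "int (nat (j - i))" 0] ij unfolding int_iterate_of_nat by simp
    then have "?G ((g ^^ nat (j - i)) (\<gamma> 0)) = \<gamma> (real_of_int j * l)" "?G (\<gamma> 0) = \<gamma> (real_of_int i * l)"
      using int_iterate_axis[OF g \<gamma> l(2), of i] by (simp_all add: algebra_simps)
    then have "chain_separates ((`) ?G ` c) {\<gamma> (real_of_int i * l)} {\<gamma> (real_of_int j * l)}"
      using chain_separates_isometry[OF G c(2)] by simp
    moreover have "L_chain L ((`) ?G ` c)" by (rule L_chain_isometry[OF G c(1)])
    ultimately show ?thesis using c(3) ij card_image_isometry[OF G, of c] by (intro exI[of _ "(`) ?G ` c"]) simp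
  qed
  have "contracting (range \<gamma>)"
  proof (rule contracting_if_long_L_chains[where \<tau> = l and L = L, OF \<gamma>])
    fix N :: nat
    obtain n0 :: nat where "(a + real N) / \<kappa> < real n0" using reals_Archimedean2 by blast
    then have n0: "a + real N < \<kappa> * real n0" using \<kappa> by (simp add: field_simps)
    show "\<exists>M. \<forall>s t. M \<le> \<bar>t - s\<bar> \<longrightarrow> (\<exists>s0 t0 c. \<bar>s - s0\<bar> \<le> l \<and> \<bar>t - t0\<bar> \<le> l \<and>
        L_chain L c \<and> chain_separates c {\<gamma> s0} {\<gamma> t0} \<and> N \<le> card c)"
    proof (rule exI[of _ "(real n0 + 2) * l"], intro allI impI)
      fix s t assume st: "(real n0 + 2) * l \<le> \<bar>t - s\<bar>"
      define i where "i = \<lfloor>s / l\<rfloor>"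
      define j where "j = \<lfloor>t / l\<rfloor>"
      have near: "\<bar>u - real_of_int \<lfloor>u / l\<rfloor> * l\<bar> \<le> l" for u
      proof -
        have "\<bar>u / l - real_of_int \<lfloor>u / l\<rfloor>\<bar> * l \<le> 1 * l" using l(1) by (intro mult_right_mono) linarith+
        moreover have "\<bar>u / l - real_of_int \<lfloor>u / l\<rfloor>\<bar> * l = \<bar>(u / l - real_of_int \<lfloor>u / l\<rfloor>) * l\<bar>"
          using l(1) by (simp add: abs_mult)
        ultimately show ?thesis using l(1) by (simp add: left_diff_distrib)
      qed
      have si: "\<bar>s - real_of_int i * l\<bar> \<le> l" and tj: "\<bar>t - real_of_int j * l\<bar> \<le> l"
        unfolding i_def j_def by (rule near)+
      have "\<bar>t - s\<bar> \<le> \<bar>real_of_int j * l - real_of_int i * l\<bar> + 2 * l" using si tj by linarith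
      also have "\<bar>real_of_int j * l - real_of_int i * l\<bar> = \<bar>real_of_int (j - i)\<bar> * l"
        using l(1) by (simp add: abs_mult flip: left_diff_distrib)
      finally have "real n0 * l \<le> \<bar>real_of_int (j - i)\<bar> * l" using st by (simp add: algebra_simps)
      then have "real n0 \<le> \<bar>real_of_int (j - i)\<bar>" using l(1) by simp
      then have "\<kappa> * real n0 \<le> \<kappa> * \<bar>real_of_int (j - i)\<bar>" using \<kappa> by simp
      then have card: "real N \<le> \<kappa> * \<bar>real_of_int (j - i)\<bar> - a" using n0 by linarith
      have "\<exists>c. L_chain L c \<and> chain_separates c {\<gamma> (real_of_int i * l)} {\<gamma> (real_of_int j * l)} \<and> N \<le> card c"
      proof (cases "i \<le> j")
        case True
        obtain c where c: "L_chain L c" "chain_separates c {\<gamma> (real_of_int i * l)} {\<gamma> (real_of_int j * l)}"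
          "\<kappa> * real_of_int (j - i) - a \<le> real (card c)" using ord[OF True] by blast
        have e: "\<bar>real_of_int (j - i)\<bar> = real_of_int (j - i)" using True by simp
        have "N \<le> card c" using card[unfolded e] c(3) by linarith
        then show ?thesis using c by blast
      next
        case False
        then have "j \<le> i" by simp
        then obtain c where c: "L_chain L c" "chain_separates c {\<gamma> (real_of_int j * l)} {\<gamma> (real_of_int i * l)}"
          "\<kappa> * real_of_int (i - j) - a \<le> real (card c)" using ord by blast
        have e: "\<bar>real_of_int (j - i)\<bar> = real_of_int (i - j)" using False by simp
        have "N \<le> card c" using card[unfolded e] c(3) by linarith
        then show ?thesis using c chain_separates_commute by blast
      qed
      then show "\<exists>s0 t0 c. \<bar>s - s0\<bar> \<le> l \<and> \<bar>t - t0\<bar> \<le> l \<and>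
          L_chain L c \<and> chain_separates c {\<gamma> s0} {\<gamma> t0} \<and> N \<le> card c"
        using si tj by blast
    qed
  qed
  then show ?thesis unfolding contracting_isometry_def using hyp ax unfolding r by blast
qed

section \<open>Flat half-planes\<close>

lemma dist_plane: "dist (a, b) (c, d) = sqrt ((a - c)\<^sup>2 + (b - d)\<^sup>2)" for a b c d :: real
  by (simp add: dist_prod_def dist_real_def)

text \<open>
  The ball of radius \<open>r\<close> about the point at height \<open>r\<close> of the half-plane misses the line, and its part in
  the half-plane projects onto an interval of length \<open>2 * r\<close>.
\<close>

lemma contracting_no_flat_half_plane:
  fixes \<gamma> :: "real \<Rightarrow> 'a::cat0_space"
  assumes \<gamma>: "geodesic_on UNIV \<gamma>" and con: "contracting (range \<gamma>)"
  shows "\<not> bounds_flat_half_plane \<gamma>"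
proof
  assume "bounds_flat_half_plane \<gamma>"
  then obtain f :: "real \<times> real \<Rightarrow> 'a" where iso: "\<And>u v. u \<in> UNIV \<times> {0..} \<Longrightarrow> v \<in> UNIV \<times> {0..} \<Longrightarrow> dist (f u) (f v) = dist u v"
    and bd: "f ` (UNIV \<times> {0}) = range \<gamma>" unfolding bounds_flat_half_plane_def by metis
  obtain R where R: "R_contracting R (range \<gamma>)" using con by (auto simp: contracting_def)
  define r where "r = \<bar>R\<bar> + 2"
  have r: "0 < r" by (simp add: r_def)
  have foot: "\<gamma> (foot \<gamma> (f (a, r))) = f (a, 0)" for a
  proof -
    have "is_closest (range \<gamma>) (f (a, r)) (f (a, 0))"
      unfolding is_closest_def
    proof (intro conjI ballI)
      show "f (a, 0) \<in> range \<gamma>" unfolding bd[symmetric] by (rule imageI) simp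
      fix q assume "q \<in> range \<gamma>"
      then obtain b where q: "q = f (b, 0)" unfolding bd[symmetric] by auto
      have "r\<^sup>2 \<le> (a - b)\<^sup>2 + r\<^sup>2" by simp
      then have "sqrt (r\<^sup>2) \<le> sqrt ((a - b)\<^sup>2 + r\<^sup>2)" by (rule real_sqrt_le_mono)
      then show "dist (f (a, r)) (f (a, 0)) \<le> dist (f (a, r)) q"
        unfolding q using r by (simp add: iso dist_plane)
    qed
    then show ?thesis
      using closest_point_unique[OF geo_convex_geodesic[OF \<gamma>] _ foot_closest[OF \<gamma>]] by metis
  qed
  have "height \<gamma> (f (0, r)) = r" unfolding height_def foot using r by (simp add: iso dist_plane)
  moreover have "dist (f (0, r)) (f (\<bar>R\<bar> + 1, r)) = \<bar>R\<bar> + 1" using r by (simp add: iso dist_plane)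
  ultimately have "\<bar>foot \<gamma> (f (0, r)) - foot \<gamma> (f (\<bar>R\<bar> + 1, r))\<bar> \<le> R"
    by (intro contracting_lineD[OF \<gamma> R]) (simp add: r_def)
  then have "dist (f (0, 0)) (f (\<bar>R\<bar> + 1, 0)) \<le> R" unfolding foot[symmetric] line_dist[OF \<gamma>] .
  then show False by (simp add: iso dist_plane)
qed

section \<open>Geometry of the perpendiculars to a line\<close>

text \<open>
  The point at height \<open>s\<close> on the perpendicular through \<open>x\<close>. If \<open>x\<close> is on the line, the quotient is 0 and
  the point is \<open>x\<close>.
\<close>

definition perp :: "(real \<Rightarrow> 'a::metric_space) \<Rightarrow> 'a \<Rightarrow> real \<Rightarrow> 'a" where
  "perp \<gamma> x s = along (\<gamma> (foot \<gamma> x)) x (s / height \<gamma> x)"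

context
  fixes \<gamma> :: "real \<Rightarrow> 'a::cat0_space"
  assumes \<gamma>: "geodesic_on UNIV \<gamma>"
begin

lemma
  assumes s: "0 \<le> s" "s \<le> height \<gamma> x"
  shows dist_foot_perp: "dist (\<gamma> (foot \<gamma> x)) (perp \<gamma> x s) = s"
    and dist_perp_top: "dist (perp \<gamma> x s) x = height \<gamma> x - s"
    and perp_in_seg: "perp \<gamma> x s \<in> seg (\<gamma> (foot \<gamma> x)) x"
    and foot_perp: "foot \<gamma> (perp \<gamma> x s) = foot \<gamma> x"
    and height_perp: "height \<gamma> (perp \<gamma> x s) = s"
proof -
  let ?H = "height \<gamma> x"
  have l: "0 \<le> s / ?H" "s / ?H \<le> 1" using s by (auto simp: divide_le_eq_1)
  have m: "s / ?H * ?H = s" using s by (cases "?H = 0") auto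
  have d: "dist (\<gamma> (foot \<gamma> x)) x = ?H" by (simp add: height_def dist_commute)
  show 1: "dist (\<gamma> (foot \<gamma> x)) (perp \<gamma> x s) = s" "dist (perp \<gamma> x s) x = ?H - s"
    unfolding perp_def dist_along[OF l] d left_diff_distrib m by simp_all
  show 2: "perp \<gamma> x s \<in> seg (\<gamma> (foot \<gamma> x)) x" unfolding perp_def by (rule along_in_seg[OF l])
  then show 3: "foot \<gamma> (perp \<gamma> x s) = foot \<gamma> x"
    using foot_on_perpendicular[OF \<gamma>] by (simp add: seg_commute)
  show "height \<gamma> (perp \<gamma> x s) = s" unfolding height_def 3 using 1 by (simp add: dist_commute)
qed

lemma perp_height [simp]: "perp \<gamma> x (height \<gamma> x) = x"
  using dist_perp_top[of "height \<gamma> x" x] by simp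

lemma perp_0 [simp]: "perp \<gamma> x 0 = \<gamma> (foot \<gamma> x)"
  by (simp add: perp_def)

lemma dist_perp_perp:
  assumes "0 \<le> s" "s \<le> height \<gamma> x" "0 \<le> s'" "s' \<le> height \<gamma> x"
  shows "dist (perp \<gamma> x s) (perp \<gamma> x s') = \<bar>s - s'\<bar>"
  using dist_on_seg[OF perp_in_seg perp_in_seg, of s x s'] assms by (simp add: dist_foot_perp)

lemma perp_spread:
  assumes s: "0 \<le> s" "s \<le> height \<gamma> p" "s \<le> height \<gamma> q" and \<mu>: "0 \<le> \<mu>" "\<mu> \<le> 1"
  shows "dist (perp \<gamma> p (\<mu> * s)) (perp \<gamma> q (\<mu> * s))
    \<le> (1 - \<mu>) * \<bar>foot \<gamma> p - foot \<gamma> q\<bar> + \<mu> * dist (perp \<gamma> p s) (perp \<gamma> q s)"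
proof -
  have ms: "0 \<le> \<mu> * s" "\<mu> * s \<le> s" using s \<mu> by (auto simp: mult_left_le_one_le)
  have *: "perp \<gamma> x (\<mu> * s) = along (\<gamma> (foot \<gamma> x)) (perp \<gamma> x s) \<mu>" if "s \<le> height \<gamma> x" for x
    by (rule along_unique[OF \<mu>]) (use that s ms in \<open>simp_all add: dist_foot_perp dist_perp_perp algebra_simps\<close>)
  show ?thesis
    using dist_convex[OF \<mu>, of "\<gamma> (foot \<gamma> p)" "perp \<gamma> p s" "\<gamma> (foot \<gamma> q)" "perp \<gamma> q s"] s
    by (simp add: * line_dist[OF \<gamma>])
qed

lemma height_on_seg:
  assumes "z \<in> seg x y" shows "height \<gamma> z \<le> max (height \<gamma> x) (height \<gamma> y)"
proof -
  obtain l where l: "0 \<le> l" "l \<le> 1" "z = along x y l" using seg_along[OF assms] by blast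
  let ?w = "along (\<gamma> (foot \<gamma> x)) (\<gamma> (foot \<gamma> y)) l"
  obtain u where u: "?w = \<gamma> u" using seg_line[OF \<gamma> along_in_seg[OF l(1,2)]] by metis
  have "height \<gamma> z \<le> dist z ?w" unfolding u by (rule height_le[OF \<gamma>])
  also have "\<dots> \<le> (1 - l) * height \<gamma> x + l * height \<gamma> y"
    unfolding l(3) height_def by (rule dist_convex[OF l(1,2)])
  also have "\<dots> \<le> (1 - l) * max (height \<gamma> x) (height \<gamma> y) + l * max (height \<gamma> x) (height \<gamma> y)"
    using l by (intro add_mono mult_left_mono) auto
  finally show ?thesis by (simp add: algebra_simps)
qed

text \<open>
  If \<open>p\<close> is at least as high as \<open>q\<close>, the point of its perpendicular at the height of \<open>q\<close> is the point
  closest to \<open>p\<close> on the geodesic to \<open>q\<close>, because heights along that geodesic do not exceed that of \<open>q\<close>.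
\<close>

lemma foot_height_pythagoras:
  "(height \<gamma> p - height \<gamma> q)\<^sup>2 + (foot \<gamma> p - foot \<gamma> q)\<^sup>2 \<le> (dist p q)\<^sup>2"
proof -
  have *: "(height \<gamma> p - height \<gamma> q)\<^sup>2 + (foot \<gamma> p - foot \<gamma> q)\<^sup>2 \<le> (dist p q)\<^sup>2"
    if le: "height \<gamma> q \<le> height \<gamma> p" for p q
  proof -
    define r where "r = perp \<gamma> p (height \<gamma> q)"
    have r: "dist r p = height \<gamma> p - height \<gamma> q" "foot \<gamma> r = foot \<gamma> p" "height \<gamma> r = height \<gamma> q"
      using le by (simp_all add: r_def dist_perp_top foot_perp height_perp)
    have "is_closest (seg r q) p r"
      unfolding is_closest_def
    proof (intro conjI ballI)
      fix m assume "m \<in> seg r q"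
      then have "height \<gamma> m \<le> height \<gamma> q" using height_on_seg[of m r q] r(3) by simp
      then show "dist p r \<le> dist p m"
        using height_nonexpansive[OF \<gamma>, of p m] r(1) by (simp add: dist_commute[of p r])
    qed simp
    then have "(dist p r)\<^sup>2 + (dist r q)\<^sup>2 \<le> (dist p q)\<^sup>2"
      by (rule closest_point_obtuse[OF geo_convex_seg]) simp
    moreover have "(foot \<gamma> p - foot \<gamma> q)\<^sup>2 \<le> (dist r q)\<^sup>2"
      using foot_nonexpansive[OF \<gamma>, of r q] r(2) by (simp add: power2_le_iff_abs_le)
    ultimately show ?thesis using r(1) by (simp add: dist_commute[of p r])
  qed
  show ?thesis
    using *[of q p] *[of p q] by (cases "height \<gamma> q \<le> height \<gamma> p")
      (simp_all add: dist_commute[of q p] power2_commute[of "height \<gamma> q"] power2_commute[of "foot \<gamma> q"])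
qed

section \<open>Uniformly diverging perpendiculars make a line contracting\<close>

context
  fixes \<delta> b \<theta> :: real
  assumes \<delta>: "0 < \<delta>" and b: "0 < b" and \<theta>: "0 < \<theta>"
    and gap: "\<And>p q. height \<gamma> p = \<delta> \<Longrightarrow> height \<gamma> q = \<delta> \<Longrightarrow> \<bar>foot \<gamma> p - foot \<gamma> q\<bar> = b \<Longrightarrow> b + \<theta> \<le> dist p q"
begin

text \<open>
  The distance between two perpendiculars is a convex function of the height; it is \<open>b\<close> at height 0 and
  at least \<open>b + \<theta>\<close> at height \<open>\<delta>\<close>.
\<close>

lemma perp_divergence:
  assumes "\<delta> \<le> s" "s \<le> height \<gamma> p" "s \<le> height \<gamma> q" and f: "\<bar>foot \<gamma> p - foot \<gamma> q\<bar> = b"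
  shows "b + \<theta> / \<delta> * s \<le> dist (perp \<gamma> p s) (perp \<gamma> q s)"
proof -
  define \<mu> where "\<mu> = \<delta> / s"
  have s: "0 < s" using assms \<delta> by linarith
  have \<mu>: "0 < \<mu>" "\<mu> \<le> 1" "\<mu> * s = \<delta>" using s \<delta> assms by (auto simp: \<mu>_def)
  let ?\<phi> = "dist (perp \<gamma> p s) (perp \<gamma> q s)"
  have "b + \<theta> \<le> dist (perp \<gamma> p \<delta>) (perp \<gamma> q \<delta>)"
    by (rule gap) (use assms \<delta> in \<open>simp_all add: height_perp foot_perp\<close>)
  also have "\<dots> \<le> (1 - \<mu>) * b + \<mu> * ?\<phi>"
    using perp_spread[of s p q \<mu>] assms s \<mu> by simp
  finally have "\<theta> \<le> \<mu> * (?\<phi> - b)" by (simp add: algebra_simps)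
  then have "\<theta> / \<mu> \<le> ?\<phi> - b" using \<mu>(1) by (simp add: divide_le_eq mult.commute)
  moreover have "\<theta> / \<mu> = \<theta> / \<delta> * s" by (simp add: \<mu>_def)
  ultimately show ?thesis by simp
qed

text \<open>
  In a Euclidean cone the perpendiculars would span the angle \<open>\<theta> / \<delta>\<close>. By the law of cosines, changing
  from one to the other at height \<open>s\<close> costs an additional length of the order of \<open>s\<close> times its square.
\<close>

definition angle_rate :: real where "angle_rate = min 1 (\<theta> / \<delta> / 2)"

definition angle_gain :: real where "angle_gain = angle_rate\<^sup>2 / 2"

lemma angle_rate: "0 < angle_rate" "angle_rate \<le> 1" "2 * angle_rate \<le> \<theta> / \<delta>"
proof -
  have t: "0 < \<theta> / \<delta>" using \<delta> \<theta> by simp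
  show "0 < angle_rate" "angle_rate \<le> 1" using t unfolding angle_rate_def by simp_all
  show "2 * angle_rate \<le> \<theta> / \<delta>" unfolding angle_rate_def by (simp add: min_def)
qed

lemma angle_gain: "0 < angle_gain" "2 * angle_gain \<le> angle_rate" "angle_gain \<le> 1 / 2"
proof -
  have "angle_rate\<^sup>2 \<le> angle_rate * 1"
    unfolding power2_eq_square using angle_rate by (intro mult_left_mono) auto
  then show "2 * angle_gain \<le> angle_rate" "angle_gain \<le> 1 / 2" using angle_rate by (auto simp: angle_gain_def)
  show "0 < angle_gain" using angle_rate by (simp add: angle_gain_def)
qed

text \<open>
  If \<open>d(p, q)\<close> were smaller, \<open>q\<close> would be almost on the geodesic from \<open>p\<close> to the foot \<open>q'\<close> of \<open>q\<close>. That
  geodesic stays within distance \<open>b\<close> of the perpendicular through \<open>p\<close>, which contradicts the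
  divergence of the perpendiculars at the height \<open>s\<close> of \<open>q\<close>.
\<close>

lemma climbing_gain:
  assumes f: "\<bar>foot \<gamma> p - foot \<gamma> q\<bar> = b" and s: "\<delta> \<le> height \<gamma> q" "height \<gamma> q \<le> height \<gamma> p"
  shows "height \<gamma> p - height \<gamma> q + angle_gain * height \<gamma> q \<le> dist p q"
proof (rule ccontr)
  assume less: "\<not> ?thesis"
  define s where "s = height \<gamma> q"
  define P where "P = dist p q"
  define Hp where "Hp = height \<gamma> p"
  define p' where "p' = \<gamma> (foot \<gamma> p)"
  define q' where "q' = \<gamma> (foot \<gamma> q)"
  define G where "G = dist p q'"
  define T where "T = P + s"
  define c where "c = angle_gain"
  define \<kappa> where "\<kappa> = angle_rate"
  have s0: "0 < s" "\<delta> \<le> s" "s \<le> Hp" using \<delta> assms by (auto simp: s_def Hp_def)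
  have qq': "dist q q' = s" by (simp add: s_def q'_def height_def)
  have T: "T < Hp + c * s" using less by (simp add: T_def P_def s_def Hp_def c_def)
  have GH: "Hp \<le> G" unfolding Hp_def G_def q'_def by (rule height_le[OF \<gamma>])
  have GT: "G \<le> T" unfolding G_def T_def P_def using dist_triangle[of p q' q] qq' by simp
  have P0: "0 \<le> P" by (simp add: P_def)
  have T0: "0 < T" "s \<le> T" "P \<le> T" using P0 s0 by (auto simp: T_def)
  \<comment> \<open>\<open>w\<close> divides \<open>[p, q']\<close> in the ratio in which \<open>q\<close> divides the path from \<open>p\<close> through \<open>q\<close> to \<open>q'\<close>.\<close>
  define l where "l = P / T"
  have l: "0 \<le> l" "l \<le> 1" "1 - l = s / T"
    using P0 T0 by (auto simp: l_def field_simps T_def)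
  define w where "w = along p q' l"
  define v where "v = along p p' l"
  have "(dist q w)\<^sup>2 \<le> (1 - l) * (dist q p)\<^sup>2 + l * (dist q q')\<^sup>2 - l * (1 - l) * (dist p q')\<^sup>2"
    by (rule CN_inequality) (use l(1,2) in \<open>simp_all add: w_def dist_along\<close>)
  also have "\<dots> = s / T * P\<^sup>2 + P / T * s\<^sup>2 - P / T * (s / T) * G\<^sup>2"
    unfolding l(3) qq' by (simp add: l_def P_def G_def dist_commute[of q p])
  also have "\<dots> = (P / T) * s * ((T - G) * ((T + G) / T))"
  proof -
    have "s / T * P\<^sup>2 + P / T * s\<^sup>2 = P / T * s * T" unfolding T_def power2_eq_square
      by (simp add: algebra_simps add_divide_distrib)
    moreover have "T = T * T / T" using T0 by simp
    ultimately show ?thesis using T0 by (simp add: field_simps power2_eq_square)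
  qed
  also have "\<dots> \<le> 1 * s * ((c * s) * 2)"
  proof (intro mult_mono)
    show "P / T \<le> 1" "(T + G) / T \<le> 2" using T0 GT by (simp_all add: divide_le_eq)
    show "T - G \<le> c * s" using T GH by linarith
  qed (use P0 T0 GT s0 angle_gain GH in \<open>auto simp: c_def intro!: mult_nonneg_nonneg divide_nonneg_nonneg\<close>)
  also have "\<dots> = (\<kappa> * s)\<^sup>2" by (simp add: c_def angle_gain_def \<kappa>_def power2_eq_square)
  finally have qw: "dist q w \<le> \<kappa> * s" by (rule power2_le_imp_le) (use s0 angle_rate in \<open>simp add: \<kappa>_def\<close>)
  have "dist w v \<le> l * dist q' p'" unfolding w_def v_def by (rule dist_along_common_point[OF l(1,2)])
  also have "\<dots> \<le> 1 * b"
    using l(1,2) f by (intro mult_mono) (auto simp: q'_def p'_def line_dist[OF \<gamma>])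
  finally have wv: "dist w v \<le> b" by simp
  have pp': "dist p' p = Hp" by (simp add: p'_def Hp_def height_def dist_commute)
  have "v \<in> seg p' p" unfolding v_def using along_in_seg[OF l(1,2)] by (simp add: seg_commute)
  moreover have "perp \<gamma> p s \<in> seg p' p" unfolding p'_def by (rule perp_in_seg) (use s0 in \<open>simp_all add: Hp_def\<close>)
  ultimately have "dist v (perp \<gamma> p s) = \<bar>dist p' v - dist p' (perp \<gamma> p s)\<bar>" by (rule dist_on_seg)
  also have "dist p' v = s / T * Hp"
    unfolding v_def l(3)[symmetric] using dist_along(2)[OF l(1,2), of p p'] pp' by (simp add: dist_commute)
  also have "dist p' (perp \<gamma> p s) = s"
    unfolding p'_def by (rule dist_foot_perp) (use s0 in \<open>simp_all add: Hp_def\<close>)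
  also have "\<bar>s / T * Hp - s\<bar> \<le> c * s"
  proof -
    have "s - s / T * Hp = s / T * (T - Hp)" using T0 by (simp add: field_simps)
    also have "\<dots> \<le> 1 * (c * s)" using T0 s0 T GH GT angle_gain by (intro mult_mono) (auto simp: c_def)
    finally have "s - s / T * Hp \<le> c * s" by simp
    moreover have "s / T * Hp \<le> s" using T0 s0 GH GT by (simp add: divide_le_eq)
    ultimately show ?thesis by simp
  qed
  finally have vp: "dist v (perp \<gamma> p s) \<le> c * s" .
  have "dist q (perp \<gamma> p s) \<le> dist q w + dist w v + dist v (perp \<gamma> p s)"
    using dist_triangle[of q "perp \<gamma> p s" w] dist_triangle[of w "perp \<gamma> p s" v] by linarith
  also have "\<dots> \<le> b + (\<kappa> + c) * s" using qw wv vp by (simp add: algebra_simps)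
  also have "\<dots> < b + \<theta> / \<delta> * s"
  proof -
    have "\<kappa> + c < \<theta> / \<delta>" using angle_rate angle_gain by (simp add: \<kappa>_def c_def)
    then have "(\<kappa> + c) * s < \<theta> / \<delta> * s" using s0(1) by (rule mult_strict_right_mono)
    then show ?thesis by (simp only: add_less_cancel_left)
  qed
  also have "\<dots> \<le> dist (perp \<gamma> p s) (perp \<gamma> q s)"
    by (rule perp_divergence) (use s0 f in \<open>simp_all add: s_def Hp_def\<close>)
  finally show False by (simp add: s_def dist_commute)
qed

lemma block_gain:
  assumes f: "\<bar>foot \<gamma> p - foot \<gamma> q\<bar> = b" and s: "\<delta> \<le> height \<gamma> p" "\<delta> \<le> height \<gamma> q"
  shows "height \<gamma> p - height \<gamma> q + angle_gain * height \<gamma> q \<le> dist p q"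
proof (cases "height \<gamma> q \<le> height \<gamma> p")
  case True
  then show ?thesis using climbing_gain f s by blast
next
  case False
  have climb: "height \<gamma> q - height \<gamma> p + angle_gain * height \<gamma> p \<le> dist p q"
    using climbing_gain[of q p] f s False by (simp add: abs_minus_commute dist_commute)
  have "angle_gain * (height \<gamma> q - height \<gamma> p) \<le> 1 * (height \<gamma> q - height \<gamma> p)"
    using False angle_gain by (intro mult_right_mono) auto
  with False have "angle_gain * height \<gamma> q - angle_gain * height \<gamma> p \<le> 2 * (height \<gamma> q - height \<gamma> p)"
    by (simp add: right_diff_distrib)
  with climb show ?thesis by (simp add: algebra_simps)
qed

text \<open>
  Let \<open>d(x, y)\<close> be less than the height of \<open>x\<close>, and divide \<open>[x, y]\<close> by points whose feet are at the
  multiples of \<open>b\<close> from the foot of \<open>x\<close>, stopping \<open>2 * \<delta>\<close> before the foot of \<open>y\<close>; up to there all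
  heights are at least \<open>\<delta>\<close>. Later heights are at most twice earlier ones, and each block costs its loss
  of height plus a fixed proportion of the height at its end. So after \<open>k\<close> blocks the length travelled
  is at least the height lost plus \<open>k\<close> times a fixed proportion of the current height, and for large
  \<open>k\<close> this is at least the height of \<open>x\<close>.
\<close>

lemma diverging_perpendiculars_contracting: "contracting (range \<gamma>)"
proof -
  obtain n :: nat where n: "2 / angle_gain < real n" using reals_Archimedean2 by blast
  then have n2: "2 \<le> angle_gain * real n" using angle_gain(1) by (simp add: divide_less_eq mult.commute)
  show ?thesis
  proof (rule contracting_lineI[OF \<gamma>, of "real n * b + 2 * \<delta>"], rule ccontr)
    fix x y assume xy: "dist x y < height \<gamma> x" and far: "\<not> \<bar>foot \<gamma> x - foot \<gamma> y\<bar> \<le> real n * b + 2 * \<delta>"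
    define d where "d = dist x y"
    define H where "H l = height \<gamma> (along x y l)" for l
    define e :: real where "e = (if foot \<gamma> x \<le> foot \<gamma> y then 1 else -1)"
    define F where "F l = e * (foot \<gamma> (along x y l) - foot \<gamma> x)" for l
    have e: "\<bar>e\<bar> = 1" by (simp add: e_def)
    have F0: "F 0 = 0" by (simp add: F_def)
    have F1: "F 1 = \<bar>foot \<gamma> x - foot \<gamma> y\<bar>" by (simp add: F_def e_def)
    have Fd: "\<bar>foot \<gamma> (along x y l) - foot \<gamma> (along x y m)\<bar> = \<bar>F l - F m\<bar>" for l m
    proof -
      have "F l - F m = e * (foot \<gamma> (along x y l) - foot \<gamma> (along x y m))" by (simp add: F_def algebra_simps)
      then show ?thesis using e by (simp add: abs_mult)
    qed
    have contF: "continuous_on {0..1} F"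
      unfolding F_def
      by (intro continuous_intros continuous_on_compose2[OF continuous_on_foot[OF \<gamma>, of UNIV] continuous_on_along]) auto
    have dl: "dist x (along x y l) = l * d" "dist (along x y l) y = (1 - l) * d" if "0 \<le> l" "l \<le> 1" for l
      using dist_along[OF that] by (simp_all add: d_def)
    have drop: "H 0 - H l \<le> l * d" if "0 \<le> l" "l \<le> 1" for l
      using height_nonexpansive[OF \<gamma>, of x "along x y l"] dl[OF that] by (simp add: H_def)
    have H0: "d < H 0" using xy by (simp add: H_def d_def)
    have high: "\<delta> \<le> H l" if l: "0 \<le> l" "l \<le> 1" and Fl: "F l \<le> F 1 - 2 * \<delta>" for l
    proof -
      have "\<bar>foot \<gamma> y - foot \<gamma> (along x y l)\<bar> \<le> dist y (\<gamma> (foot \<gamma> (along x y l)))" by (rule foot_le[OF \<gamma>])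
      also have "\<dots> \<le> dist (along x y l) y + H l"
        using dist_triangle[of y "\<gamma> (foot \<gamma> (along x y l))" "along x y l"] by (simp add: H_def height_def dist_commute)
      finally have "F 1 - F l \<le> (1 - l) * d + H l" using Fd[of 1 l] dl[OF l] by simp
      then show ?thesis using drop[OF l] H0 Fl by (simp add: algebra_simps)
    qed
    have double: "H m \<le> 2 * H l" if "0 \<le> l" "l \<le> m" "m \<le> 1" for l m
    proof -
      have "H m - H l \<le> dist (along x y l) (along x y m)"
        using height_nonexpansive[OF \<gamma>, of "along x y m" "along x y l"] by (simp add: H_def dist_commute)
      also have "\<dots> = (m - l) * d" using dist_along_along[of l m x y] that by (simp add: d_def)
      finally have "H m - H l \<le> m * d - l * d" by (simp add: algebra_simps)
      moreover have "m * d \<le> d" using that(3) mult_right_mono[of m 1 d] by (simp add: d_def)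
      ultimately show ?thesis using drop[of l] that H0 by linarith
    qed
    \<comment> \<open>\<open>S\<close> is the sum of the heights at the ends of the first \<open>k\<close> blocks.\<close>
    have "\<exists>l S. 0 \<le> l \<and> l \<le> 1 \<and> F l = real k * b \<and> H 0 - H l + angle_gain * S \<le> l * d \<and>
        (\<forall>m. l \<le> m \<longrightarrow> m \<le> 1 \<longrightarrow> real k * H m \<le> 2 * S)" if "real k * b \<le> F 1 - 2 * \<delta>" for k
      using that
    proof (induction k)
      case 0
      show ?case by (rule exI[of _ 0], rule exI[of _ 0]) (simp add: F0)
    next
      case (Suc k)
      have k: "real k * b \<le> F 1 - 2 * \<delta>" using Suc.prems b by (simp add: algebra_simps)
      then obtain l S where l: "0 \<le> l" "l \<le> 1" "F l = real k * b" "H 0 - H l + angle_gain * S \<le> l * d"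
        and S: "\<And>m. l \<le> m \<Longrightarrow> m \<le> 1 \<Longrightarrow> real k * H m \<le> 2 * S" using Suc.IH by metis
      have "continuous_on {l..1} F" by (rule continuous_on_subset[OF contF]) (use l in auto)
      moreover have "F l \<le> real (Suc k) * b" "real (Suc k) * b \<le> F 1"
        using l(3) b Suc.prems \<delta> by (simp_all add: algebra_simps)
      ultimately obtain m where m: "l \<le> m" "m \<le> 1" "F m = real (Suc k) * b"
        using IVT'[of F l "real (Suc k) * b" 1] l(2) by blast
      have "H l - H m + angle_gain * H m \<le> dist (along x y l) (along x y m)"
        unfolding H_def
      proof (rule block_gain)
        show "\<bar>foot \<gamma> (along x y l) - foot \<gamma> (along x y m)\<bar> = b"
          unfolding Fd l(3) m(3) using b by (simp add: algebra_simps)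
        show "\<delta> \<le> height \<gamma> (along x y l)" using high[of l] l k by (simp add: H_def)
        show "\<delta> \<le> height \<gamma> (along x y m)" using high[of m] l m Suc.prems by (simp add: H_def)
      qed
      also have "\<dots> = m * d - l * d"
        using dist_along_along[of l m x y] l m by (simp add: d_def left_diff_distrib)
      finally have 1: "H 0 - H m + angle_gain * (S + H m) \<le> m * d" using l(4) by (simp add: algebra_simps)
      have 2: "real (Suc k) * H m' \<le> 2 * (S + H m)" if m': "m \<le> m'" "m' \<le> 1" for m'
        using S[of m'] double[of m m'] l m m' by (simp add: algebra_simps)
      show ?case
        by (rule exI[of _ m], rule exI[of _ "S + H m"]) (use l m 1 2 in auto)
    qed
    moreover have "real n * b \<le> F 1 - 2 * \<delta>" using far F1 by simp
    ultimately obtain l S where l: "0 \<le> l" "l \<le> 1" "H 0 - H l + angle_gain * S \<le> l * d" "real n * H l \<le> 2 * S"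
      by (metis order_refl)
    have "2 * H l \<le> angle_gain * real n * H l" using n2 by (rule mult_right_mono) (simp add: H_def)
    also have "\<dots> \<le> angle_gain * (2 * S)" unfolding mult.assoc using l(4) angle_gain(1) by (intro mult_left_mono) auto
    finally have "H 0 \<le> l * d" using l(3) by simp
    moreover have "l * d \<le> d" using l(2) mult_right_mono[of l 1 d] by (simp add: d_def)
    ultimately show False using H0 by linarith
  qed
qed

end

end

section \<open>Almost flat rectangles and their limit\<close>

lemma dist_plane_le: "dist (a, b) (c, d) \<le> \<bar>a - c\<bar> + \<bar>b - d\<bar>" for a b c d :: real
  unfolding dist_plane by (rule sqrt_sum_squares_le_sum_abs)

text \<open>
  \<open>X\<close> parametrises an almost flat rectangle of height \<open>N\<close> over the stretch of length \<open>2 * N\<close> of the line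
  about \<open>\<gamma> u\<close>. Upper bounds are asked for horizontal and vertical distances only, since diagonals are
  controlled in the limit.
\<close>

definition almost_flat ::
  "(real \<Rightarrow> 'a::metric_space) \<Rightarrow> real \<Rightarrow> real \<Rightarrow> real \<Rightarrow> (real \<Rightarrow> real \<Rightarrow> 'a) \<Rightarrow> bool" where
  "almost_flat \<gamma> N u \<epsilon> X \<longleftrightarrow>
    (\<forall>t\<in>{u - N..u + N}. X t 0 = \<gamma> t) \<and>
    (\<forall>t\<in>{u - N..u + N}. \<forall>s\<in>{0..N}. \<forall>s'\<in>{0..N}. dist (X t s) (X t s') \<le> \<bar>s - s'\<bar>) \<and>
    (\<forall>t\<in>{u - N..u + N}. \<forall>t'\<in>{u - N..u + N}. \<forall>s\<in>{0..N}.
       dist (X t s) (X t' s) \<le> \<bar>t - t'\<bar> * (1 + \<epsilon>)) \<and>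
    (\<forall>t\<in>{u - N..u + N}. \<forall>t'\<in>{u - N..u + N}. \<forall>s\<in>{0..N}. \<forall>s'\<in>{0..N}.
       dist (t, s) (t', s') - \<epsilon> \<le> dist (X t s) (X t' s'))"

text \<open>
  In a quadrilateral with base \<open>2 * N\<close> on the line, perpendicular sides of length \<open>N\<close> and a top that is
  longer than the base by at most \<open>\<theta>\<close>, let \<open>X t s\<close> divide the segment between the points at height \<open>s\<close>
  on the two sides in the ratio in which \<open>\<gamma> t\<close> divides the base. Its foot and height are close to \<open>t\<close>
  and \<open>s\<close>: by \<open>foot_height_pythagoras\<close> a sagging top would be too long, and vertical distances do not
  exceed the differences of \<open>s\<close>. The same inequality then bounds distances from below.
\<close>

lemma almost_flat_rectangle:
  fixes \<gamma> :: "real \<Rightarrow> 'a::cat0_space"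
  assumes \<gamma>: "geodesic_on UNIV \<gamma>" and N: "1 \<le> N"
    and hp: "height \<gamma> p = N" "foot \<gamma> p = u - N" and hq: "height \<gamma> q = N" "foot \<gamma> q = u + N"
    and pq: "dist p q \<le> 2 * N + \<theta>" and \<theta>: "0 \<le> \<theta>" and \<omega>: "0 \<le> \<omega>" "2 * \<theta> * (2 * N + \<theta>) \<le> \<omega>\<^sup>2"
  shows "\<exists>X. almost_flat \<gamma> N u (2 * (\<theta> + \<omega>)) X"
proof -
  define A where "A s = perp \<gamma> p s" for s
  define B where "B s = perp \<gamma> q s" for s
  define \<phi> where "\<phi> s = dist (A s) (B s)" for s
  define \<rho> where "\<rho> t = (t - u + N) / (2 * N)" for t
  define X where "X t s = along (A s) (B s) (\<rho> t)" for t s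
  have \<rho>: "0 \<le> \<rho> t" "\<rho> t \<le> 1" if "\<bar>t - u\<bar> \<le> N" for t using that N by (auto simp: \<rho>_def)
  have \<rho>N: "\<rho> t * (2 * N) = t - u + N" for t using N by (simp add: \<rho>_def)
  have A: "foot \<gamma> (A s) = u - N" "height \<gamma> (A s) = s" if "0 \<le> s" "s \<le> N" for s
    using that foot_perp[OF \<gamma>, of s p] height_perp[OF \<gamma>, of s p] hp by (simp_all add: A_def)
  have B: "foot \<gamma> (B s) = u + N" "height \<gamma> (B s) = s" if "0 \<le> s" "s \<le> N" for s
    using that foot_perp[OF \<gamma>, of s q] height_perp[OF \<gamma>, of s q] hq by (simp_all add: B_def)
  have AB: "dist (A s) (A s') = \<bar>s - s'\<bar>" "dist (B s) (B s') = \<bar>s - s'\<bar>"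
    if "0 \<le> s" "s \<le> N" "0 \<le> s'" "s' \<le> N" for s s'
    using that dist_perp_perp[OF \<gamma>, of s _ s'] hp hq by (simp_all add: A_def B_def)
  have \<phi>: "\<phi> s \<le> 2 * N + \<theta>" if s: "0 \<le> s" "s \<le> N" for s
  proof -
    define \<mu> where "\<mu> = s / N"
    have \<mu>: "0 \<le> \<mu>" "\<mu> \<le> 1" "\<mu> * N = s" using s N by (auto simp: \<mu>_def)
    have "perp \<gamma> p N = p" "perp \<gamma> q N = q" using perp_height[OF \<gamma>, of p] perp_height[OF \<gamma>, of q] hp hq by simp_all
    then have "\<phi> s \<le> (1 - \<mu>) * (2 * N) + \<mu> * dist p q"
      using perp_spread[OF \<gamma>, of N p q \<mu>] hp hq N \<mu> by (simp add: \<phi>_def A_def B_def)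
    also have "\<dots> \<le> (1 - \<mu>) * (2 * N) + \<mu> * (2 * N + \<theta>)" using \<mu>(1) pq by (intro add_left_mono mult_left_mono)
    also have "\<dots> = 2 * N + \<mu> * \<theta>" by (simp add: algebra_simps)
    also have "\<dots> \<le> 2 * N + \<theta>" using \<mu>(2) \<theta> mult_right_mono[of \<mu> 1 \<theta>] by simp
    finally show ?thesis .
  qed
  have dX: "dist (A s) (X t s) = \<rho> t * \<phi> s" "dist (X t s) (B s) = (1 - \<rho> t) * \<phi> s" if "\<bar>t - u\<bar> \<le> N" for t s
    using dist_along[OF \<rho>[OF that]] by (simp_all add: X_def \<phi>_def)
  have foot: "\<bar>foot \<gamma> (X t s) - t\<bar> \<le> \<theta>" if t: "\<bar>t - u\<bar> \<le> N" and s: "0 \<le> s" "s \<le> N" for t s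
  proof -
    note l = \<rho>[OF t]
    have th: "\<rho> t * \<theta> \<le> \<theta>" "(1 - \<rho> t) * \<theta> \<le> \<theta>"
      using l \<theta> by (simp_all add: mult_left_le_one_le)
    have "\<rho> t * \<phi> s \<le> \<rho> t * (2 * N + \<theta>)" using l(1) \<phi>[OF s] by (rule mult_left_mono[rotated])
    then have 1: "\<rho> t * \<phi> s \<le> t - u + N + \<theta>" using \<rho>N[of t] th(1) by (simp add: distrib_left)
    have "(1 - \<rho> t) * \<phi> s \<le> (1 - \<rho> t) * (2 * N + \<theta>)" using l(2) \<phi>[OF s] by (intro mult_left_mono) simp_all
    also have "\<dots> = 2 * N - \<rho> t * (2 * N) + (1 - \<rho> t) * \<theta>" by (simp add: algebra_simps)
    finally have 2: "(1 - \<rho> t) * \<phi> s \<le> N - t + u + \<theta>" using \<rho>N[of t] th(2) by simp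
    have "\<bar>foot \<gamma> (A s) - foot \<gamma> (X t s)\<bar> \<le> \<rho> t * \<phi> s" "\<bar>foot \<gamma> (X t s) - foot \<gamma> (B s)\<bar> \<le> (1 - \<rho> t) * \<phi> s"
      using foot_nonexpansive[OF \<gamma>, of "A s" "X t s"] foot_nonexpansive[OF \<gamma>, of "X t s" "B s"] dX[OF t] by simp_all
    then show ?thesis unfolding A(1)[OF s] B(1)[OF s] using 1 2 by linarith
  qed
  have X0: "X t 0 = \<gamma> t" if t: "\<bar>t - u\<bar> \<le> N" for t
  proof -
    have "A 0 = \<gamma> (u - N)" "B 0 = \<gamma> (u + N)" using hp hq by (simp_all add: A_def B_def perp_0[OF \<gamma>])
    then have "\<gamma> t = along (A 0) (B 0) (\<rho> t)"
      using \<rho>[OF t] \<rho>N[of t] t N by (intro along_unique) (auto simp: line_dist[OF \<gamma>] left_diff_distrib)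
    then show ?thesis by (simp add: X_def)
  qed
  have vert: "dist (X t s) (X t s') \<le> \<bar>s - s'\<bar>"
    if t: "\<bar>t - u\<bar> \<le> N" and s: "0 \<le> s" "s \<le> N" "0 \<le> s'" "s' \<le> N" for t s s'
  proof -
    have "dist (X t s) (X t s') \<le> (1 - \<rho> t) * dist (A s) (A s') + \<rho> t * dist (B s) (B s')"
      unfolding X_def by (rule dist_convex[OF \<rho>[OF t]])
    also have "\<dots> = \<bar>s - s'\<bar>" unfolding AB[OF s] by (simp add: algebra_simps)
    finally show ?thesis .
  qed
  have up: "height \<gamma> (X t s) \<le> s" if t: "\<bar>t - u\<bar> \<le> N" and s: "0 \<le> s" "s \<le> N" for t s
    using height_le[OF \<gamma>, of "X t s" t] vert[OF t s, of 0] X0[OF t] s N by simp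
  have top: "N - \<omega> \<le> height \<gamma> (X t N)" if t: "\<bar>t - u\<bar> \<le> N" for t
  proof -
    define z where "z = X t N"
    define k where "k = N - height \<gamma> z"
    define x1 where "x1 = foot \<gamma> z - (u - N)"
    define x2 where "x2 = u + N - foot \<gamma> z"
    define d1 where "d1 = dist (A N) z"
    have AN: "foot \<gamma> (A N) = u - N" "height \<gamma> (A N) = N" and BN: "foot \<gamma> (B N) = u + N" using A B N by simp_all
    have x1: "\<bar>x1\<bar> \<le> d1" using foot_nonexpansive[OF \<gamma>, of z "A N"] by (simp add: x1_def d1_def AN dist_commute)
    have x2: "x2 \<le> dist z (B N)" using foot_nonexpansive[OF \<gamma>, of z "B N"] by (simp add: x2_def BN)
    have sum: "d1 + dist z (B N) = \<phi> N" using dX[OF t, of N] by (simp add: d1_def z_def algebra_simps)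
    have diff: "d1 - x1 \<le> \<theta>" using sum x2 \<phi>[of N] N by (simp add: x1_def x2_def)
    have "0 \<le> dist z (B N)" by simp
    then have d1: "d1 \<le> 2 * N + \<theta>" using sum \<phi>[of N] N by linarith
    have "k\<^sup>2 + x1\<^sup>2 \<le> d1\<^sup>2"
      using foot_height_pythagoras[OF \<gamma>, of "A N" z] unfolding AN
      by (simp add: k_def x1_def d1_def power2_commute[of "u - N"])
    then have "k\<^sup>2 \<le> (d1 - x1) * (d1 + x1)" by (simp add: power2_eq_square algebra_simps)
    also have "\<dots> \<le> \<theta> * (2 * (2 * N + \<theta>))" using x1 diff d1 \<theta> by (intro mult_mono) auto
    finally have "k\<^sup>2 \<le> \<omega>\<^sup>2" using \<omega>(2) by (simp add: algebra_simps)
    then have "k \<le> \<omega>" using \<omega>(1) by (rule power2_le_imp_le)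
    then show ?thesis by (simp add: k_def z_def)
  qed
  have down: "s - \<omega> \<le> height \<gamma> (X t s)" if t: "\<bar>t - u\<bar> \<le> N" and s: "0 \<le> s" "s \<le> N" for t s
    using height_nonexpansive[OF \<gamma>, of "X t N" "X t s"] vert[OF t, of N s] top[OF t] s N by simp
  have horiz: "dist (X t s) (X t' s) \<le> \<bar>t - t'\<bar> * (1 + \<theta>)"
    if t: "\<bar>t - u\<bar> \<le> N" "\<bar>t' - u\<bar> \<le> N" and s: "0 \<le> s" "s \<le> N" for t t' s
  proof -
    have "dist (X t s) (X t' s) = \<bar>\<rho> t - \<rho> t'\<bar> * \<phi> s"
      unfolding X_def \<phi>_def by (rule dist_along_along) (use \<rho> t in auto)
    also have "\<dots> \<le> \<bar>\<rho> t - \<rho> t'\<bar> * ((2 * N) * (1 + \<theta>))"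
    proof (rule mult_left_mono)
      have "\<theta> * 1 \<le> \<theta> * (2 * N)" using \<theta> N by (intro mult_left_mono) auto
      then show "\<phi> s \<le> (2 * N) * (1 + \<theta>)" using \<phi>[OF s] by (simp add: algebra_simps)
    qed simp
    also have "\<bar>\<rho> t - \<rho> t'\<bar> * ((2 * N) * (1 + \<theta>)) = \<bar>\<rho> t * (2 * N) - \<rho> t' * (2 * N)\<bar> * (1 + \<theta>)"
      using N by (simp add: abs_mult flip: left_diff_distrib)
    also have "\<dots> = \<bar>t - t'\<bar> * (1 + \<theta>)" unfolding \<rho>N by simp
    finally show ?thesis .
  qed
  have lower: "dist (t, s) (t', s') - 2 * (\<theta> + \<omega>) \<le> dist (X t s) (X t' s')"
    if t: "\<bar>t - u\<bar> \<le> N" "\<bar>t' - u\<bar> \<le> N" and s: "0 \<le> s" "s \<le> N" "0 \<le> s'" "s' \<le> N" for t t' s s'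
  proof -
    define V where "V t s = (foot \<gamma> (X t s), height \<gamma> (X t s))" for t s
    have near: "dist (t, s) (V t s) \<le> \<theta> + \<omega>" if "\<bar>t - u\<bar> \<le> N" "0 \<le> s" "s \<le> N" for t s
    proof -
      have "dist (t, s) (V t s) \<le> \<bar>t - foot \<gamma> (X t s)\<bar> + \<bar>s - height \<gamma> (X t s)\<bar>"
        unfolding V_def by (rule dist_plane_le)
      moreover have "\<bar>s - height \<gamma> (X t s)\<bar> \<le> \<omega>" using up[OF that] down[OF that] \<omega>(1) by simp
      ultimately show ?thesis using foot[OF that] by (simp add: abs_minus_commute)
    qed
    have "(dist (V t s) (V t' s'))\<^sup>2 \<le> (dist (X t s) (X t' s'))\<^sup>2"
      using foot_height_pythagoras[OF \<gamma>, of "X t s" "X t' s'"] by (simp add: V_def dist_plane)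
    then have "dist (V t s) (V t' s') \<le> dist (X t s) (X t' s')" by (rule power2_le_imp_le) simp
    moreover have "dist (t, s) (t', s') \<le> dist (t, s) (V t s) + dist (V t s) (V t' s') + dist (t', s') (V t' s')"
      using dist_triangle[of "(t, s)" "(t', s')" "V t s"] dist_triangle[of "V t s" "(t', s')" "V t' s'"]
      by (simp add: dist_commute)
    moreover have "D - 2 * (\<theta> + \<omega>) \<le> E"
      if "B \<le> E" "D \<le> A + B + C" "A \<le> \<theta> + \<omega>" "C \<le> \<theta> + \<omega>" for A B C D E
      using that by simp
    ultimately show ?thesis using near[OF t(1) s(1,2)] near[OF t(2) s(3,4)] by blast
  qed
  have ran: "\<bar>t - u\<bar> \<le> N" if "t \<in> {u - N..u + N}" for t using that by (auto simp: abs_le_iff)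
  have "dist (X t s) (X t' s) \<le> \<bar>t - t'\<bar> * (1 + 2 * (\<theta> + \<omega>))"
    if "t \<in> {u - N..u + N}" "t' \<in> {u - N..u + N}" "s \<in> {0..N}" for t t' s
  proof -
    have "dist (X t s) (X t' s) \<le> \<bar>t - t'\<bar> * (1 + \<theta>)" by (rule horiz) (use that ran in auto)
    also have "\<dots> \<le> \<bar>t - t'\<bar> * (1 + 2 * (\<theta> + \<omega>))" using \<theta> \<omega>(1) by (intro mult_left_mono) auto
    finally show ?thesis .
  qed
  then have "almost_flat \<gamma> N u (2 * (\<theta> + \<omega>)) X"
    unfolding almost_flat_def using X0 vert lower ran by (intro conjI ballI) auto
  then show ?thesis by blast
qed

text \<open>
  A sequence of maps with values in compact balls has a cluster point for pointwise convergence, by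
  Tychonoff's theorem. Approximation at two points at a time is enough to pass to the limit in
  inequalities between distances.
\<close>

lemma pointwise_cluster_point:
  fixes F :: "nat \<Rightarrow> 'i \<Rightarrow> 'a::metric_space"
  assumes K: "\<And>z. compact (K z)" and F: "\<And>n z. F n z \<in> K z"
  shows "\<exists>\<Phi>. \<forall>z1 z2 e m. 0 < e \<longrightarrow> (\<exists>n\<ge>m. dist (F n z1) (\<Phi> z1) < e \<and> dist (F n z2) (\<Phi> z2) < e)"
proof -
  have "compactin (product_topology (\<lambda>_. euclidean) UNIV) (PiE UNIV K)"
    using K by (simp add: compactin_PiE)
  then have "compact (PiE UNIV K)" by (simp add: euclidean_product_topology)
  moreover have "filtermap F sequentially \<noteq> bot" by (simp add: filtermap_bot_iff)
  moreover have "eventually (\<lambda>f. f \<in> PiE UNIV K) (filtermap F sequentially)"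
    using F by (simp add: eventually_filtermap PiE_def)
  ultimately obtain \<Phi> where \<Phi>: "inf (nhds \<Phi>) (filtermap F sequentially) \<noteq> bot"
    unfolding compact_filter by blast
  have "\<exists>n\<ge>m. dist (F n z1) (\<Phi> z1) < e \<and> dist (F n z2) (\<Phi> z2) < e" if e: "0 < e" for z1 z2 e m
  proof (rule ccontr)
    assume no: "\<not> ?thesis"
    have near: "eventually (\<lambda>f. dist (f z) (\<Phi> z) < e) (nhds \<Phi>)" for z
    proof -
      have "open {f. dist (f z) (\<Phi> z) < e}"
        by (intro open_Collect_less continuous_on_dist continuous_on_product_coordinates continuous_on_const)
      then have "eventually (\<lambda>f. f \<in> {f. dist (f z) (\<Phi> z) < e}) (nhds \<Phi>)"
        by (rule eventually_nhds_in_open) (use e in simp)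
      then show ?thesis by simp
    qed
    have "eventually (\<lambda>f. dist (f z1) (\<Phi> z1) < e \<and> dist (f z2) (\<Phi> z2) < e) (nhds \<Phi>)"
      using near by (intro eventually_conj)
    moreover have "eventually (\<lambda>f. \<not> (dist (f z1) (\<Phi> z1) < e \<and> dist (f z2) (\<Phi> z2) < e)) (filtermap F sequentially)"
      unfolding eventually_filtermap using no by (intro eventually_sequentiallyI[of m]) blast
    ultimately have "eventually (\<lambda>f. False) (inf (nhds \<Phi>) (filtermap F sequentially))"
      unfolding eventually_inf by blast
    then show False using \<Phi> by (simp add: eventually_False)
  qed
  then show ?thesis by blast
qed

text \<open>
  In the limit, horizontal and vertical distances do not exceed the Euclidean ones and no distance is
  smaller than the Euclidean one; the quadrilateral inequality, applied to a rectangle, then bounds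
  the diagonals from above.
\<close>

lemma flat_half_plane_limit:
  fixes \<gamma> :: "real \<Rightarrow> 'a::cat0_space"
  assumes proper: "\<And>(x::'a) r. compact (cball x r)" and \<gamma>: "geodesic_on UNIV \<gamma>"
    and flat: "\<And>n. almost_flat \<gamma> (real (Suc n)) (u n) (\<epsilon> n) (X n)"
    and u: "\<And>n. \<bar>u n\<bar> \<le> l" and \<epsilon>: "\<epsilon> \<longlonglongrightarrow> 0"
  shows "bounds_flat_half_plane \<gamma>"
proof -
  define good where "good n t s \<longleftrightarrow> t \<in> {u n - real (Suc n)..u n + real (Suc n)} \<and> s \<in> {0..real (Suc n)}" for n t s
  have good0: "good n t s \<Longrightarrow> good n t 0" for n t s by (simp add: good_def)
  have X0: "good n t 0 \<Longrightarrow> X n t 0 = \<gamma> t"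
    and vert: "good n t s \<Longrightarrow> good n t s' \<Longrightarrow> dist (X n t s) (X n t s') \<le> \<bar>s - s'\<bar>"
    and horiz: "good n t s \<Longrightarrow> good n t' s \<Longrightarrow> dist (X n t s) (X n t' s) \<le> \<bar>t - t'\<bar> * (1 + \<epsilon> n)"
    and lower: "good n t s \<Longrightarrow> good n t' s' \<Longrightarrow> dist (t, s) (t', s') - \<epsilon> n \<le> dist (X n t s) (X n t' s')" for n t t' s s'
    using flat[of n] unfolding almost_flat_def good_def by blast+
  define F where "F n z = (if good n (fst z) (snd z) then X n (fst z) (snd z) else \<gamma> 0)" for n z
  have "F n z \<in> cball (\<gamma> 0) (\<bar>fst z\<bar> + \<bar>snd z\<bar>)" for n z
  proof (cases "good n (fst z) (snd z)")
    case True
    then have "dist (X n (fst z) 0) (X n (fst z) (snd z)) \<le> \<bar>snd z\<bar>"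
      using vert[OF good0[OF True] True] by simp
    moreover have "X n (fst z) 0 = \<gamma> (fst z)" using X0[OF good0[OF True]] .
    ultimately show ?thesis
      using True dist_triangle[of "\<gamma> 0" "F n z" "\<gamma> (fst z)"] by (simp add: F_def line_dist[OF \<gamma>])
  next
    case False
    then show ?thesis by (simp add: F_def)
  qed
  then obtain \<Phi> where cluster: "\<And>z1 z2 e m. 0 < e \<Longrightarrow>
      \<exists>n\<ge>m. dist (F n z1) (\<Phi> z1) < e \<and> dist (F n z2) (\<Phi> z2) < e"
    using pointwise_cluster_point[of "\<lambda>z. cball (\<gamma> 0) (\<bar>fst z\<bar> + \<bar>snd z\<bar>)" F] proper by metis
  have ev_good: "\<exists>m. \<forall>n\<ge>m. good n t s" if "0 \<le> s" for t s
  proof -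
    obtain m :: nat where m: "\<bar>t\<bar> + l + s \<le> real m" using real_arch_simple by blast
    have "good n t s" if "m \<le> n" for n
    proof -
      have "real m \<le> real (Suc n)" using that by simp
      then show ?thesis using m u[of n] \<open>0 \<le> s\<close> unfolding good_def atLeastAtMost_iff by linarith
    qed
    then show ?thesis by blast
  qed
  have ev_\<epsilon>: "\<exists>m. \<forall>n\<ge>m. \<bar>\<epsilon> n\<bar> < e" if "0 < e" for e
    using \<epsilon> that by (auto simp: lim_sequentially dist_real_def)
  have approx: "\<exists>n. good n t s \<and> good n t' s' \<and> \<bar>\<epsilon> n\<bar> < e \<and>
      \<bar>dist (\<Phi> (t, s)) (\<Phi> (t', s')) - dist (X n t s) (X n t' s')\<bar> < 2 * e"
    if e: "0 < e" and s: "0 \<le> s" "0 \<le> s'" for e t s t' s'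
  proof -
    obtain m1 m2 m3 where m: "\<forall>n\<ge>m1. good n t s" "\<forall>n\<ge>m2. good n t' s'" "\<forall>n\<ge>m3. \<bar>\<epsilon> n\<bar> < e"
      using ev_good s ev_\<epsilon>[OF e] by metis
    obtain n where n: "max m1 (max m2 m3) \<le> n" "dist (F n (t, s)) (\<Phi> (t, s)) < e" "dist (F n (t', s')) (\<Phi> (t', s')) < e"
      using cluster[OF e] by blast
    have g: "good n t s" "good n t' s'" "\<bar>\<epsilon> n\<bar> < e" using m n(1) by auto
    then have "F n (t, s) = X n t s" "F n (t', s') = X n t' s'" by (simp_all add: F_def)
    with n have d: "dist (X n t s) (\<Phi> (t, s)) < e" "dist (X n t' s') (\<Phi> (t', s')) < e" by simp_all
    have "dist (\<Phi> (t, s)) (\<Phi> (t', s')) \<le> dist (X n t s) (\<Phi> (t, s)) + dist (X n t s) (X n t' s') + dist (X n t' s') (\<Phi> (t', s'))"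
      using dist_triangle[of "\<Phi> (t, s)" "\<Phi> (t', s')" "X n t s"] dist_triangle[of "X n t s" "\<Phi> (t', s')" "X n t' s'"]
      by (simp add: dist_commute)
    moreover have "dist (X n t s) (X n t' s') \<le> dist (X n t s) (\<Phi> (t, s)) + dist (\<Phi> (t, s)) (\<Phi> (t', s')) + dist (X n t' s') (\<Phi> (t', s'))"
      using dist_triangle[of "X n t s" "X n t' s'" "\<Phi> (t, s)"] dist_triangle[of "\<Phi> (t, s)" "X n t' s'" "\<Phi> (t', s')"]
      by (simp add: dist_commute)
    ultimately have "\<bar>dist (\<Phi> (t, s)) (\<Phi> (t', s')) - dist (X n t s) (X n t' s')\<bar> < 2 * e" using d by linarith
    then show ?thesis using g by blast
  qed
  have low: "dist (t, s) (t', s') \<le> dist (\<Phi> (t, s)) (\<Phi> (t', s'))" if s: "0 \<le> s" "0 \<le> s'" for t s t' s'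
  proof (rule field_le_epsilon)
    fix e :: real assume e: "0 < e"
    have "0 < e / 3" using e by simp
    from approx[OF this s] obtain n where n: "good n t s" "good n t' s'" "\<bar>\<epsilon> n\<bar> < e / 3"
      "\<bar>dist (\<Phi> (t, s)) (\<Phi> (t', s')) - dist (X n t s) (X n t' s')\<bar> < 2 * (e / 3)" by blast
    have "dist (t, s) (t', s') - \<epsilon> n \<le> dist (X n t s) (X n t' s')"
      by (rule lower[OF n(1,2)])
    then show "dist (t, s) (t', s') \<le> dist (\<Phi> (t, s)) (\<Phi> (t', s')) + e" using n(3,4) by linarith
  qed
  have hor: "dist (\<Phi> (t, s)) (\<Phi> (t', s)) \<le> \<bar>t - t'\<bar>" if s: "0 \<le> s" for t s t'
  proof (rule field_le_epsilon)
    fix e :: real assume e: "0 < e"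
    define e' where "e' = e / (2 + \<bar>t - t'\<bar>)"
    have e': "0 < e'" "e' * (2 + \<bar>t - t'\<bar>) = e" using e by (simp_all add: e'_def add_pos_nonneg)
    from approx[OF e'(1) s s] obtain n where n: "good n t s" "good n t' s" "\<bar>\<epsilon> n\<bar> < e'"
      "\<bar>dist (\<Phi> (t, s)) (\<Phi> (t', s)) - dist (X n t s) (X n t' s)\<bar> < 2 * e'" by blast
    have "dist (X n t s) (X n t' s) \<le> \<bar>t - t'\<bar> * (1 + \<epsilon> n)"
      by (rule horiz[OF n(1,2)])
    also have "\<dots> \<le> \<bar>t - t'\<bar> * (1 + e')" using n(3) by (intro mult_left_mono) auto
    finally show "dist (\<Phi> (t, s)) (\<Phi> (t', s)) \<le> \<bar>t - t'\<bar> + e"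
      using n(4) unfolding e'(2)[symmetric] by (simp add: algebra_simps)
  qed
  have ver: "dist (\<Phi> (t, s)) (\<Phi> (t, s')) \<le> \<bar>s - s'\<bar>" if s: "0 \<le> s" "0 \<le> s'" for t s s'
  proof (rule field_le_epsilon)
    fix e :: real assume e: "0 < e"
    have "0 < e / 2" using e by simp
    from approx[OF this s] obtain n where n: "good n t s" "good n t s'"
      "\<bar>dist (\<Phi> (t, s)) (\<Phi> (t, s')) - dist (X n t s) (X n t s')\<bar> < 2 * (e / 2)" by blast
    have "dist (X n t s) (X n t s') \<le> \<bar>s - s'\<bar>"
      by (rule vert[OF n(1,2)])
    then show "dist (\<Phi> (t, s)) (\<Phi> (t, s')) \<le> \<bar>s - s'\<bar> + e" using n(3) by linarith
  qed
  have iso: "dist (\<Phi> (t, s)) (\<Phi> (t', s')) = dist (t, s) (t', s')" if s: "0 \<le> s" "0 \<le> s'" for t s t' s'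
  proof -
    let ?d = "\<lambda>a b c e. dist (\<Phi> (a, b)) (\<Phi> (c, e))"
    have sq: "(dist (t, s) (t', s'))\<^sup>2 = (t - t')\<^sup>2 + (s - s')\<^sup>2" by (simp add: dist_plane)
    have "(?d t s t' s')\<^sup>2 + (?d t' s t s')\<^sup>2 \<le> (?d t s t' s)\<^sup>2 + (?d t' s t' s')\<^sup>2 + (?d t' s' t s')\<^sup>2 + (?d t s' t s)\<^sup>2"
      by (rule quadrilateral_inequality)
    also have "\<dots> \<le> \<bar>t - t'\<bar>\<^sup>2 + \<bar>s - s'\<bar>\<^sup>2 + \<bar>t' - t\<bar>\<^sup>2 + \<bar>s' - s\<bar>\<^sup>2"
      using s hor ver by (intro add_mono power_mono) auto
    also have "\<dots> = 2 * (dist (t, s) (t', s'))\<^sup>2" unfolding sq by (simp add: power2_commute)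
    finally have up: "(?d t s t' s')\<^sup>2 + (?d t' s t s')\<^sup>2 \<le> 2 * (dist (t, s) (t', s'))\<^sup>2" .
    have "dist (t', s) (t, s') \<le> ?d t' s t s'" by (rule low[OF s])
    moreover have "dist (t', s) (t, s') = dist (t, s) (t', s')" by (simp add: dist_plane power2_commute)
    ultimately have "(dist (t, s) (t', s'))\<^sup>2 \<le> (?d t' s t s')\<^sup>2" by (intro power_mono) auto
    then have "(?d t s t' s')\<^sup>2 \<le> (dist (t, s) (t', s'))\<^sup>2" using up by linarith
    then have "?d t s t' s' \<le> dist (t, s) (t', s')" by (rule power2_le_imp_le) simp
    then show ?thesis using low[OF s, of t t'] by simp
  qed
  have base: "\<Phi> (t, 0) = \<gamma> t" for t
  proof -
    have "dist (\<gamma> t) (\<Phi> (t, 0)) \<le> 0 + e" if e: "0 < e" for e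
    proof -
      obtain m where m: "\<forall>n\<ge>m. good n t 0" using ev_good by blast
      obtain n where "m \<le> n" "dist (F n (t, 0)) (\<Phi> (t, 0)) < e" using cluster[OF e] by blast
      moreover from this have "F n (t, 0) = \<gamma> t" using m X0 by (simp add: F_def)
      ultimately show ?thesis by simp
    qed
    then have "dist (\<gamma> t) (\<Phi> (t, 0)) \<le> 0" by (rule field_le_epsilon)
    then show ?thesis by simp
  qed
  show ?thesis
    unfolding bounds_flat_half_plane_def
  proof (rule exI[of _ \<Phi>], intro conjI ballI)
    show "dist (\<Phi> a) (\<Phi> b) = dist a b" if "a \<in> UNIV \<times> {0..}" "b \<in> UNIV \<times> {0..}" for a b
      using that iso by auto
    show "\<Phi> ` (UNIV \<times> {0}) = range \<gamma>"
    proof (intro equalityI subsetI)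
      fix y assume "y \<in> \<Phi> ` (UNIV \<times> {0})" then show "y \<in> range \<gamma>" using base by auto
    next
      fix y assume "y \<in> range \<gamma>"
      then obtain t where "y = \<Phi> (t, 0)" using base by auto
      then show "y \<in> \<Phi> ` (UNIV \<times> {0})" by auto
    qed
  qed
qed

text \<open>
  If the line is not contracting, then for every \<open>N\<close> there are perpendiculars at distance \<open>2 * N\<close> that
  have hardly diverged at height \<open>N\<close>. They bound an almost flat rectangle, and powers of \<open>g\<close> translate
  these rectangles so that their bases exhaust the line.
\<close>

lemma axis_contracting_or_flat:
  fixes g :: "'a::cat0_space \<Rightarrow> 'a"
  assumes proper: "\<And>(x::'a) r. compact (cball x r)" and g: "isometry g"
    and \<gamma>: "geodesic_on UNIV \<gamma>" and l: "0 < l" "\<And>t. g (\<gamma> t) = \<gamma> (t + l)"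
    and flat: "\<not> bounds_flat_half_plane \<gamma>"
  shows "contracting (range \<gamma>)"
proof (rule ccontr)
  assume con: "\<not> contracting (range \<gamma>)"
  have thin: "\<exists>p q. height \<gamma> p = \<delta> \<and> height \<gamma> q = \<delta> \<and> \<bar>foot \<gamma> p - foot \<gamma> q\<bar> = b \<and> dist p q < b + \<theta>"
    if "0 < \<delta>" "0 < b" "0 < \<theta>" for \<delta> b \<theta>
    using diverging_perpendiculars_contracting[OF \<gamma> that] con by (metis not_le)
  define N where "N n = real (Suc n)" for n
  \<comment> \<open>An excess \<open>\<theta>\<close> of the top lets it sag by an amount of the order of \<open>sqrt (\<theta> * N)\<close>, which has to vanish.\<close>
  define \<theta> where "\<theta> n = 1 / N n ^ 3" for n
  define \<omega> where "\<omega> n = 3 / N n" for n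
  define \<epsilon> where "\<epsilon> n = 2 * (\<theta> n + \<omega> n)" for n
  have N1: "1 \<le> N n" for n by (simp add: N_def)
  have \<theta>0: "0 < \<theta> n" for n using N1[of n] by (simp add: \<theta>_def)
  have \<theta>N: "\<theta> n \<le> 1 / N n" for n
  proof -
    have "N n ^ 1 \<le> N n ^ 3" using N1[of n] by (intro power_increasing) auto
    then show ?thesis using N1[of n] unfolding \<theta>_def by (intro divide_left_mono) auto
  qed
  have \<omega>: "0 \<le> \<omega> n" "2 * \<theta> n * (2 * N n + \<theta> n) \<le> (\<omega> n)\<^sup>2" for n
  proof -
    show "0 \<le> \<omega> n" using N1[of n] by (simp add: \<omega>_def)
    have "1 / N n \<le> 1" using N1[of n] by simp
    then have "\<theta> n \<le> N n" using \<theta>N[of n] N1[of n] by linarith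
    then have "2 * \<theta> n * (2 * N n + \<theta> n) \<le> 2 * \<theta> n * (3 * N n)"
      using \<theta>0[of n] by (intro mult_left_mono) auto
    also have "\<dots> = 6 / (N n)\<^sup>2" using N1[of n] by (simp add: \<theta>_def power2_eq_square power3_eq_cube)
    also have "\<dots> \<le> (\<omega> n)\<^sup>2" by (simp add: \<omega>_def power_divide divide_right_mono)
    finally show "2 * \<theta> n * (2 * N n + \<theta> n) \<le> (\<omega> n)\<^sup>2" .
  qed
  have \<epsilon>: "\<epsilon> \<longlonglongrightarrow> 0"
  proof (rule Lim_null_comparison)
    have "(\<lambda>n. 8 * inverse (real (Suc n))) \<longlonglongrightarrow> 8 * 0" by (intro tendsto_mult_left LIMSEQ_inverse_real_of_nat)
    then show "(\<lambda>n. 8 / N n) \<longlonglongrightarrow> 0" unfolding N_def by (simp add: divide_inverse)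
    show "eventually (\<lambda>n. norm (\<epsilon> n) \<le> 8 / N n) sequentially"
    proof (rule always_eventually, rule allI)
      fix n show "norm (\<epsilon> n) \<le> 8 / N n" using \<theta>N[of n] \<theta>0[of n] \<omega>(1)[of n] by (simp add: \<epsilon>_def \<omega>_def)
    qed
  qed
  have rect: "\<exists>p q u. height \<gamma> p = N n \<and> foot \<gamma> p = u - N n \<and> height \<gamma> q = N n \<and> foot \<gamma> q = u + N n \<and>
      \<bar>u\<bar> \<le> l \<and> dist p q \<le> 2 * N n + \<theta> n" for n
  proof -
    have "\<exists>p q. height \<gamma> p = N n \<and> height \<gamma> q = N n \<and> \<bar>foot \<gamma> p - foot \<gamma> q\<bar> = 2 * N n \<and> dist p q < 2 * N n + \<theta> n"
      using N1[of n] \<theta>0[of n] by (intro thin) auto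
    then obtain p q where pq: "height \<gamma> p = N n" "height \<gamma> q = N n" "foot \<gamma> q = foot \<gamma> p + 2 * N n" "dist p q < 2 * N n + \<theta> n"
      by (metis (no_types, opaque_lifting) abs_if add.commute diff_add_cancel dist_commute minus_diff_eq)
    define v where "v = foot \<gamma> p + N n"
    define i where "i = - \<lfloor>v / l\<rfloor>"
    let ?G = "int_iterate g i"
    have f: "foot \<gamma> (?G x) = foot \<gamma> x + real_of_int i * l" "height \<gamma> (?G x) = height \<gamma> x" for x
      using foot_int_iterate[OF g \<gamma> l(2)] height_int_iterate[OF g \<gamma> l(2)] by auto
    have "0 \<le> (v / l + real_of_int i) * l" "(v / l + real_of_int i) * l \<le> 1 * l"
      using l(1) by (intro mult_nonneg_nonneg mult_right_mono; simp add: i_def; linarith)+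
    then have v: "\<bar>v + real_of_int i * l\<bar> \<le> l" using l(1) by (simp add: distrib_right)
    show ?thesis
      by (rule exI[of _ "?G p"], rule exI[of _ "?G q"], rule exI[of _ "v + real_of_int i * l"])
        (use pq f v isometry_dist[OF isometry_int_iterate[OF g], of i p q] in \<open>simp add: v_def\<close>)
  qed
  have "\<exists>X u. \<bar>u\<bar> \<le> l \<and> almost_flat \<gamma> (N n) u (\<epsilon> n) X" for n
  proof -
    obtain p q u where "height \<gamma> p = N n" "foot \<gamma> p = u - N n" "height \<gamma> q = N n" "foot \<gamma> q = u + N n"
      and u: "\<bar>u\<bar> \<le> l" and "dist p q \<le> 2 * N n + \<theta> n" using rect by blast
    then have "\<exists>X. almost_flat \<gamma> (N n) u (\<epsilon> n) X"
      unfolding \<epsilon>_def using N1[of n] \<theta>0[of n] \<omega>[of n] by (intro almost_flat_rectangle[OF \<gamma>]) simp_all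
    then show ?thesis using u by blast
  qed
  then obtain X u where "\<And>n. \<bar>u n\<bar> \<le> l" "\<And>n. almost_flat \<gamma> (real (Suc n)) (u n) (\<epsilon> n) (X n)"
    unfolding N_def by metis
  then have "bounds_flat_half_plane \<gamma>"
    using flat_half_plane_limit[of \<gamma> u \<epsilon> X l] proper \<gamma> \<epsilon> by blast
  then show False using flat by blast
qed

lemma bounds_flat_half_plane_range:
  assumes "range \<beta> = range \<gamma>" shows "bounds_flat_half_plane \<beta> \<longleftrightarrow> bounds_flat_half_plane \<gamma>"
  unfolding bounds_flat_half_plane_def assms ..

lemma contracting_iff_rank_one:
  fixes g :: "'a::cat0_space \<Rightarrow> 'a"
  assumes proper: "\<And>(x::'a) r. compact (cball x r)" and g: "isometry g"
  shows "contracting_isometry g \<longleftrightarrow> rank_one g"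
proof
  assume "contracting_isometry g"
  then obtain \<gamma> where *: "hyperbolic g" "is_axis g \<gamma>" "contracting (range \<gamma>)"
    unfolding contracting_isometry_def by blast
  moreover from *(2) have "geodesic_on UNIV \<gamma>" by (simp add: is_axis_def)
  ultimately show "rank_one g" unfolding rank_one_def using contracting_no_flat_half_plane by blast
next
  assume "rank_one g"
  then obtain \<gamma> where *: "hyperbolic g" "is_axis g \<gamma>" "\<not> bounds_flat_half_plane \<gamma>"
    unfolding rank_one_def by blast
  obtain \<beta> l where \<beta>: "geodesic_on UNIV \<beta>" "range \<beta> = range \<gamma>" "0 < l" "\<And>t. g (\<beta> t) = \<beta> (t + l)"
    using positive_axis[OF *(2)] by blast
  have "contracting (range \<beta>)"
    by (rule axis_contracting_or_flat[OF proper g \<beta>(1,3,4)]) (use * bounds_flat_half_plane_range[OF \<beta>(2)] in simp)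
  then show "contracting_isometry g" unfolding contracting_isometry_def \<beta>(2) using * by blast
qed

theorem theorem3:
  fixes g :: "'a::cat0_space \<Rightarrow> 'a"
    and w :: "nat \<Rightarrow> real"
  assumes "curtain_weights w"
    and "isometry g"
    and "semisimple g"
  shows "(contracting_isometry g \<longleftrightarrow> (\<exists>h h'. separated h h' \<and> skewers g h h'))
    \<and> ((\<exists>h h'. separated h h' \<and> skewers g h h') \<longleftrightarrow> acts_loxodromically (curtain_dist w) g)
    \<and> ((\<forall>(x::'a) r. compact (cball x r)) \<longrightarrow> (contracting_isometry g \<longleftrightarrow> rank_one g))"
proof -
  have "\<exists>h h'. separated h h' \<and> skewers g h h'" if "contracting_isometry g"
    using that by (rule contracting_skewers)
  moreover have "acts_loxodromically (curtain_dist w) g" if "\<exists>h h'. separated h h' \<and> skewers g h h'"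
    using that skewers_linear_L_chains[OF assms(2)] loxodromic_if_linear_L_chains[OF assms(1,2)] by blast
  moreover have "contracting_isometry g" if "acts_loxodromically (curtain_dist w) g"
    by (rule linear_L_chains_contracting[OF assms(3) linear_L_chains_if_loxodromic[OF assms(1,2) that]])
  moreover have "contracting_isometry g \<longleftrightarrow> rank_one g" if "\<forall>(x::'a) r. compact (cball x r)"
    by (rule contracting_iff_rank_one[OF _ assms(2)]) (use that in blast)
  ultimately show ?thesis by blast
qed

end
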